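(* If $\hat\rho_1\in\mathcal A_1$ (i.e. $\rho_1$ is $G$-invariant), then $$\lim_{n\to\infty}\frac1n\log P_{\min}(\rho_0^{\otimes n}:\rho_1^{\otimes n})\le\liminf_{n\to\infty}\frac1n\log P_{\min}(\rho_{0,n}:\rho_{1,n})\le\limsup_{n\to\infty}\frac1n\log P_{\min}(\rho_{0,n}:\rho_{1,n})\le\frac12\lim_{n\to\infty}\frac1n\log P_{\min}(\rho_0^{\otimes n}:\rho_1^{\otimes n}).$$
   Context: Let $\mathcal H$ be a finite-dimensional complex Hilbert space, $G$ a compact group and $g\mapsto u_g$ a continuous unitary representation of $G$ on $\mathcal H$. For $n\in\mathbb N$ let $\mathcal A_n=\{A\in\mathcal B(\mathcal H^{\otimes n}):Au_g^{\otimes n}=u_g^{\otimes n}A\ \forall g\in G\}$ and $E_{\mathcal A_n}(X)=\int_G u_g^{\otimes n}Xu_g^{*\otimes n}\,dg$ (normalized Haar measure). Let $\rho_0,\rho_1$ be states on $\mathcal B(\mathcal H)$ with densities $\hat\rho_0,\hat\rho_1$, and $\hat\rho_{k,n}:=E_{\mathcal A_n}(\hat\rho_k^{\otimes n})$. Define $P_{\min}(\rho_{0,n}:\rho_{1,n}):=\min\{\operatorname{Tr}\hat\rho_0^{\otimes n}(I-T)+\operatorname{Tr}\hat\rho_1^{\otimes n}T:\ T\in\mathcal A_n,\ 0\le T\le I\}$ and $P_{\min}(\rho_0^{\otimes n}:\rho_1^{\otimes n}):=\min\{\operatorname{Tr}\hat\rho_0^{\otimes n}(I-T)+\operatorname{Tr}\hat\rho_1^{\otimes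 n}T:\ T\in\mathcal B(\mathcal H^{\otimes n}),\ 0\le T\le I\}$. The limit $\lim_n\frac1n\log P_{\min}(\rho_0^{\otimes n}:\rho_1^{\otimes n})$ exists (and equals $\min_{0\le s\le1}\log\operatorname{Tr}\hat\rho_0^s\hat\rho_1^{1-s}$, by the quantum Chernoff bound). *)

theory Defs
  imports "HOL-Analysis.Analysis" "HOL-Algebra.Group" "Jordan_Normal_Form.Matrix"
begin

text \<open>Finite-dimensional Hilbert space H = C^d; operators are d x d complex matrices.\<close>

definition adj :: "complex mat \<Rightarrow> complex mat" where
  "adj A = mat (dim_col A) (dim_row A) (\<lambda>(i,j). cnj (A $$ (j,i)))"

definition unitary_mat :: "nat \<Rightarrow> complex mat \<Rightarrow> bool" where
  "unitary_mat d U \<longleftrightarrow> U \<in> carrier_mat d d \<and> adj U * U = 1\<^sub>m d \<and> U * adj U = 1\<^sub>m d"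

definition psd :: "nat \<Rightarrow> complex mat \<Rightarrow> bool" where
  "psd d A \<longleftrightarrow> A \<in> carrier_mat d d \<and>
     (\<forall>v \<in> carrier_vec d. let z = (\<Sum>i<d. \<Sum>j<d. cnj (v $ i) * A $$ (i,j) * v $ j)
                           in Im z = 0 \<and> Re z \<ge> 0)"

definition mtrace :: "complex mat \<Rightarrow> complex" where
  "mtrace A = (\<Sum>i<dim_row A. A $$ (i,i))"

definition density :: "nat \<Rightarrow> complex mat \<Rightarrow> bool" where
  "density d \<rho> \<longleftrightarrow> psd d \<rho> \<and> mtrace \<rho> = 1"

definition kron :: "complex mat \<Rightarrow> complex mat \<Rightarrow> complex mat" where
  "kron A B = mat (dim_row A * dim_row B) (dim_col A * dim_col B)
     (\<lambda>(i,j). A $$ (i div dim_row B, j div dim_col B) * B $$ (i mod dim_row B, j mod dim_col B))"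

fun tpow :: "complex mat \<Rightarrow> nat \<Rightarrow> complex mat" where
  "tpow A 0 = 1\<^sub>m 1"
| "tpow A (Suc n) = kron (tpow A n) A"

definition err :: "nat \<Rightarrow> complex mat \<Rightarrow> complex mat \<Rightarrow> nat \<Rightarrow> complex mat \<Rightarrow> real" where
  "err d \<rho>0 \<rho>1 n T = Re (mtrace (tpow \<rho>0 n * (1\<^sub>m (d^n) - T)) + mtrace (tpow \<rho>1 n * T))"

definition is_test :: "nat \<Rightarrow> nat \<Rightarrow> complex mat \<Rightarrow> bool" where
  "is_test d n T \<longleftrightarrow> psd (d^n) T \<and> psd (d^n) (1\<^sub>m (d^n) - T)"

text \<open>P_min(rho_0^n : rho_1^n): optimum over all tests (the minimum is attained, so Inf = min).\<close>
definition Pmin_full :: "nat \<Rightarrow> complex mat \<Rightarrow> complex mat \<Rightarrow> nat \<Rightarrow> real" where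
  "Pmin_full d \<rho>0 \<rho>1 n = Inf {err d \<rho>0 \<rho>1 n T | T. is_test d n T}"

text \<open>P_min(rho_{0,n} : rho_{1,n}): optimum over tests in the commutant A_n of u_g^{(x)n}, g in G.\<close>
definition Pmin_inv :: "nat \<Rightarrow> ('g \<Rightarrow> complex mat) \<Rightarrow> 'g set \<Rightarrow> complex mat \<Rightarrow> complex mat \<Rightarrow> nat \<Rightarrow> real" where
  "Pmin_inv d u Gs \<rho>0 \<rho>1 n = Inf {err d \<rho>0 \<rho>1 n T | T. is_test d n T \<and>
      (\<forall>g \<in> Gs. T * tpow (u g) n = tpow (u g) n * T)}"

definition lnE :: "real \<Rightarrow> ereal" where
  "lnE x = (if x = 0 then - \<infinity> else ereal (ln x))"

end

theory Submission
  imports Defs "HOL-Computational_Algebra.Computational_Algebra"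
    "HOL-Real_Asymp.Real_Asymp"
begin

text \<open>
  Let \<open>P n\<close> be the optimal error for \<open>\<rho>0\<^sup>\<otimes>\<^sup>n\<close> and \<open>\<rho>1\<^sup>\<otimes>\<^sup>n\<close>, and let \<open>c n\<close> be the optimal error
  for the classical Nussbaum-Szkola distributions, which pair the eigenprojections of the two states.
  Then \<open>c n / 2 \<le> P n \<le> p n * c n\<close> with a polynomial \<open>p\<close>, because \<open>\<rho>0\<^sup>\<otimes>\<^sup>n\<close> has only polynomially many
  distinct eigenvalues. As \<open>c\<close> is supermultiplicative, the rate of \<open>P\<close> exists by Fekete's lemma.

  For the factor 1/2, let \<open>T\<close> be any test of error \<open>e\<close>. The span of the operators \<open>u\<^sub>g\<^sup>\<otimes>\<^sup>n\<close> has
  polynomial dimension \<open>D\<close>, and averaging \<open>T\<close> over it gives an invariant \<open>M \<ge> T\<close> with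
  \<open>Tr \<rho>1\<^sup>\<otimes>\<^sup>n M \<le> D Tr \<rho>1\<^sup>\<otimes>\<^sup>n T\<close>; this is where the invariance of \<open>\<rho>1\<close> enters. The spectral projection of
  \<open>M\<close> above the threshold \<open>\<surd>e\<close> is an invariant test of error at most \<open>(D + 6) \<surd>e\<close>.
\<close>

section \<open>Finitely supported matrices\<close>

text \<open>The exponent is halved by the choice of threshold. Above a threshold \<delta>, Markov's
  inequality costs the second state at most \<open>D * e / \<delta>\<close>. Below it,
  \<open>T \<le> M \<le> \<delta>\<close> makes \<open>T\<close> nearly reject, which leaves the
  first state an error of order \<open>\<delta> + e\<close>. The two costs balance at
  \<open>\<delta> = sqrt e\<close>, and all other losses are polynomial in \<open>n\<close>, so they
  vanish on the exponential scale. The domination \<open>T \<le> M\<close> is what makes the second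
  half work: it turns smallness of the invariant operator into smallness of the given test. The
  claim speaks of \<open>lim\<close>, a definite description that carries information only after
  convergence is proved. The classical error supplies this, since
  \<open>min s t * min s' t' \<le> min (s * s') (t * t')\<close> for nonnegative numbers makes it
  supermultiplicative. States with orthogonal supports are a separate case, in which both rates are
  \<open>- \<infinity>\<close>.\<close>

text \<open>The dimension \<open>d ^ n\<close> varies, so matrices of all sizes are put into one ring without unit;
  \<open>idn m\<close> below is the unit of the corner of the matrices \<open>X\<close> with \<open>fits m X\<close>, and the inner product
  is the real part of the trace of \<open>adjf X * Y\<close>.\<close>

typedef fmat = "{f :: nat \<Rightarrow> nat \<Rightarrow> complex. \<exists>m. \<forall>i j. f i j \<noteq> 0 \<longrightarrow> i < m \<and> j < m}"
  morphisms ent mk_fmat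
  by (rule exI[of _ "\<lambda>_ _. 0"]) auto

definition fits :: "nat \<Rightarrow> fmat \<Rightarrow> bool" where
  "fits m X \<longleftrightarrow> (\<forall>i j. ent X i j \<noteq> 0 \<longrightarrow> i < m \<and> j < m)"

lemma fits_ex: "\<exists>m. fits m X"
  using ent[of X] by (auto simp: fits_def)

lemma fits_mono: "fits m X \<Longrightarrow> m \<le> n \<Longrightarrow> fits n X"
  unfolding fits_def by (meson order_less_le_trans)

lemma fits_ex2: "\<exists>m. fits m X \<and> fits m Y"
proof -
  obtain a b where "fits a X" "fits b Y" using fits_ex by blast
  then have "fits (max a b) X \<and> fits (max a b) Y"
    by (auto intro: fits_mono)
  then show ?thesis by blast
qed

lemma fits_ex3: "\<exists>m. fits m X \<and> fits m Y \<and> fits m Z"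
proof -
  obtain a b where "fits a X" "fits a Y" "fits b Z" using fits_ex fits_ex2 by metis
  then have "fits (max a b) X \<and> fits (max a b) Y \<and> fits (max a b) Z"
    by (auto intro: fits_mono)
  then show ?thesis by blast
qed

lemma fits_zero: "fits m X \<Longrightarrow> \<not> (i < m \<and> j < m) \<Longrightarrow> ent X i j = 0"
  by (auto simp: fits_def)

lemma fmat_eqI: "(\<And>i j. ent X i j = ent Y i j) \<Longrightarrow> X = Y"
  by (metis ent_inject ext)

lemma ent_mk: "(\<And>i j. f i j \<noteq> 0 \<Longrightarrow> i < m \<and> j < m) \<Longrightarrow> ent (mk_fmat f) = f"
  by (rule mk_fmat_inverse) blast

instantiation fmat :: real_algebra
begin

definition "0 = mk_fmat (\<lambda>_ _. 0)"
definition "X + Y = mk_fmat (\<lambda>i j. ent X i j + ent Y i j)"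
definition "X - Y = mk_fmat (\<lambda>i j. ent X i j - ent Y i j)"
definition "- X = mk_fmat (\<lambda>i j. - ent X i j)"
definition "r *\<^sub>R X = mk_fmat (\<lambda>i j. r *\<^sub>R ent X i j)"
text \<open>Each row has finite support, so the product needs no common size of the factors.\<close>

definition "X * Y = mk_fmat (\<lambda>i j. \<Sum>k\<in>{k. ent X i k \<noteq> 0}. ent X i k * ent Y k j)"

lemma ent_zero: "ent 0 i j = 0"
  unfolding zero_fmat_def by (subst ent_mk) auto

lemma ent_add: "ent (X + Y) i j = ent X i j + ent Y i j"
proof -
  obtain m where "fits m X \<and> fits m Y" using fits_ex2 by blast
  then show ?thesis unfolding plus_fmat_def
    by (subst ent_mk[of _ m]) (auto simp: fits_def, (metis add.right_neutral)+)
qed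

lemma ent_uminus: "ent (- X) i j = - ent X i j"
proof -
  obtain m where "fits m X" using fits_ex by blast
  then show ?thesis unfolding uminus_fmat_def
    by (subst ent_mk[of _ m]) (auto simp: fits_def)
qed

lemma ent_diff: "ent (X - Y) i j = ent X i j - ent Y i j"
proof -
  obtain m where "fits m X \<and> fits m Y" using fits_ex2 by blast
  then show ?thesis unfolding minus_fmat_def
    by (subst ent_mk[of _ m]) (auto simp: fits_def, metis+)
qed

lemma ent_scaleR: "ent (r *\<^sub>R X) i j = r *\<^sub>R ent X i j"
proof -
  obtain m where "fits m X" using fits_ex by blast
  then show ?thesis unfolding scaleR_fmat_def
    by (subst ent_mk[of _ m]) (auto simp: fits_def)
qed

lemma ent_mult_left:
  assumes "fits m X" shows "ent (X * Y) i j = (\<Sum>k<m. ent X i k * ent Y k j)"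
proof -
  obtain n where n: "fits n X \<and> fits n Y" using fits_ex2 by blast
  have "ent (X * Y) = (\<lambda>i j. \<Sum>k\<in>{k. ent X i k \<noteq> 0}. ent X i k * ent Y k j)"
    unfolding times_fmat_def
  proof (rule ent_mk[of _ n])
    fix i j assume "(\<Sum>k\<in>{k. ent X i k \<noteq> 0}. ent X i k * ent Y k j) \<noteq> 0"
    then obtain k where "ent X i k * ent Y k j \<noteq> 0" by (meson sum.neutral)
    then show "i < n \<and> j < n" using n by (auto simp: fits_def)
  qed
  moreover have "(\<Sum>k\<in>{k. ent X i k \<noteq> 0}. ent X i k * ent Y k j) = (\<Sum>k<m. ent X i k * ent Y k j)"
    using assms by (intro sum.mono_neutral_left) (auto simp: fits_def)
  ultimately show ?thesis by simp
qed

lemma fits_mult: "fits m X \<Longrightarrow> fits m Y \<Longrightarrow> fits m (X * Y)"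
  by (subst fits_def, auto simp: ent_mult_left)
    (metis (no_types, lifting) fits_zero mult_eq_0_iff sum.neutral)+

instance
proof
  fix X Y Z :: fmat and a b :: real
  obtain m where m: "fits m X" "fits m Y" "fits m Z" using fits_ex3 by blast
  show "X * Y * Z = X * (Y * Z)"
  proof (rule fmat_eqI)
    fix i j
    have "ent (X * Y * Z) i j = (\<Sum>k<m. (\<Sum>l<m. ent X i l * ent Y l k) * ent Z k j)"
      using m by (simp add: ent_mult_left[of m] fits_mult)
    also have "\<dots> = (\<Sum>k<m. \<Sum>l<m. ent X i l * (ent Y l k * ent Z k j))"
      by (simp add: sum_distrib_right mult.assoc)
    also have "\<dots> = (\<Sum>l<m. \<Sum>k<m. ent X i l * (ent Y l k * ent Z k j))"
      by (rule sum.swap)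
    also have "\<dots> = ent (X * (Y * Z)) i j"
      using m by (simp add: ent_mult_left[of m] sum_distrib_left)
    finally show "ent (X * Y * Z) i j = ent (X * (Y * Z)) i j" .
  qed
  show "(X + Y) * Z = X * Z + Y * Z"
  proof (rule fmat_eqI)
    fix i j
    have "fits m (X + Y)" using m by (auto simp: fits_def ent_add) (metis add.right_neutral)+
    then show "ent ((X + Y) * Z) i j = ent (X * Z + Y * Z) i j"
      using m by (simp add: ent_mult_left[of m] ent_add algebra_simps sum.distrib)
  qed
  show "X * (Y + Z) = X * Y + X * Z"
    using m by (intro fmat_eqI) (simp add: ent_mult_left[of m] ent_add algebra_simps sum.distrib)
  have fa: "fits m (a *\<^sub>R X)" using m by (auto simp: fits_def ent_scaleR)
  show "a *\<^sub>R X * Y = a *\<^sub>R (X * Y)"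
    using m fa by (intro fmat_eqI) (simp add: ent_mult_left[of m] ent_scaleR scaleR_right.sum)
  show "X * a *\<^sub>R Y = a *\<^sub>R (X * Y)"
    using m by (intro fmat_eqI) (simp add: ent_mult_left[of m] ent_scaleR scaleR_right.sum)
qed (auto intro!: fmat_eqI simp: ent_add ent_zero ent_diff ent_uminus ent_scaleR algebra_simps)

end

definition adjf :: "fmat \<Rightarrow> fmat" where
  "adjf X = mk_fmat (\<lambda>i j. cnj (ent X j i))"

lemma ent_adjf: "ent (adjf X) i j = cnj (ent X j i)"
proof -
  obtain m where "fits m X" using fits_ex by blast
  then show ?thesis unfolding adjf_def
    by (subst ent_mk[of _ m]) (auto simp: fits_def)
qed

lemma fits_adjf: "fits m (adjf X) \<longleftrightarrow> fits m X"
  by (auto simp: fits_def ent_adjf)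

lemma adjf_adjf [simp]: "adjf (adjf X) = X"
  by (rule fmat_eqI) (simp add: ent_adjf)

lemma adjf_mult: "adjf (X * Y) = adjf Y * adjf X"
proof (rule fmat_eqI)
  fix i j
  obtain m where "fits m X \<and> fits m Y" using fits_ex2 by blast
  then show "ent (adjf (X * Y)) i j = ent (adjf Y * adjf X) i j"
    by (simp add: ent_adjf ent_mult_left[of m] fits_adjf mult.commute)
qed

lemma adjf_add: "adjf (X + Y) = adjf X + adjf Y"
  and adjf_diff: "adjf (X - Y) = adjf X - adjf Y"
  and adjf_zero [simp]: "adjf 0 = 0"
  and adjf_scaleR: "adjf (r *\<^sub>R X) = r *\<^sub>R adjf X"
  by (auto intro!: fmat_eqI simp: ent_adjf ent_add ent_diff ent_zero ent_scaleR)

lemma adjf_sum: "adjf (\<Sum>i\<in>I. f i) = (\<Sum>i\<in>I. adjf (f i))"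
  by (induction I rule: infinite_finite_induct) (auto simp: adjf_add)

lemma ent_sum: "ent (\<Sum>i\<in>I. f i) a b = (\<Sum>i\<in>I. ent (f i) a b)"
  by (induction I rule: infinite_finite_induct) (auto simp: ent_add ent_zero)

section \<open>The Hilbert-Schmidt inner product\<close>

instantiation fmat :: real_inner
begin

definition "inner X Y = (\<Sum>(i,j)\<in>{(i,j). ent X i j \<noteq> 0}. Re (cnj (ent X i j) * ent Y i j))"
definition "norm (X::fmat) = sqrt (inner X X)"
definition "sgn (X::fmat) = X /\<^sub>R norm X"
definition "dist (X::fmat) Y = norm (X - Y)"
definition [code del]:
  "(uniformity :: (fmat \<times> fmat) filter) = (INF e\<in>{0 <..}. principal {(x, y). dist x y < e})"
definition [code del]:
  "open (U :: fmat set) \<longleftrightarrow> (\<forall>x\<in>U. \<forall>\<^sub>F (x', y) in uniformity. x' = x \<longrightarrow> y \<in> U)"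

lemma inner_fmat:
  assumes "fits m X"
  shows "inner X Y = (\<Sum>i<m. \<Sum>j<m. Re (cnj (ent X i j) * ent Y i j))"
proof -
  have "inner X Y = (\<Sum>(i,j)\<in>{..<m} \<times> {..<m}. Re (cnj (ent X i j) * ent Y i j))"
    unfolding inner_fmat_def using assms
    by (intro sum.mono_neutral_left) (auto simp: fits_def)
  then show ?thesis by (simp add: sum.cartesian_product)
qed

instance
proof
  fix X Y Z :: fmat and r :: real
  obtain m where m: "fits m X" "fits m Y" "fits m Z" using fits_ex3 by blast
  show "inner X Y = inner Y X"
    using m by (simp add: inner_fmat algebra_simps)
  have "fits m (X + Y)" using m by (auto simp: fits_def ent_add) (metis add.right_neutral)+
  then show "inner (X + Y) Z = inner X Z + inner Y Z"
    using m by (simp add: inner_fmat ent_add algebra_simps sum.distrib)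
  have "fits m (r *\<^sub>R X)" using m by (auto simp: fits_def ent_scaleR)
  then show "inner (r *\<^sub>R X) Y = r * inner X Y"
    using m by (simp add: inner_fmat ent_scaleR algebra_simps sum_distrib_left)
  have i: "inner X X = (\<Sum>i<m. \<Sum>j<m. (cmod (ent X i j))\<^sup>2)"
    using m by (simp add: inner_fmat cmod_power2 flip: power2_eq_square)
  then show "0 \<le> inner X X" by (simp add: sum_nonneg)
  show "inner X X = 0 \<longleftrightarrow> X = 0"
  proof
    assume "inner X X = 0"
    then have "\<And>i j. i < m \<Longrightarrow> j < m \<Longrightarrow> ent X i j = 0"
      using i by (simp add: sum_nonneg_eq_0_iff sum_nonneg)
    then show "X = 0" using m by (intro fmat_eqI) (metis ent_zero fits_zero)
  qed (simp add: inner_fmat_def ent_zero)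
qed (simp_all add: norm_fmat_def sgn_fmat_def dist_fmat_def uniformity_fmat_def open_fmat_def)

end

lemma inner_adjf: "inner (adjf X) (adjf Y) = inner X Y"
proof -
  obtain m where m: "fits m X" using fits_ex by blast
  then have "inner (adjf X) (adjf Y) = (\<Sum>i<m. \<Sum>j<m. Re (cnj (ent X j i) * ent Y j i))"
    by (simp add: inner_fmat[of m] fits_adjf ent_adjf)
  also have "\<dots> = inner X Y" using m by (subst sum.swap) (simp add: inner_fmat)
  finally show ?thesis .
qed

lemma norm_adjf: "norm (adjf X) = norm X"
  by (simp add: norm_eq_sqrt_inner inner_adjf)

text \<open>Together with \<open>inner_mult_right\<close> this is cyclicity of the trace in the form
  used below: a factor moves to the other argument as its adjoint.\<close>

lemma inner_mult_left: "inner (A * X) Y = inner X (adjf A * Y)"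
proof -
  obtain m where m: "fits m A" "fits m X" "fits m Y" using fits_ex3 by blast
  have "inner (A * X) Y = (\<Sum>i<m. \<Sum>j<m. \<Sum>k<m. Re (cnj (ent A i k) * cnj (ent X k j) * ent Y i j))"
    using m by (simp add: inner_fmat[of m] fits_mult ent_mult_left[of m] sum_distrib_right
        flip: Re_sum del: times_complex.sel)
  also have "\<dots> = (\<Sum>k<m. \<Sum>j<m. \<Sum>i<m. Re (cnj (ent A i k) * cnj (ent X k j) * ent Y i j))"
    by (subst sum.swap, subst (2) sum.swap, subst sum.swap) simp
  also have "\<dots> = inner X (adjf A * Y)"
    using m by (simp add: inner_fmat[of m] fits_adjf ent_adjf ent_mult_left[of m] sum_distrib_left
        mult.assoc mult.left_commute flip: Re_sum del: times_complex.sel)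
  finally show ?thesis .
qed

lemma inner_mult_right: "inner (X * A) Y = inner X (Y * adjf A)"
  by (metis adjf_adjf adjf_mult inner_adjf inner_mult_left)

hide_const (open) Module.smult

definition idn :: "nat \<Rightarrow> fmat" where
  "idn m = mk_fmat (\<lambda>i j. if i = j \<and> i < m then 1 else 0)"

lemma ent_idn: "ent (idn m) i j = (if i = j \<and> i < m then 1 else 0)"
  unfolding idn_def by (subst ent_mk[of _ m]) (auto split: if_splits)

lemma fits_idn [simp]: "fits m (idn m)"
  by (auto simp: fits_def ent_idn)

lemma adjf_idn [simp]: "adjf (idn m) = idn m"
  by (rule fmat_eqI) (auto simp: ent_adjf ent_idn)

lemma ent_idn_mult: "ent (idn m * X) i j = (if i < m then ent X i j else 0)"
proof -
  have "ent (idn m * X) i j = (\<Sum>k<m. if k = i then ent X k j else 0)"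
    unfolding ent_mult_left[OF fits_idn] by (rule sum.cong) (auto simp: ent_idn)
  then show ?thesis by simp
qed

lemma idn_mult: "fits m X \<Longrightarrow> idn m * X = X"
  by (rule fmat_eqI) (auto simp: ent_idn_mult fits_def)

lemma mult_idn: "fits m X \<Longrightarrow> X * idn m = X"
  by (metis adjf_adjf adjf_idn adjf_mult fits_adjf idn_mult)

lemma idn_idn [simp]: "idn m * idn m = idn m"
  by (simp add: idn_mult)

lemma fits_zero_fmat [simp]: "fits m 0"
  by (simp add: fits_def ent_zero)

lemma fits_add: "fits m X \<Longrightarrow> fits m Y \<Longrightarrow> fits m (X + Y)"
  by (auto simp: fits_def ent_add) (metis add.right_neutral)+

lemma fits_diff: "fits m X \<Longrightarrow> fits m Y \<Longrightarrow> fits m (X - Y)"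
  by (auto simp: fits_def ent_diff) metis+

lemma fits_scaleR: "fits m X \<Longrightarrow> fits m (r *\<^sub>R X)"
  by (auto simp: fits_def ent_scaleR)

lemma fits_sum: "(\<And>i. i \<in> I \<Longrightarrow> fits m (f i)) \<Longrightarrow> fits m (\<Sum>i\<in>I. f i)"
  by (induction I rule: infinite_finite_induct) (auto simp: fits_add)

lemmas fits_intros = fits_mult fits_add fits_diff fits_scaleR fits_sum fits_idn fits_zero_fmat

text \<open>Left multiplication by \<open>idn m\<close> controls the rows; the columns are reached
  through the adjoint. Membership in the corner thereby becomes an algebraic identity, as is
  convenient for projections.\<close>

lemma fitsI: "idn m * X = X \<Longrightarrow> X * idn m = X \<Longrightarrow> fits m X"
proof -
  assume 1: "idn m * X = X" "X * idn m = X"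
  then have "idn m * adjf X = adjf X" by (metis adjf_idn adjf_mult)
  then have "ent (adjf X) i j = (if i < m then ent (adjf X) i j else 0)" for i j
    by (metis ent_idn_mult)
  moreover have "ent X i j = (if i < m then ent X i j else 0)" for i j
    using 1 by (metis ent_idn_mult)
  ultimately show "fits m X" unfolding fits_def ent_adjf by (metis complex_cnj_zero_iff)
qed

section \<open>Matrices constant on classes of index pairs\<close>

definition ind :: "nat \<Rightarrow> (nat \<Rightarrow> nat \<Rightarrow> 'k) \<Rightarrow> complex \<Rightarrow> 'k \<Rightarrow> fmat" where
  "ind m key z k = mk_fmat (\<lambda>i j. if i < m \<and> j < m \<and> key i j = k then z else 0)"

lemma ent_ind: "ent (ind m key z k) i j = (if i < m \<and> j < m \<and> key i j = k then z else 0)"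
  unfolding ind_def by (subst ent_mk[of _ m]) (auto split: if_splits)

text \<open>Spans are real, so each class contributes two generators, with values \<open>1\<close>
  and \<open>\<i>\<close>. The key \<open>Pair\<close> separates all entries and gives finite
  dimension; a coarse key gives a small one.\<close>

definition inds :: "nat \<Rightarrow> (nat \<Rightarrow> nat \<Rightarrow> 'k) \<Rightarrow> fmat set" where
  "inds m key = (\<Union>z\<in>{1, \<i>}. ind m key z ` case_prod key ` ({..<m} \<times> {..<m}))"

lemma finite_inds [simp]: "finite (inds m key)"
  by (simp add: inds_def)

lemma card_inds: "card (inds m key) \<le> 2 * card (case_prod key ` ({..<m} \<times> {..<m}))"
proof -
  have "card (inds m key) \<le> (\<Sum>z\<in>{1, \<i>}. card (ind m key z ` case_prod key ` ({..<m} \<times> {..<m})))"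
    unfolding inds_def by (rule card_UN_le) simp
  also have "\<dots> \<le> (\<Sum>z\<in>{1, \<i>}. card (case_prod key ` ({..<m} \<times> {..<m})))"
    by (intro sum_mono card_image_le) auto
  also have "\<dots> \<le> 2 * card (case_prod key ` ({..<m} \<times> {..<m}))"
    by (simp add: card_insert_if)
  finally show ?thesis .
qed

lemma in_span_inds:
  assumes X: "fits m X"
    and key: "\<And>i j i' j'. i < m \<Longrightarrow> j < m \<Longrightarrow> i' < m \<Longrightarrow> j' < m \<Longrightarrow> key i j = key i' j' \<Longrightarrow>
      ent X i j = ent X i' j'"
  shows "X \<in> span (inds m key)"
proof -
  let ?K = "case_prod key ` ({..<m} \<times> {..<m})"
  define v where "v k = (SOME z. \<exists>i<m. \<exists>j<m. key i j = k \<and> z = ent X i j)" for k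
  have v: "v (key i j) = ent X i j" if "i < m" "j < m" for i j
  proof -
    have "\<exists>z. \<exists>i'<m. \<exists>j'<m. key i' j' = key i j \<and> z = ent X i' j'" using that by blast
    from someI_ex[OF this] show ?thesis unfolding v_def using key that by metis
  qed
  have "X = (\<Sum>k\<in>?K. Re (v k) *\<^sub>R ind m key 1 k + Im (v k) *\<^sub>R ind m key \<i> k)" (is "_ = ?R")
  proof (rule fmat_eqI)
    fix i j
    show "ent X i j = ent ?R i j"
    proof (cases "i < m \<and> j < m")
      case True
      then have "ent ?R i j = (\<Sum>k\<in>?K. if k = key i j then v k else 0)"
        unfolding ent_sum ent_add ent_scaleR ent_ind
        by (intro sum.cong refl) (auto simp: complex_eq_iff)
      also have "\<dots> = v (key i j)" using True by (subst sum.delta) force+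
      finally show ?thesis using v True by simp
    next
      case False
      then show ?thesis using fits_zero[OF X]
        by (auto simp: ent_sum ent_add ent_scaleR ent_ind)
    qed
  qed
  also have "\<dots> \<in> span (inds m key)"
    by (intro span_sum span_add span_scale span_base) (auto simp: inds_def)
  finally show ?thesis .
qed

lemma fits_in_span: "fits m X \<Longrightarrow> X \<in> span (inds m Pair)"
  by (rule in_span_inds) auto

section \<open>Spectral theorem\<close>

text \<open>Horner evaluation of \<open>p\<close> at \<open>H\<close> in the corner with unit
  \<open>idn m\<close>, to which constant terms are attached.\<close>

definition pev :: "nat \<Rightarrow> fmat \<Rightarrow> real poly \<Rightarrow> fmat" where
  "pev m H p = fold_coeffs (\<lambda>a X. a *\<^sub>R idn m + H * X) p 0"

lemma pev_0 [simp]: "pev m H 0 = 0"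
  by (simp add: pev_def)

lemma pev_pCons: "pev m H (pCons a p) = a *\<^sub>R idn m + H * pev m H p"
  by (cases "p = 0 \<and> a = 0") (auto simp: pev_def)

lemma pev_add: "pev m H (p + q) = pev m H p + pev m H q"
  by (induction p q rule: poly_induct2) (auto simp: pev_pCons algebra_simps)

lemma pev_smult: "pev m H (smult a p) = a *\<^sub>R pev m H p"
  by (induction p) (auto simp: pev_pCons algebra_simps)

lemma pev_diff: "pev m H (p - q) = pev m H p - pev m H q"
  using pev_add[of m H "p - q" q] by simp

lemma pev_sum: "pev m H (\<Sum>i\<in>I. f i) = (\<Sum>i\<in>I. pev m H (f i))"
  by (induction I rule: infinite_finite_induct) (auto simp: pev_add)

lemma pev_1: "pev m H 1 = idn m"
  by (simp add: one_pCons pev_pCons)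

context
  fixes m H assumes H: "fits m H" "adjf H = H"
begin

lemma fits_pev: "fits m (pev m H p)"
  by (induction p) (auto simp: pev_pCons H intro!: fits_intros)

lemma pev_mult: "pev m H (p * q) = pev m H p * pev m H q"
  by (induction p) (auto simp: pev_pCons pev_add pev_smult algebra_simps idn_mult fits_pev)

lemma pev_commute:
  assumes "fits m X" "X * H = H * X" shows "X * pev m H p = pev m H p * X"
proof (induction p)
  case (pCons a p)
  have "X * (H * pev m H p) = H * (X * pev m H p)"
    by (metis assms(2) mult.assoc)
  then show ?case using pCons assms
    by (simp add: pev_pCons algebra_simps idn_mult mult_idn)
qed simp

lemma adjf_pev: "adjf (pev m H p) = pev m H p"
proof (induction p)
  case (pCons a p)
  have "H * pev m H p = pev m H p * H" by (rule pev_commute) (auto simp: H)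
  then show ?case using pCons H
    by (simp add: pev_pCons adjf_add adjf_scaleR adjf_mult)
qed simp

text \<open>The powers of \<open>H\<close> lie in a space with finitely many generators, so
  sufficiently many of them are linearly dependent.\<close>

lemma pev_annihilator: "\<exists>p. p \<noteq> 0 \<and> pev m H p = 0"
proof -
  let ?T = "inds m Pair"
  let ?f = "\<lambda>k. pev m H (monom 1 k)"
  let ?K = "{..card ?T}"
  have sp: "?f k \<in> span ?T" for k using fits_in_span fits_pev by blast
  show ?thesis
  proof (cases "inj_on ?f ?K")
    \<comment> \<open>Dependence is a property of sets, so coinciding powers are treated apart; they
      already give an annihilating binomial.\<close>
    case False
    then obtain a b where "a \<noteq> b" "?f a = ?f b" by (auto simp: inj_on_def)
    then have "monom 1 a - monom 1 b \<noteq> (0::real poly) \<and> pev m H (monom 1 a - monom 1 b) = 0"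
      by (simp add: pev_diff monom_eq_iff')
    then show ?thesis by blast
  next
    case True
    then have "card (?f ` ?K) > card ?T" by (simp add: card_image)
    then have "dependent (?f ` ?K)"
      using independent_span_bound[of ?T "?f ` ?K"] sp by force
    then obtain c where c: "\<exists>v\<in>?f ` ?K. c v \<noteq> 0" "(\<Sum>v\<in>?f ` ?K. c v *\<^sub>R v) = 0"
      by (auto simp: dependent_finite)
    define p where "p = (\<Sum>k\<in>?K. monom (c (?f k)) k)"
    have "pev m H p = (\<Sum>k\<in>?K. c (?f k) *\<^sub>R ?f k)"
      unfolding p_def pev_sum
      by (intro sum.cong refl) (metis mult.right_neutral pev_smult smult_monom)
    also have "\<dots> = 0" using c(2) True by (simp add: sum.reindex)
    finally have "pev m H p = 0" .
    moreover obtain k where "k \<in> ?K" "c (?f k) \<noteq> 0" using c(1) by blast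
    then have "coeff p k \<noteq> 0" by (simp add: p_def coeff_sum)
    then have "p \<noteq> 0" by auto
    ultimately show ?thesis by blast
  qed
qed

end

section \<open>Real polynomials at complex points\<close>

definition cev :: "real poly \<Rightarrow> complex \<Rightarrow> complex" where
  "cev p z = poly (map_poly of_real p) z"

lemma cev_pCons: "cev (pCons a p) z = of_real a + z * cev p z"
  by (simp add: cev_def map_poly_pCons)

lemma cev_0 [simp]: "cev 0 z = 0"
  by (simp add: cev_def)

lemma cev_add: "cev (p + q) z = cev p z + cev q z"
  by (induction p q rule: poly_induct2) (auto simp: cev_pCons algebra_simps)

lemma cev_smult: "cev (smult a p) z = of_real a * cev p z"
  by (induction p) (auto simp: cev_pCons algebra_simps)

lemma cev_mult: "cev (p * q) z = cev p z * cev q z"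
  by (induction p) (auto simp: cev_pCons cev_add cev_smult algebra_simps)

lemma cev_of_real: "cev p (of_real x) = of_real (poly p x)"
  by (induction p) (auto simp: cev_pCons)

lemma cev_root_ex:
  assumes "degree p > 0" shows "\<exists>z. cev p z = 0"
proof -
  have "degree (map_poly complex_of_real p) > 0" using assms by (simp add: degree_map_poly)
  then have "\<not> constant (poly (map_poly complex_of_real p))"
    by (simp add: constant_degree)
  then show ?thesis unfolding cev_def by (rule fundamental_theorem_of_algebra)
qed

text \<open>The quadratic has the roots \<open>z\<close> and \<open>cnj z\<close>. The remainder is
  real, of degree at most one, and vanishes at the nonreal \<open>z\<close>, hence is zero.\<close>

lemma quadratic_dvd:
  assumes z: "cev p z = 0" "Im z \<noteq> 0"
  shows "[:(Re z)\<^sup>2 + (Im z)\<^sup>2, -2 * Re z, 1:] dvd p"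
proof -
  let ?q = "[:(Re z)\<^sup>2 + (Im z)\<^sup>2, -2 * Re z, 1:]"
  define r where "r = p mod ?q"
  have "r = 0 \<or> degree r < degree ?q" unfolding r_def by (rule degree_mod_less) simp
  then have "degree r \<le> 1" by auto
  then have "coeff r (Suc (Suc n)) = 0" for n by (simp add: coeff_eq_0)
  then have "r = [:coeff r 0, coeff r 1:]"
    by (intro poly_eqI) (simp add: coeff_pCons split: nat.split)
  then obtain s t where r: "r = [:s, t:]" by blast
  have "cev ?q z = 0"
    by (simp add: cev_pCons complex_eq_iff power2_eq_square algebra_simps)
  then have "cev r z = 0"
    using z(1) cev_add[of "?q * (p div ?q)" r z] by (simp add: r_def cev_mult del: mult_pCons_left)
  then have "t = 0 \<and> s = 0" using z(2)
    by (auto simp: r cev_pCons complex_eq_iff)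
  then have "r = 0" by (simp add: r)
  then show ?thesis unfolding r_def by (simp add: mod_eq_0_iff_dvd)
qed

definition rootp :: "real set \<Rightarrow> real poly" where
  "rootp S = (\<Prod>k\<in>S. [:-k, 1:])"

lemma rootp_dvd:
  assumes "finite S" "\<And>x. x \<in> S \<Longrightarrow> poly f x = 0" shows "rootp S dvd f"
  using assms
proof (induction S arbitrary: f rule: finite_induct)
  case (insert x S)
  then obtain g where g: "f = [:-x, 1:] * g" by (metis dvdE insertI1 poly_eq_0_iff_dvd)
  have "poly g y = 0" if "y \<in> S" for y
  proof -
    have "poly f y = 0" "y \<noteq> x" using insert that by auto
    then show ?thesis by (simp add: g)
  qed
  then have "rootp S dvd g" using insert by blast
  moreover have r: "rootp (insert x S) = [:-x, 1:] * rootp S" using insert by (simp add: rootp_def)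
  ultimately show ?case unfolding g r by (intro mult_dvd_mono dvd_refl)
qed (simp add: rootp_def)

context
  fixes m H assumes H: "fits m H" "adjf H = H"
begin

text \<open>A factor of the annihilating polynomial that is a repeated real or a nonreal quadratic one
  can be cancelled, because the trace form is positive definite.\<close>

lemma pev_cancel_square:
  assumes "pev m H (p * p * q) = 0" shows "pev m H (p * q) = 0"
proof -
  have "inner (pev m H (p * q)) (pev m H (p * q)) = inner (pev m H q) (pev m H (p * p * q))"
    by (simp add: pev_mult[OF H] inner_mult_left adjf_pev[OF H] mult.assoc)
  then show ?thesis using assms by simp
qed

lemma pev_cancel_quadratic:
  assumes "pev m H ([:a\<^sup>2 + b\<^sup>2, -2 * a, 1:] * q) = 0" "b \<noteq> 0" shows "pev m H q = 0"
proof -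
  \<comment> \<open>The quadratic is the square of \<open>x - a\<close> plus the square of
    \<open>b\<close>, so the pairing below is a sum of two squared norms.\<close>
  have e: "[:a\<^sup>2 + b\<^sup>2, -2 * a, 1:] * q = [:-a, 1:] * ([:-a, 1:] * q) + smult (b\<^sup>2) q"
  proof -
    have q0: "[:a\<^sup>2 + b\<^sup>2, -2 * a, 1:] = [:-a, 1:] * [:-a, 1:] + [:b\<^sup>2:]"
      by (simp add: power2_eq_square)
    have "[:b\<^sup>2:] * q = smult (b\<^sup>2) q" by simp
    then show ?thesis by (simp only: q0 distrib_right mult.assoc)
  qed
  have "inner (pev m H q) (pev m H ([:a\<^sup>2 + b\<^sup>2, -2 * a, 1:] * q))
    = inner (pev m H ([:-a,1:] * q)) (pev m H ([:-a,1:] * q)) + b\<^sup>2 * inner (pev m H q) (pev m H q)"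
    unfolding e pev_add pev_smult inner_add_right pev_mult[OF H]
    by (simp add: inner_mult_left adjf_pev[OF H] mult.assoc)
  then have "b\<^sup>2 * inner (pev m H q) (pev m H q) \<le> 0"
    using inner_ge_zero[of "pev m H ([:-a,1:] * q)"] unfolding assms(1) inner_zero_right by linarith
  then have "inner (pev m H q) (pev m H q) \<le> 0"
    using assms(2) by (simp add: mult_le_0_iff)
  then show ?thesis by (metis inner_eq_zero_iff inner_ge_zero order_antisym)
qed

text \<open>The cofactor \<open>q\<close> holds what was already split off from \<open>p\<close>. A
  real root is kept once, since a second copy forms a square and cancels; a pair of conjugate roots
  cancels altogether.\<close>

lemma pev_simple_roots:
  "p \<noteq> 0 \<Longrightarrow> pev m H (p * q) = 0 \<Longrightarrow> \<exists>S. finite S \<and> pev m H (rootp S * q) = 0"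
proof (induction "degree p" arbitrary: p q rule: less_induct)
  case less
  show ?case
  proof (cases "degree p = 0")
    case True
    then obtain c where c: "p = [:c:]" by (metis degree_eq_zeroE)
    then have "c \<noteq> 0" "c *\<^sub>R pev m H q = 0" using less by (auto simp: pev_smult)
    then have "pev m H (rootp {} * q) = 0" by (simp add: rootp_def)
    then show ?thesis by (metis finite.emptyI)
  next
    case False
    then obtain z where z: "cev p z = 0" using cev_root_ex by auto
    show ?thesis
    proof (cases "Im z = 0")
      case True
      then have "poly p (Re z) = 0"
        by (metis cev_of_real complex_is_Real_iff of_real_Re of_real_eq_0_iff z)
      then obtain p' where p': "p = [:- Re z, 1:] * p'" by (metis dvdE poly_eq_0_iff_dvd)
      have "p' \<noteq> 0" using p' less.prems(1) by (metis mult_zero_right)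
      then have "degree p' < degree p" unfolding p' by (subst degree_mult_eq) auto
      moreover have "pev m H (p' * ([:- Re z, 1:] * q)) = 0"
        using less.prems(2) unfolding p' by (simp only: ac_simps)
      ultimately obtain S where S: "finite S" "pev m H (rootp S * ([:- Re z, 1:] * q)) = 0"
        using less.hyps[OF _ \<open>p' \<noteq> 0\<close>] by metis
      show ?thesis
      proof (cases "Re z \<in> S")
        case True
        then have r: "rootp S = [:- Re z, 1:] * rootp (S - {Re z})"
          using S unfolding rootp_def by (subst prod.remove[of _ "Re z"]) auto
        have "pev m H ([:- Re z, 1:] * [:- Re z, 1:] * (rootp (S - {Re z}) * q)) = 0"
          using S(2) unfolding r by (simp only: ac_simps)
        from pev_cancel_square[OF this] show ?thesis
          using S(1) unfolding r[symmetric] mult.assoc[symmetric] by blast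
      next
        case False
        then have "rootp (insert (Re z) S) * q = rootp S * ([:- Re z, 1:] * q)"
          using S unfolding rootp_def by (simp only: prod.insert False not_False_eq_True ac_simps)
        then show ?thesis using S by (metis finite_insert)
      qed
    next
      case False
      let ?Q = "[:(Re z)\<^sup>2 + (Im z)\<^sup>2, -2 * Re z, 1:]"
      obtain p' where p': "p = ?Q * p'" using quadratic_dvd[OF z False] by blast
      have "p' \<noteq> 0" using p' less.prems(1) by (metis mult_zero_right)
      then have "degree p' < degree p" unfolding p' by (subst degree_mult_eq) auto
      moreover have "pev m H (p' * (?Q * q)) = 0"
        using less.prems(2) unfolding p' by (simp only: ac_simps)
      ultimately obtain S where S: "finite S" "pev m H (rootp S * (?Q * q)) = 0"
        using less.hyps[OF _ \<open>p' \<noteq> 0\<close>] by metis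
      then have "pev m H (?Q * (rootp S * q)) = 0" by (simp only: ac_simps)
      from pev_cancel_quadratic[OF this False] show ?thesis using S(1) by blast
    qed
  qed
qed

end

text \<open>A finite projective measurement. Zero projections are allowed, so products over words
  and sums over groups need no pruning.\<close>

definition resol :: "nat \<Rightarrow> 'i set \<Rightarrow> ('i \<Rightarrow> fmat) \<Rightarrow> bool" where
  "resol m I E \<longleftrightarrow> finite I \<and> (\<forall>i\<in>I. adjf (E i) = E i) \<and>
     (\<forall>i\<in>I. \<forall>j\<in>I. E i * E j = (if i = j then E i else 0)) \<and> (\<Sum>i\<in>I. E i) = idn m"

text \<open>The projections are Lagrange polynomials evaluated at \<open>H\<close>. Being
  polynomials in \<open>H\<close>, they commute with whatever commutes with \<open>H\<close>; later
  this makes spectral tests invariant.\<close>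

theorem spectral_resolution:
  assumes H: "fits m H" "adjf H = H"
  obtains S E where "resol m S E" "\<And>k. k \<in> S \<Longrightarrow> E k \<noteq> 0" "H = (\<Sum>k\<in>S. k *\<^sub>R E k)"
    "\<And>X k. fits m X \<Longrightarrow> X * H = H * X \<Longrightarrow> k \<in> S \<Longrightarrow> X * E k = E k * X"
proof -
  obtain p where "p \<noteq> 0" "pev m H (p * 1) = 0" using pev_annihilator[OF H] by auto
  then obtain R where R: "finite R" "pev m H (rootp R) = 0" using pev_simple_roots[OF H, of p 1] by auto
  \<comment> \<open>Since \<open>rootp R\<close> annihilates \<open>H\<close>, the value of a
    polynomial at \<open>H\<close> depends only on its values on \<open>R\<close>.\<close>
  have van: "pev m H f = pev m H g" if "\<And>x. x \<in> R \<Longrightarrow> poly f x = poly g x" for f g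
  proof -
    have "rootp R dvd f - g" using that by (intro rootp_dvd R) auto
    then have "pev m H (f - g) = 0" using R by (auto simp: dvd_def pev_mult[OF H])
    then show ?thesis by (simp add: pev_diff)
  qed
  define l where "l k = (\<Prod>s\<in>R - {k}. smult (1 / (k - s)) [:-s, 1:])" for k
  have l: "poly (l k) x = (if x = k then 1 else 0)" if "x \<in> R" "k \<in> R" for x k
  proof -
    have "poly (l k) x = (\<Prod>s\<in>R - {k}. (x - s) / (k - s))"
      unfolding l_def poly_prod by (rule prod.cong) (simp_all flip: diff_divide_distrib)
    also have "\<dots> = (if x = k then 1 else 0)"
      using R that by (auto intro!: prod.neutral)
    finally show ?thesis .
  qed
  define E where "E k = pev m H (l k)" for k
  \<comment> \<open>\<open>R\<close> may contain roots that are not eigenvalues; these have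
    \<open>E k = 0\<close> and are dropped.\<close>
  define S where "S = {k\<in>R. E k \<noteq> 0}"
  have SR: "finite S" "S \<subseteq> R" using R by (auto simp: S_def)
  have res: "resol m S E" unfolding resol_def
  proof (intro conjI ballI)
    show "adjf (E i) = E i" for i unfolding E_def by (rule adjf_pev[OF H])
    show "E i * E j = (if i = j then E i else 0)" if "i \<in> S" "j \<in> S" for i j
    proof -
      have "pev m H (l i * l j) = pev m H (if i = j then l i else 0)"
        using that SR by (intro van) (auto simp: l subset_iff)
      then show ?thesis by (auto simp: E_def pev_mult[OF H])
    qed
    have "(\<Sum>i\<in>S. E i) = (\<Sum>i\<in>R. E i)"
      using SR R by (intro sum.mono_neutral_left) (auto simp: S_def)
    also have "\<dots> = pev m H (\<Sum>i\<in>R. l i)" by (simp add: E_def pev_sum)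
    also have "\<dots> = pev m H 1"
      using R by (intro van) (auto simp: poly_sum l)
    finally show "(\<Sum>i\<in>S. E i) = idn m" by (simp add: pev_1)
  qed (use SR in auto)
  have Heq: "H = (\<Sum>k\<in>S. k *\<^sub>R E k)"
  proof -
    have "(\<Sum>k\<in>S. k *\<^sub>R E k) = (\<Sum>k\<in>R. k *\<^sub>R E k)"
      using SR R by (intro sum.mono_neutral_left) (auto simp: S_def)
    also have "\<dots> = pev m H (\<Sum>k\<in>R. smult k (l k))" by (simp add: E_def pev_sum pev_smult)
    also have "\<dots> = pev m H [:0, 1:]"
      using R by (intro van) (auto simp: poly_sum l if_distrib cong: if_cong)
    also have "\<dots> = H" by (simp add: pev_pCons mult_idn H)
    finally show ?thesis by (rule sym)
  qed
  have com: "X * E k = E k * X" if "fits m X" "X * H = H * X" for X k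
    unfolding E_def by (rule pev_commute[OF H that])
  show ?thesis
  proof (rule that[OF res _ Heq com])
    show "E k \<noteq> 0" if "k \<in> S" for k using that by (simp add: S_def)
  qed
qed

hide_const (open) Matrix.orthogonal

section \<open>Resolutions of the identity and tests\<close>

lemma resolD:
  assumes "resol m I E"
  shows "finite I" "i \<in> I \<Longrightarrow> adjf (E i) = E i" "i \<in> I \<Longrightarrow> E i * E i = E i"
    "i \<in> I \<Longrightarrow> j \<in> I \<Longrightarrow> i \<noteq> j \<Longrightarrow> E i * E j = 0" "(\<Sum>i\<in>I. E i) = idn m"
  using assms by (auto simp: resol_def)

lemma resol_fits:
  assumes r: "resol m I E" and i: "i \<in> I" shows "fits m (E i)"
proof (rule fitsI)
  have "idn m * E i = (\<Sum>j\<in>I. E j * E i)" by (simp add: sum_distrib_right flip: resolD(5)[OF r])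
  also have "\<dots> = (\<Sum>j\<in>I. if j = i then E i else 0)"
    using resolD[OF r] i by (intro sum.cong) auto
  also have "\<dots> = E i" using resolD[OF r] i by simp
  finally show 1: "idn m * E i = E i" .
  then show "E i * idn m = E i" by (metis adjf_idn adjf_mult i resolD(2)[OF r])
qed

lemma resol_mult_partial:
  assumes r: "resol m I E" and K: "K \<subseteq> I" and i: "i \<in> I"
  shows "E i * (\<Sum>j\<in>K. E j) = (if i \<in> K then E i else 0)"
proof -
  have "E i * (\<Sum>j\<in>K. E j) = (\<Sum>j\<in>K. if i = j then E i else 0)"
    unfolding sum_distrib_left using r K i by (intro sum.cong) (auto simp: resol_def)
  then show ?thesis using resolD(1)[OF r] K by (simp add: finite_subset)
qed

lemma resol_partial:
  assumes r: "resol m I E" and K: "K \<subseteq> I"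
  shows "adjf (\<Sum>j\<in>K. E j) = (\<Sum>j\<in>K. E j)" "(\<Sum>j\<in>K. E j) * (\<Sum>j\<in>K. E j) = (\<Sum>j\<in>K. E j)"
    "fits m (\<Sum>j\<in>K. E j)"
proof -
  show "adjf (\<Sum>j\<in>K. E j) = (\<Sum>j\<in>K. E j)"
    unfolding adjf_sum using resolD(2)[OF r] K by (intro sum.cong) auto
  show "fits m (\<Sum>j\<in>K. E j)" using resol_fits[OF r] K by (intro fits_sum) auto
  show "(\<Sum>j\<in>K. E j) * (\<Sum>j\<in>K. E j) = (\<Sum>j\<in>K. E j)"
    unfolding sum_distrib_right using resol_mult_partial[OF r K] K by (intro sum.cong) auto
qed

lemma norm2_eq_inner: "(norm X)\<^sup>2 = inner X (X::fmat)"
  by (rule power2_norm_eq_inner)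

lemma proj_inner:
  assumes "adjf P = P" "P * P = P" shows "inner X (P * X) = (norm (P * X))\<^sup>2"
  by (metis assms inner_mult_left mult.assoc norm2_eq_inner)

lemma proj_inner_self:
  assumes "adjf P = P" "P * P = P" shows "inner P T = inner P (T * P)"
  by (metis assms inner_mult_right)

lemma resol_norm_left:
  assumes r: "resol m I E" and K: "K \<subseteq> I"
  shows "(norm (\<Sum>i\<in>K. c i *\<^sub>R (E i * Y i)))\<^sup>2 = (\<Sum>i\<in>K. (c i)\<^sup>2 * (norm (E i * Y i))\<^sup>2)"
proof -
  have "pairwise (\<lambda>i j. orthogonal (c i *\<^sub>R (E i * Y i)) (c j *\<^sub>R (E j * Y j))) K"
  proof (rule pairwiseI)
    fix i j assume ij: "i \<in> K" "j \<in> K" "i \<noteq> j"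
    then have "inner (E i * Y i) (E j * Y j) = inner (Y i) ((E i * E j) * Y j)"
      using K resolD(2)[OF r] by (auto simp: inner_mult_left mult.assoc)
    also have "E i * E j = 0" using resolD(4)[OF r, of i j] ij K by blast
    finally have "inner (E i * Y i) (E j * Y j) = 0" by simp
    then show "orthogonal (c i *\<^sub>R (E i * Y i)) (c j *\<^sub>R (E j * Y j))"
      by (simp add: real_inner_class.orthogonal_def)
  qed
  from norm_sum_Pythagorean[OF _ this] resolD(1)[OF r] K show ?thesis
    by (simp add: finite_subset power_mult_distrib)
qed

lemma resol_norm_right:
  assumes r: "resol m I E" and K: "K \<subseteq> I"
  shows "(norm (\<Sum>i\<in>K. c i *\<^sub>R (Y i * E i)))\<^sup>2 = (\<Sum>i\<in>K. (c i)\<^sup>2 * (norm (Y i * E i))\<^sup>2)"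
proof -
  have e: "adjf (Y i * E i) = E i * adjf (Y i)" if "i \<in> K" for i
    using resolD(2)[OF r] K that by (auto simp: adjf_mult)
  have "(norm (\<Sum>i\<in>K. c i *\<^sub>R (Y i * E i)))\<^sup>2 = (norm (\<Sum>i\<in>K. c i *\<^sub>R (E i * adjf (Y i))))\<^sup>2"
    by (subst norm_adjf[symmetric]) (simp add: adjf_sum adjf_scaleR e)
  also have "\<dots> = (\<Sum>i\<in>K. (c i)\<^sup>2 * (norm (E i * adjf (Y i)))\<^sup>2)" by (rule resol_norm_left[OF r K])
  also have "\<dots> = (\<Sum>i\<in>K. (c i)\<^sup>2 * (norm (Y i * E i))\<^sup>2)"
    by (rule sum.cong) (auto simp: norm_adjf simp flip: e)
  finally show ?thesis .
qed

lemma resol_norm_partial: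
  assumes r: "resol m I E" and K: "K \<subseteq> I"
  shows "(norm ((\<Sum>i\<in>K. E i) * X))\<^sup>2 = (\<Sum>i\<in>K. (norm (E i * X))\<^sup>2)"
  using resol_norm_left[OF r K, of "\<lambda>_. 1" "\<lambda>_. X"] by (simp add: sum_distrib_right)

lemma resol_norm:
  assumes r: "resol m I E" and "idn m * X = X"
  shows "(norm X)\<^sup>2 = (\<Sum>i\<in>I. (norm (E i * X))\<^sup>2)"
  using resol_norm_partial[OF r subset_refl, of X] assms by (simp add: resolD(5)[OF r])

lemma resol_quad:
  assumes r: "resol m I E"
  shows "inner X ((\<Sum>i\<in>I. c i *\<^sub>R E i) * X) = (\<Sum>i\<in>I. c i * (norm (E i * X))\<^sup>2)"
  using resolD[OF r] by (auto simp: sum_distrib_right inner_sum_right proj_inner intro!: sum.cong)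

lemma proj_norm_le:
  assumes "adjf P = P" "P * P = P" shows "norm (P * X) \<le> norm X"
proof -
  have "(norm (P * X))\<^sup>2 \<le> norm X * norm (P * X)"
    using proj_inner[OF assms, of X] norm_cauchy_schwarz[of X "P * X"] by simp
  then show ?thesis by (cases "norm (P * X) = 0") (auto simp: power2_eq_square)
qed

lemma proj_norm_le_right:
  assumes "adjf P = P" "P * P = P" shows "norm (X * P) \<le> norm X"
  by (metis adjf_mult assms norm_adjf proj_norm_le)

lemma proj_compl:
  assumes "fits m P" "adjf P = P" "P * P = P"
  shows "adjf (idn m - P) = idn m - P" "(idn m - P) * (idn m - P) = idn m - P"
  using assms by (simp_all add: adjf_diff algebra_simps idn_mult mult_idn)

text \<open>\<open>inner X (T * X)\<close> adds the quadratic form of \<open>T\<close> over the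
  columns of \<open>X\<close>, so ranging over matrices \<open>X\<close> expresses
  \<open>0 \<le> T \<le> 1\<close>.\<close>

definition testf :: "nat \<Rightarrow> fmat \<Rightarrow> bool" where
  "testf m T \<longleftrightarrow> fits m T \<and> adjf T = T \<and> (\<forall>X. 0 \<le> inner X (T * X)) \<and>
     (\<forall>X. 0 \<le> inner X ((idn m - T) * X))"

lemma testf_compl: "testf m T \<Longrightarrow> testf m (idn m - T)"
  by (auto simp: testf_def adjf_diff fits_diff)

text \<open>This says that the square of \<open>T\<close> is at most \<open>T\<close>. With
  \<open>S = 1 - T\<close>, which commutes with \<open>T\<close>, the difference
  \<open>T - T * T\<close> equals \<open>T * S * T + S * T * S\<close>, a sum of two positive
  operators.\<close>

lemma testf_norm_le:
  assumes T: "testf m T" shows "(norm (T * X))\<^sup>2 \<le> inner X (T * X)"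
proof -
  let ?S = "idn m - T"
  have s: "fits m T" "adjf T = T" "adjf ?S = ?S" using T by (auto simp: testf_def adjf_diff)
  have "T - T * T = T * (?S * T) + ?S * (T * ?S)"
    using s by (simp add: algebra_simps idn_mult mult_idn fits_mult)
  then have "(T - T * T) * X = (T * (?S * T) + ?S * (T * ?S)) * X" by (rule arg_cong)
  then have e: "(T - T * T) * X = T * (?S * (T * X)) + ?S * (T * (?S * X))"
    by (simp only: mult.assoc distrib_right)
  have "inner X (T * X) - inner X (T * (T * X)) = inner X ((T - T * T) * X)"
    by (simp add: left_diff_distrib inner_diff_right mult.assoc)
  also have "\<dots> = inner (T * X) (?S * (T * X)) + inner (?S * X) (T * (?S * X))"
    unfolding e inner_add_right using s by (simp only: inner_mult_left)
  also have "\<dots> \<ge> 0" using T by (simp add: testf_def)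
  finally show ?thesis using s(2) by (simp add: norm2_eq_inner inner_mult_left)
qed

definition errf :: "nat \<Rightarrow> fmat \<Rightarrow> fmat \<Rightarrow> fmat \<Rightarrow> real" where
  "errf m A B T = inner A (idn m - T) + inner B T"

section \<open>Comparison with the classical error of the Nussbaum-Szkola distributions\<close>

text \<open>The squared norm is the trace of the product of \<open>E i\<close> and
  \<open>F j\<close>. Weighted by \<open>l i\<close> or by \<open>u j\<close> it gives the two
  Nussbaum-Szkola distributions on pairs, and the sum of minima is their optimal classical
  error.\<close>

definition clerr :: "'i set \<Rightarrow> ('i \<Rightarrow> fmat) \<Rightarrow> ('i \<Rightarrow> real) \<Rightarrow> 'j set \<Rightarrow> ('j \<Rightarrow> fmat) \<Rightarrow> ('j \<Rightarrow> real) \<Rightarrow> real" where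
  "clerr I E l J F u = (\<Sum>i\<in>I. \<Sum>j\<in>J. min (l i) (u j) * (norm (F j * E i))\<^sup>2)"

text \<open>The first state pays for \<open>1 - T\<close> with weights \<open>l i\<close>, the
  second for \<open>T\<close> with weights \<open>u j\<close>, and both weights are at least the
  minimum. Inserting the other resolution breaks each cost into contributions of pairs.\<close>

theorem errf_ge_clerr:
  assumes E: "resol m I E" and F: "resol m J F" and T: "testf m T"
    and l: "\<And>i. i \<in> I \<Longrightarrow> 0 \<le> l i" and u: "\<And>j. j \<in> J \<Longrightarrow> 0 \<le> u j"
  shows "clerr I E l J F u \<le> 2 * errf m (\<Sum>i\<in>I. l i *\<^sub>R E i) (\<Sum>j\<in>J. u j *\<^sub>R F j) T"
proof -
  let ?S = "idn m - T"
  have fT: "fits m T" "fits m ?S" "adjf T = T" using T by (auto simp: testf_def fits_diff)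
  have S: "testf m ?S" using T by (rule testf_compl)
  have "l i * inner (E i) ?S \<ge> (\<Sum>j\<in>J. min (l i) (u j) * (norm (F j * (?S * E i)))\<^sup>2)" if i: "i \<in> I" for i
  proof -
    have "idn m * (?S * E i) = ?S * E i" using fT by (metis idn_mult mult.assoc)
    then have "(\<Sum>j\<in>J. (norm (F j * (?S * E i)))\<^sup>2) = (norm (?S * E i))\<^sup>2" by (metis resol_norm[OF F])
    also have "\<dots> \<le> inner (E i) (?S * E i)" by (rule testf_norm_le[OF S])
    also have "\<dots> = inner (E i) ?S" using resolD[OF E] i by (simp add: proj_inner_self[symmetric])
    finally have "l i * inner (E i) ?S \<ge> (\<Sum>j\<in>J. l i * (norm (F j * (?S * E i)))\<^sup>2)"
      using l[OF i] by (simp add: mult_left_mono flip: sum_distrib_left)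
    moreover have "(\<Sum>j\<in>J. min (l i) (u j) * (norm (F j * (?S * E i)))\<^sup>2)
        \<le> (\<Sum>j\<in>J. l i * (norm (F j * (?S * E i)))\<^sup>2)"
      by (intro sum_mono mult_right_mono) auto
    ultimately show ?thesis by linarith
  qed
  then have 1: "inner (\<Sum>i\<in>I. l i *\<^sub>R E i) ?S \<ge>
      (\<Sum>i\<in>I. \<Sum>j\<in>J. min (l i) (u j) * (norm (F j * (?S * E i)))\<^sup>2)"
    by (simp add: inner_sum_left sum_mono)
  have "u j * inner (F j) T \<ge> (\<Sum>i\<in>I. min (l i) (u j) * (norm (F j * (T * E i)))\<^sup>2)" if j: "j \<in> J" for j
  proof -
    have "idn m * (T * F j) = T * F j" using fT by (metis idn_mult mult.assoc)
    then have "(norm (T * F j))\<^sup>2 = (\<Sum>i\<in>I. (norm (E i * (T * F j)))\<^sup>2)" by (metis resol_norm[OF E])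
    also have "\<dots> = (\<Sum>i\<in>I. (norm (F j * (T * E i)))\<^sup>2)"
      using fT resolD(2)[OF E] resolD(2)[OF F] j
      by (intro sum.cong refl, subst norm_adjf[symmetric]) (simp add: adjf_mult mult.assoc)
    finally have "(\<Sum>i\<in>I. (norm (F j * (T * E i)))\<^sup>2) \<le> inner (F j) (T * F j)"
      using testf_norm_le[OF T, of "F j"] by simp
    also have "\<dots> = inner (F j) T" using resolD[OF F] j by (simp add: proj_inner_self[symmetric])
    finally have "u j * inner (F j) T \<ge> (\<Sum>i\<in>I. u j * (norm (F j * (T * E i)))\<^sup>2)"
      using u[OF j] by (simp add: mult_left_mono flip: sum_distrib_left)
    moreover have "(\<Sum>i\<in>I. min (l i) (u j) * (norm (F j * (T * E i)))\<^sup>2)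
        \<le> (\<Sum>i\<in>I. u j * (norm (F j * (T * E i)))\<^sup>2)"
      by (intro sum_mono mult_right_mono) auto
    ultimately show ?thesis by linarith
  qed
  then have 2: "inner (\<Sum>j\<in>J. u j *\<^sub>R F j) T \<ge>
      (\<Sum>j\<in>J. \<Sum>i\<in>I. min (l i) (u j) * (norm (F j * (T * E i)))\<^sup>2)"
    by (simp add: inner_sum_left sum_mono)
  have "clerr I E l J F u \<le> (\<Sum>i\<in>I. \<Sum>j\<in>J. 2 * (min (l i) (u j) * (norm (F j * (?S * E i)))\<^sup>2
       + min (l i) (u j) * (norm (F j * (T * E i)))\<^sup>2))"
    unfolding clerr_def
  proof (intro sum_mono)
    fix i j assume ij: "i \<in> I" "j \<in> J"
    let ?a = "F j * (?S * E i)" and ?b = "F j * (T * E i)"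
    have "idn m * E i = E i" using resol_fits[OF E] ij by (simp add: idn_mult)
    \<comment> \<open>The unit between the projections is split as \<open>?S + T\<close>; squaring
      this sum of two terms produces the factor 2.\<close>
    then have "F j * E i = ?a + ?b" by (simp add: left_diff_distrib right_diff_distrib)
    then have "(norm (F j * E i))\<^sup>2 \<le> (norm ?a + norm ?b)\<^sup>2"
      by (metis norm_triangle_ineq norm_ge_zero power_mono)
    also have "\<dots> \<le> 2 * ((norm ?a)\<^sup>2 + (norm ?b)\<^sup>2)"
      using sum_squares_bound[of "norm ?a" "norm ?b"] by (simp add: power2_sum)
    finally have "(norm (F j * E i))\<^sup>2 \<le> 2 * ((norm ?a)\<^sup>2 + (norm ?b)\<^sup>2)" .
    then have "min (l i) (u j) * (norm (F j * E i))\<^sup>2 \<le> min (l i) (u j) * (2 * ((norm ?a)\<^sup>2 + (norm ?b)\<^sup>2))"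
      using l u ij by (intro mult_left_mono) auto
    then show "min (l i) (u j) * (norm (F j * E i))\<^sup>2 \<le> 2 * (min (l i) (u j) * (norm ?a)\<^sup>2 + min (l i) (u j) * (norm ?b)\<^sup>2)"
      by (simp add: algebra_simps)
  qed
  also have "\<dots> = 2 * ((\<Sum>i\<in>I. \<Sum>j\<in>J. min (l i) (u j) * (norm (F j * (?S * E i)))\<^sup>2)
       + (\<Sum>j\<in>J. \<Sum>i\<in>I. min (l i) (u j) * (norm (F j * (T * E i)))\<^sup>2))"
    by (subst (3) sum.swap) (simp add: sum.distrib sum_distrib_left)
  also have "\<dots> \<le> 2 * errf m (\<Sum>i\<in>I. l i *\<^sub>R E i) (\<Sum>j\<in>J. u j *\<^sub>R F j) T"
    using 1 2 by (simp add: errf_def)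
  finally show ?thesis .
qed

section \<open>Spectral tools for positive operators\<close>

lemma spectral_resolution_psd:
  assumes H: "fits m H" "adjf H = H" and pos: "\<And>X. 0 \<le> inner X (H * X)"
  obtains S E where "resol m S E" "\<And>k. k \<in> S \<Longrightarrow> 0 \<le> k" "H = (\<Sum>k\<in>S. k *\<^sub>R E k)"
    "\<And>X k. fits m X \<Longrightarrow> X * H = H * X \<Longrightarrow> k \<in> S \<Longrightarrow> X * E k = E k * X"
proof -
  obtain S E where r: "resol m S E" and ne: "\<And>k. k \<in> S \<Longrightarrow> E k \<noteq> 0" and Heq: "H = (\<Sum>k\<in>S. k *\<^sub>R E k)"
    and com: "\<And>X k. fits m X \<Longrightarrow> X * H = H * X \<Longrightarrow> k \<in> S \<Longrightarrow> X * E k = E k * X"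
    using spectral_resolution[OF H] by metis
  have "k \<ge> 0" if k: "k \<in> S" for k
  proof -
    \<comment> \<open>Testing positivity on the nonzero projection \<open>E k\<close> isolates the
      sign of \<open>k\<close>.\<close>
    have "inner (E k) (H * E k) = (\<Sum>l\<in>S. if l = k then k * (norm (E k))\<^sup>2 else 0)"
      unfolding Heq resol_quad[OF r] using resolD[OF r] k by (intro sum.cong) auto
    then have "0 \<le> k * (norm (E k))\<^sup>2" using pos[of "E k"] resolD(1)[OF r] k by simp
    moreover have "(norm (E k))\<^sup>2 > 0" using ne[OF k] by simp
    ultimately show ?thesis by (simp add: zero_le_mult_iff)
  qed
  then show ?thesis using that r Heq com by metis
qed

text \<open>With \<open>H = C * adjf C\<close>, the pairing \<open>inner H T\<close> becomes the
  quadratic form \<open>inner C (T * C)\<close>, to which projection and norm estimates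
  apply.\<close>

lemma psd_factor:
  assumes H: "fits m H" "adjf H = H" and pos: "\<And>X. 0 \<le> inner X (H * X)"
  obtains C where "fits m C" "H = C * adjf C"
proof -
  obtain S E where r: "resol m S E" and k0: "\<And>k. k \<in> S \<Longrightarrow> 0 \<le> k" and Heq: "H = (\<Sum>k\<in>S. k *\<^sub>R E k)"
    using spectral_resolution_psd[OF assms] by metis
  note f = resolD[OF r]
  define C where "C = (\<Sum>k\<in>S. sqrt k *\<^sub>R E k)"
  have "adjf C = C" unfolding C_def adjf_sum using f(2) by (intro sum.cong) (auto simp: adjf_scaleR)
  moreover have "C * C = H"
  proof -
    have "C * C = (\<Sum>k\<in>S. \<Sum>l\<in>S. if l = k then k *\<^sub>R E k else 0)"
      unfolding C_def sum_distrib_left sum_distrib_right using f(3,4) k0 by (intro sum.cong refl) auto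
    then show ?thesis using f(1) Heq by simp
  qed
  moreover have "fits m C" unfolding C_def using resol_fits[OF r] by (auto intro!: fits_intros)
  ultimately show ?thesis using that by metis
qed

text \<open>\<open>Q\<close> is the spectral projection of \<open>H\<close> for eigenvalues at most
  \<epsilon>. The bound on its complement is Markov's inequality
  \<open>\<epsilon> * (1 - Q) \<le> H\<close>.\<close>

lemma resol_threshold:
  assumes H: "fits m H" "adjf H = H" and pos: "\<And>X. 0 \<le> inner X (H * X)" and e: "\<epsilon> > 0"
  obtains Q where "fits m Q" "adjf Q = Q" "Q * Q = Q"
    "\<And>X. inner (Q * X) (H * (Q * X)) \<le> \<epsilon> * (norm (Q * X))\<^sup>2"
    "\<And>X. \<epsilon> * (norm ((idn m - Q) * X))\<^sup>2 \<le> inner X (H * X)"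
    "\<And>X. fits m X \<Longrightarrow> X * H = H * X \<Longrightarrow> X * Q = Q * X"
proof -
  obtain S E where r: "resol m S E" and k0: "\<And>k. k \<in> S \<Longrightarrow> 0 \<le> k" and Heq: "H = (\<Sum>k\<in>S. k *\<^sub>R E k)"
    and com: "\<And>X k. fits m X \<Longrightarrow> X * H = H * X \<Longrightarrow> k \<in> S \<Longrightarrow> X * E k = E k * X"
    using spectral_resolution_psd[OF H pos] by metis
  note fin = resolD(1)[OF r]
  have q: "inner X (H * X) = (\<Sum>k\<in>S. k * (norm (E k * X))\<^sup>2)" for X
    unfolding Heq by (rule resol_quad[OF r])
  define K where "K = {k\<in>S. k \<le> \<epsilon>}"
  define Q where "Q = (\<Sum>k\<in>K. E k)"
  have K: "K \<subseteq> S" by (auto simp: K_def)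
  note part = resol_partial[OF r K, folded Q_def]
  have EQ: "E k * Q = (if k \<in> K then E k else 0)" if "k \<in> S" for k
    using resol_mult_partial[OF r K that] by (simp add: Q_def)
  show ?thesis
  proof (rule that[of Q])
    show "fits m Q" "adjf Q = Q" "Q * Q = Q" by (fact part)+
    fix X
    have "inner (Q * X) (H * (Q * X)) = (\<Sum>k\<in>S. k * (norm (E k * Q * X))\<^sup>2)"
      by (simp add: q mult.assoc)
    also have "\<dots> \<le> (\<Sum>k\<in>S. \<epsilon> * (norm (E k * Q * X))\<^sup>2)"
      by (intro sum_mono) (auto simp: EQ K_def intro!: mult_right_mono)
    also have "\<dots> = \<epsilon> * (norm (Q * X))\<^sup>2"
      using part by (simp add: resol_norm[OF r] idn_mult sum_distrib_left flip: mult.assoc)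
    finally show "inner (Q * X) (H * (Q * X)) \<le> \<epsilon> * (norm (Q * X))\<^sup>2" .
    have "(\<Sum>k\<in>S - K. E k) = idn m - Q"
      using sum_diff[OF fin K, of E] by (simp add: Q_def resolD(5)[OF r])
    then have "(norm ((idn m - Q) * X))\<^sup>2 = (\<Sum>k\<in>S - K. (norm (E k * X))\<^sup>2)"
      using resol_norm_partial[OF r, of "S - K" X] by auto
    then have "\<epsilon> * (norm ((idn m - Q) * X))\<^sup>2 \<le> (\<Sum>k\<in>S - K. k * (norm (E k * X))\<^sup>2)"
      by (auto simp: sum_distrib_left K_def intro!: sum_mono mult_right_mono)
    also have "\<dots> \<le> inner X (H * X)"
      unfolding q using fin k0 by (intro sum_mono2) auto
    finally show "\<epsilon> * (norm ((idn m - Q) * X))\<^sup>2 \<le> inner X (H * X)" .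
  next
    fix X assume "fits m X" "X * H = H * X"
    then show "X * Q = Q * X"
      unfolding Q_def sum_distrib_left sum_distrib_right using K by (intro sum.cong) (auto intro: com)
  qed
qed

text \<open>\<open>T\<close> projects onto the range of \<open>L\<close>. Since \<open>L\<close>
  shrinks vectors of \<open>Q\<close> by at most a factor 2, the nonzero eigenvalues of
  \<open>L * adjf L\<close> are at least \<open>1/4\<close>, and therefore
  \<open>T \<le> 4 * L * adjf L\<close>.\<close>

lemma range_projection:
  assumes L: "fits m L" and Q: "L * Q = L" "adjf Q = Q" and low: "\<And>X. (norm (Q * X))\<^sup>2 \<le> 4 * (norm (L * X))\<^sup>2"
  obtains T where "fits m T" "adjf T = T" "T * T = T" "T * L = L"
    "\<And>X. (norm (T * X))\<^sup>2 \<le> 4 * (norm (adjf L * X))\<^sup>2"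
proof -
  have H: "fits m (L * adjf L)" "adjf (L * adjf L) = L * adjf L"
    using L by (auto intro!: fits_mult simp: fits_adjf adjf_mult)
  obtain S E where r: "resol m S E" and ne: "\<And>k. k \<in> S \<Longrightarrow> E k \<noteq> 0"
    and Heq: "L * adjf L = (\<Sum>k\<in>S. k *\<^sub>R E k)"
    using spectral_resolution[OF H] by metis
  note fin = resolD(1)[OF r]
  have q: "(norm (adjf L * X))\<^sup>2 = (\<Sum>k\<in>S. k * (norm (E k * X))\<^sup>2)" for X
    using resol_quad[OF r, of X "\<lambda>k. k"]
    by (simp add: norm2_eq_inner inner_mult_left mult.assoc flip: Heq)
  have LE: "L * (adjf L * E k) = k *\<^sub>R E k" "(norm (adjf L * E k))\<^sup>2 = k * (norm (E k))\<^sup>2" if k: "k \<in> S" for k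
  proof -
    have "L * (adjf L * E k) = (\<Sum>l\<in>S. if l = k then k *\<^sub>R E k else 0)"
      unfolding mult.assoc[symmetric] Heq sum_distrib_right using resolD[OF r] k by (intro sum.cong) auto
    then show "L * (adjf L * E k) = k *\<^sub>R E k" using fin k by simp
    then show "(norm (adjf L * E k))\<^sup>2 = k * (norm (E k))\<^sup>2"
      by (simp add: norm2_eq_inner inner_mult_left)
  qed
  \<comment> \<open>The lower bound is applied to \<open>adjf L * E k\<close>, which lies in the
    range of \<open>Q\<close>. It yields \<open>k \<le> 4 * k * k\<close>, so \<open>k\<close>
    cannot lie strictly between \<open>0\<close> and \<open>1/4\<close>.\<close>
  have gap: "k = 0 \<or> k \<ge> 1/4" if k: "k \<in> S" for k
  proof -
    have p: "(norm (E k))\<^sup>2 > 0" using ne[OF k] by simp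
    have "adjf L = Q * adjf L" using Q by (metis adjf_mult)
    then have "(norm (adjf L * E k))\<^sup>2 \<le> 4 * (norm (L * (adjf L * E k)))\<^sup>2"
      using low[of "adjf L * E k"] by (metis mult.assoc)
    then have "k * (norm (E k))\<^sup>2 \<le> (4 * k\<^sup>2) * (norm (E k))\<^sup>2"
      unfolding LE[OF k] by (simp add: power_mult_distrib)
    then have "k \<le> 4 * k\<^sup>2" using p by simp
    moreover have "0 \<le> k * (norm (E k))\<^sup>2" unfolding LE(2)[OF k, symmetric] by simp
    then have "k \<ge> 0" using p by (simp add: zero_le_mult_iff)
    ultimately show ?thesis by (cases "k = 0") (auto simp: power2_eq_square)
  qed
  define K where "K = {k\<in>S. k \<noteq> 0}"
  define T where "T = (\<Sum>k\<in>K. E k)"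
  have K: "K \<subseteq> S" by (auto simp: K_def)
  note part = resol_partial[OF r K, folded T_def]
  show ?thesis
  proof (rule that[of T])
    show "fits m T" "adjf T = T" "T * T = T" by (fact part)+
    \<comment> \<open>The projection onto the kernel of \<open>L * adjf L\<close> annihilates
      \<open>L\<close>, so the remaining ones cover its range.\<close>
    have "(\<Sum>k\<in>S - K. E k * L) = 0"
    proof (rule sum.neutral, rule ballI)
      fix k assume "k \<in> S - K"
      then have k: "k \<in> S" "k = 0" by (auto simp: K_def)
      then have "adjf L * E k = 0" using LE(2)[OF k(1)] by simp
      then have "adjf (adjf L * E k) = 0" by simp
      then show "E k * L = 0" using resolD(2)[OF r k(1)] by (simp add: adjf_mult)
    qed
    moreover have "(\<Sum>k\<in>S - K. E k) = idn m - T"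
      using sum_diff[OF fin K, of E] by (simp add: T_def resolD(5)[OF r])
    ultimately have "(idn m - T) * L = 0" by (metis sum_distrib_right)
    then show "T * L = L" using L by (simp add: left_diff_distrib idn_mult)
    fix X
    have "(norm (T * X))\<^sup>2 = (\<Sum>k\<in>K. (norm (E k * X))\<^sup>2)"
      unfolding T_def by (rule resol_norm_partial[OF r K])
    also have "\<dots> \<le> (\<Sum>k\<in>K. 4 * (k * (norm (E k * X))\<^sup>2))"
    proof (rule sum_mono)
      fix k assume "k \<in> K"
      then have "1 * (norm (E k * X))\<^sup>2 \<le> (4 * k) * (norm (E k * X))\<^sup>2"
        using gap[of k] by (intro mult_right_mono) (auto simp: K_def)
      then show "(norm (E k * X))\<^sup>2 \<le> 4 * (k * (norm (E k * X))\<^sup>2)" by simp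
    qed
    also have "\<dots> = 4 * (norm (adjf L * X))\<^sup>2"
      unfolding q sum_distrib_left using fin by (intro sum.mono_neutral_left) (auto simp: K_def)
    finally show "(norm (T * X))\<^sup>2 \<le> 4 * (norm (adjf L * X))\<^sup>2" .
  qed
qed

text \<open>Each eigenspace \<open>E a\<close> of the first operator is tilted into the span \<open>idn m - G a\<close> of the
  eigenspaces of the second operator with smaller eigenvalue. The vectors of \<open>E a\<close> that this moves
  by more than \<open>\<epsilon>\<close> are discarded (they contribute to the classical error anyway); then the tilted
  spaces are almost orthogonal, and the test is the projection onto their span.\<close>

theorem errf_le_clerr:
  fixes \<Lambda> :: "real set"
  assumes E: "resol m \<Lambda> E" and F: "resol m J F"
    and l: "\<And>a. a \<in> \<Lambda> \<Longrightarrow> 0 \<le> a" and u: "\<And>j. j \<in> J \<Longrightarrow> 0 \<le> u j"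
  obtains T where "fits m T" "adjf T = T" "T * T = T"
    "errf m (\<Sum>a\<in>\<Lambda>. a *\<^sub>R E a) (\<Sum>j\<in>J. u j *\<^sub>R F j) T \<le> 5 * (card \<Lambda> + 1) * clerr \<Lambda> E (\<lambda>a. a) J F u"
proof -
  define P where "P = idn m"
  define N where "N = real (card \<Lambda>)"
  \<comment> \<open>Chosen so that \<open>N * \<epsilon> \<le> 1/4\<close>, which keeps the
    displacement \<open>M\<close> below half the length on \<open>Q\<close>. The price
    \<open>1 / \<epsilon>\<close> reappears in the final factor.\<close>
  define \<epsilon> where "\<epsilon> = 1 / (4 * (N + 1))"
  have N0: "N \<ge> 0" by (simp add: N_def)
  have e0: "\<epsilon> > 0" using N0 by (simp add: \<epsilon>_def)
  note fE = resolD[OF E] and fF = resolD[OF F]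
  \<comment> \<open>The eigenspaces of the second operator on which the minimum in
    \<open>clerr\<close> equals \<open>a\<close>.\<close>
  define G where "G a = (\<Sum>j\<in>{j\<in>J. a \<le> u j}. F j)" for a
  have G: "adjf (G a) = G a" "G a * G a = G a" "fits m (G a)" for a
    using resol_partial[OF F, of "{j\<in>J. a \<le> u j}"] by (auto simp: G_def)
  have Gn: "(norm (G a * X))\<^sup>2 = (\<Sum>j\<in>{j\<in>J. a \<le> u j}. (norm (F j * X))\<^sup>2)" for a X
    unfolding G_def by (rule resol_norm_partial[OF F]) auto
  \<comment> \<open>\<open>P - M\<close> applies the tilt \<open>P - G a\<close> on each
    \<open>E a\<close>, so \<open>M\<close> is the displacement. The block-diagonal \<open>H\<close>
    sums the squared displacements of the single blocks, see \<open>qH\<close>.\<close>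
  define M where "M = (\<Sum>a\<in>\<Lambda>. G a * E a)"
  define H where "H = (\<Sum>a\<in>\<Lambda>. E a * (G a * E a))"
  have Efit: "a \<in> \<Lambda> \<Longrightarrow> fits m (E a)" for a by (rule resol_fits[OF E])
  have Hfit: "fits m H" "fits m M" unfolding H_def M_def using Efit G by (auto intro!: fits_intros)
  have Hadj: "adjf H = H" unfolding H_def adjf_sum
    using fE(2) G by (intro sum.cong) (auto simp: adjf_mult mult.assoc)
  have qH: "inner X (H * X) = (\<Sum>a\<in>\<Lambda>. (norm (G a * E a * X))\<^sup>2)" for X
  proof -
    have "inner X (H * X) = (\<Sum>a\<in>\<Lambda>. inner (E a * X) (G a * (E a * X)))"
      unfolding H_def sum_distrib_right inner_sum_right
      using fE(2) by (intro sum.cong) (auto simp: inner_mult_left mult.assoc)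
    then show ?thesis using proj_inner[OF G(1,2)] by (simp add: mult.assoc)
  qed
  \<comment> \<open>Cauchy-Schwarz over the eigenvalues compares the joint displacement with that of
    the blocks, at the cost of their number \<open>N\<close>.\<close>
  have MH: "(norm (M * X))\<^sup>2 \<le> N * inner X (H * X)" for X
  proof -
    have "norm (M * X) \<le> (\<Sum>a\<in>\<Lambda>. norm (G a * E a * X))"
      unfolding M_def sum_distrib_right by (rule norm_sum)
    then have "(norm (M * X))\<^sup>2 \<le> (\<Sum>a\<in>\<Lambda>. norm (G a * E a * X))\<^sup>2"
      by (intro power_mono) auto
    also have "\<dots> \<le> (\<Sum>a\<in>\<Lambda>. (norm (G a * E a * X))\<^sup>2) * N"
      unfolding N_def by (rule sum_squared_le_sum_of_squares)
    finally show ?thesis by (simp add: qH mult.commute)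
  qed
  \<comment> \<open>\<open>H\<close> respects the blocks \<open>E a\<close>, hence commutes with
    \<open>C\<close>; then so does its spectral projection \<open>Q\<close>.\<close>
  have EH: "E a * H = E a * G a * E a" "H * E a = E a * G a * E a" if a: "a \<in> \<Lambda>" for a
  proof -
    have "E a * H = (\<Sum>b\<in>\<Lambda>. if b = a then E a * G a * E a else 0)"
      unfolding H_def sum_distrib_left using fE(3,4) a
      by (intro sum.cong) (auto simp flip: mult.assoc)
    then show 1: "E a * H = E a * G a * E a" using fE(1) a by simp
    have "H * E a = adjf (E a * H)" using fE(2)[OF a] Hadj by (simp add: adjf_mult)
    then show "H * E a = E a * G a * E a" unfolding 1 using fE(2)[OF a] G by (simp add: adjf_mult mult.assoc)
  qed
  have posH: "0 \<le> inner X (H * X)" for X by (simp add: qH sum_nonneg)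
  obtain Q where Q: "fits m Q" "adjf Q = Q" "Q * Q = Q"
    and Q1: "\<And>X. inner (Q * X) (H * (Q * X)) \<le> \<epsilon> * (norm (Q * X))\<^sup>2"
    and Q2: "\<And>X. \<epsilon> * (norm ((P - Q) * X))\<^sup>2 \<le> inner X (H * X)"
    and Q3: "\<And>X. fits m X \<Longrightarrow> X * H = H * X \<Longrightarrow> X * Q = Q * X"
    unfolding P_def using resol_threshold[OF Hfit(1) Hadj posH e0] by metis
  \<comment> \<open>\<open>C\<close> and \<open>B\<close> are the square roots of the two operators,
    so both error terms become squared norms.\<close>
  define C where "C = (\<Sum>a\<in>\<Lambda>. sqrt a *\<^sub>R E a)"
  define B where "B = (\<Sum>j\<in>J. sqrt (u j) *\<^sub>R F j)"
  have C: "fits m C" "adjf C = C" "C * Q = Q * C"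
  proof -
    show "fits m C" unfolding C_def using Efit by (auto intro!: fits_intros)
    show "adjf C = C" unfolding C_def adjf_sum using fE(2) by (intro sum.cong) (auto simp: adjf_scaleR)
    have "C * H = H * C" unfolding C_def sum_distrib_left sum_distrib_right
      using EH by (intro sum.cong) auto
    then show "C * Q = Q * C" using Q3 \<open>fits m C\<close> by blast
  qed
  have CC: "C * C = (\<Sum>a\<in>\<Lambda>. a *\<^sub>R E a)"
  proof -
    have "C * C = (\<Sum>a\<in>\<Lambda>. \<Sum>b\<in>\<Lambda>. if b = a then a *\<^sub>R E a else 0)"
      unfolding C_def sum_distrib_left sum_distrib_right using fE(3,4) l by (intro sum.cong refl) auto
    then show ?thesis using fE(1) by simp
  qed
  have Ffit: "j \<in> J \<Longrightarrow> fits m (F j)" for j by (rule resol_fits[OF F])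
  have B: "fits m B" "adjf B = B"
    unfolding B_def adjf_sum using Ffit fF(2) by (auto intro!: fits_intros sum.cong simp: adjf_scaleR)
  have BB: "B * B = (\<Sum>j\<in>J. u j *\<^sub>R F j)"
  proof -
    have "B * B = (\<Sum>j\<in>J. \<Sum>k\<in>J. if k = j then u j *\<^sub>R F j else 0)"
      unfolding B_def sum_distrib_left sum_distrib_right using fF(3,4) u by (intro sum.cong refl) auto
    then show ?thesis using fF(1) by simp
  qed
  have Pfit: "fits m P" "adjf P = P" by (auto simp: P_def)
  have P1: "P * X = X" "X * P = X" if "fits m X" for X using that by (auto simp: P_def idn_mult mult_idn)
  define L where "L = (P - M) * Q"
  have Lfit: "fits m L" unfolding L_def using Hfit Q Pfit by (intro fits_intros)
  have LQ: "L * Q = L" by (simp add: L_def mult.assoc Q)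
  \<comment> \<open>On \<open>Q\<close> the displacement is at most half the length, so the triangle
    inequality leaves at least the other half for \<open>L\<close>.\<close>
  have low: "(norm (Q * X))\<^sup>2 \<le> 4 * (norm (L * X))\<^sup>2" for X
  proof -
    have "(norm (M * (Q * X)))\<^sup>2 \<le> N * (\<epsilon> * (norm (Q * X))\<^sup>2)"
      using MH[of "Q * X"] Q1[of X] N0 by (meson mult_left_mono order_trans)
    also have "\<dots> \<le> (1/4) * (norm (Q * X))\<^sup>2"
      unfolding mult.assoc[symmetric] using N0 by (intro mult_right_mono) (auto simp: \<epsilon>_def field_simps)
    finally have "(norm (M * (Q * X)))\<^sup>2 \<le> (norm (Q * X) / 2)\<^sup>2" by (simp add: power_divide)
    then have 1: "norm (M * (Q * X)) \<le> norm (Q * X) / 2" by (rule power2_le_imp_le) simp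
    have "P * (Q * X) = Q * X" using P1[OF Q(1)] by (metis mult.assoc)
    then have "Q * X = L * X + M * (Q * X)"
      by (simp add: L_def left_diff_distrib mult.assoc)
    then have "norm (Q * X) \<le> norm (L * X) + norm (M * (Q * X))" by (metis norm_triangle_ineq)
    then have "norm (Q * X) \<le> 2 * norm (L * X)" using 1 by simp
    then have "(norm (Q * X))\<^sup>2 \<le> (2 * norm (L * X))\<^sup>2" by (rule power_mono) simp
    then show ?thesis by (simp add: power_mult_distrib)
  qed
  obtain T where T: "fits m T" "adjf T = T" "T * T = T" "T * L = L"
    and TL: "\<And>X. (norm (T * X))\<^sup>2 \<le> 4 * (norm (adjf L * X))\<^sup>2"
    using range_projection[OF Lfit LQ Q(2) low] by metis
  note Tc = proj_compl[OF T(1,2,3), folded P_def] and Qc = proj_compl[OF Q, folded P_def]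

  \<comment> \<open>The two parts of \<open>clerr\<close>: pairs with \<open>a \<le> u j\<close>,
    where the minimum is \<open>a\<close>, and pairs with \<open>u j < a\<close>, where it is
    \<open>u j\<close>.\<close>
  define P1s where "P1s = (\<Sum>a\<in>\<Lambda>. a * (norm (G a * E a))\<^sup>2)"
  define P2s where "P2s = (\<Sum>a\<in>\<Lambda>. \<Sum>j\<in>{j\<in>J. u j < a}. u j * (norm (F j * E a))\<^sup>2)"
  have cl: "clerr \<Lambda> E (\<lambda>a. a) J F u = P1s + P2s"
  proof -
    have "(\<Sum>j\<in>J. min a (u j) * (norm (F j * E a))\<^sup>2)
      = a * (norm (G a * E a))\<^sup>2 + (\<Sum>j\<in>{j\<in>J. u j < a}. u j * (norm (F j * E a))\<^sup>2)" for a
    proof -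
      have "J = {j\<in>J. a \<le> u j} \<union> {j\<in>J. u j < a}" by auto
      then have "(\<Sum>j\<in>J. min a (u j) * (norm (F j * E a))\<^sup>2)
        = (\<Sum>j\<in>{j\<in>J. a \<le> u j}. min a (u j) * (norm (F j * E a))\<^sup>2)
          + (\<Sum>j\<in>{j\<in>J. u j < a}. min a (u j) * (norm (F j * E a))\<^sup>2)"
        using fF(1) by (subst sum.union_disjoint[symmetric]) auto
      then show ?thesis by (simp add: Gn sum_distrib_left)
    qed
    then show ?thesis by (simp add: clerr_def P1s_def P2s_def sum.distrib)
  qed
  have p0: "P1s \<ge> 0" "P2s \<ge> 0" unfolding P1s_def P2s_def using l u by (auto intro!: sum_nonneg)
  have EC: "E a * C = sqrt a *\<^sub>R E a" if a: "a \<in> \<Lambda>" for a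
  proof -
    have "E a * C = (\<Sum>b\<in>\<Lambda>. if b = a then sqrt a *\<^sub>R E a else 0)"
      unfolding C_def sum_distrib_left using fE(3,4) a by (intro sum.cong) auto
    then show ?thesis using fE(1) a by simp
  qed
  have HC: "inner C (H * C) = P1s"
    unfolding qH P1s_def
    by (rule sum.cong) (auto simp: mult.assoc EC power_mult_distrib l)
  have MC: "(norm (M * C))\<^sup>2 = P1s"
  proof -
    have "M * C = (\<Sum>a\<in>\<Lambda>. sqrt a *\<^sub>R (G a * E a))"
      unfolding M_def sum_distrib_right by (rule sum.cong) (auto simp: mult.assoc EC)
    then show ?thesis unfolding P1s_def
      using resol_norm_right[OF E subset_refl, of sqrt G] l by simp
  qed
  have BM: "(norm (B * (P - M)))\<^sup>2 = P2s"
  proof -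
    have "P - M = (\<Sum>a\<in>\<Lambda>. (P - G a) * E a)"
      unfolding M_def P_def left_diff_distrib sum_subtractf using Efit
      by (simp add: idn_mult fE(5) cong: sum.cong)
    then have "B * (P - M) = (\<Sum>a\<in>\<Lambda>. 1 *\<^sub>R (B * (P - G a) * E a))" by (simp add: sum_distrib_left mult.assoc)
    then have "(norm (B * (P - M)))\<^sup>2 = (\<Sum>a\<in>\<Lambda>. 1\<^sup>2 * (norm (B * (P - G a) * E a))\<^sup>2)"
      using resol_norm_right[OF E subset_refl, of "\<lambda>_. 1" "\<lambda>a. B * (P - G a)"] by (simp only:)
    also have "\<dots> = P2s" unfolding P2s_def
    proof (rule sum.cong[OF refl])
      fix a assume a: "a \<in> \<Lambda>"
      have "P - G a = (\<Sum>j\<in>J - {j\<in>J. a \<le> u j}. F j)"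
        using fF(1) by (subst sum_diff) (auto simp: G_def P_def fF(5))
      also have "J - {j\<in>J. a \<le> u j} = {j\<in>J. u j < a}" by auto
      finally have PG: "P - G a = (\<Sum>j\<in>{j\<in>J. u j < a}. F j)" .
      have "B * (P - G a) = (\<Sum>j\<in>J. if j \<in> {j\<in>J. u j < a} then sqrt (u j) *\<^sub>R F j else 0)"
        unfolding B_def PG sum_distrib_right
        using resol_mult_partial[OF F, of "{j\<in>J. u j < a}"] by (intro sum.cong) auto
      also have "\<dots> = (\<Sum>j\<in>{j\<in>J. u j < a}. sqrt (u j) *\<^sub>R F j)"
        using fF(1) by (intro sum.mono_neutral_cong_right) auto
      finally have "B * (P - G a) * E a = (\<Sum>j\<in>{j\<in>J. u j < a}. sqrt (u j) *\<^sub>R (F j * E a))"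
        by (simp add: sum_distrib_right)
      then show "1\<^sup>2 * (norm (B * (P - G a) * E a))\<^sup>2 = (\<Sum>j\<in>{j\<in>J. u j < a}. u j * (norm (F j * E a))\<^sup>2)"
        using resol_norm_left[OF F, of "{j\<in>J. u j < a}" "\<lambda>j. sqrt (u j)" "\<lambda>_. E a"] u by simp
    qed
    finally show ?thesis .
  qed
  \<comment> \<open>The test is at most \<open>4 * L * adjf L\<close>, and on the tilted blocks
    \<open>B\<close> meets only eigenvalues \<open>u j < a\<close>; this is
    \<open>P2s\<close>.\<close>
  have II: "inner (B * B) T \<le> 4 * P2s"
  proof -
    have "inner (B * B) T = inner B (T * B)" using B by (simp add: inner_mult_right)
    also have "\<dots> = (norm (T * B))\<^sup>2" by (rule proj_inner[OF T(2,3)])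
    also have "\<dots> \<le> 4 * (norm (adjf L * B))\<^sup>2" by (rule TL)
    also have "norm (adjf L * B) = norm (B * (P - M) * Q)"
      by (subst norm_adjf[symmetric]) (simp add: adjf_mult B L_def mult.assoc)
    also have "\<dots>\<^sup>2 \<le> (norm (B * (P - M)))\<^sup>2"
      using proj_norm_le_right[OF Q(2,3)] by (intro power_mono) auto
    finally show ?thesis by (simp add: BM)
  qed
  have I: "inner (C * C) (P - T) \<le> (4 * (N + 1) + 1) * P1s"
  proof -
    let ?X = "(P - T) * C"
    have fX: "fits m ?X" using T C Pfit by (intro fits_intros)
    have "inner (C * C) (P - T) = inner C (?X)" using C by (simp add: inner_mult_right)
    also have "\<dots> = (norm ?X)\<^sup>2" by (rule proj_inner[OF Tc])
    \<comment> \<open>Split at \<open>Q\<close>. On \<open>Q\<close> the test accepts the tilted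
      vector, so only the displacement \<open>M * C\<close> is missed. Off \<open>Q\<close> the
      threshold bounds the discarded vectors by \<open>P1s / \<epsilon>\<close>.\<close>
    also have "\<dots> = (norm (?X * Q))\<^sup>2 + (norm (?X * (P - Q)))\<^sup>2"
    proof -
      have X: "?X = ?X * Q + ?X * (P - Q)" using P1[OF fX] by (simp add: right_diff_distrib)
      have "inner (?X * Q) (?X * (P - Q)) = inner ?X (?X * ((P - Q) * Q))"
        unfolding inner_mult_right[of ?X Q] Q(2) by (simp only: mult.assoc)
      also have "(P - Q) * Q = 0" using P1[OF Q(1)] Q(3) by (simp add: left_diff_distrib)
      finally have "orthogonal (?X * Q) (?X * (P - Q))" by (simp add: real_inner_class.orthogonal_def)
      then show ?thesis using norm_add_Pythagorean X by metis
    qed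
    also have "(norm (?X * Q))\<^sup>2 \<le> P1s"
    proof -
      have "(P - T) * L = 0" using T(4) P1[OF Lfit] by (simp add: left_diff_distrib)
      moreover have "Q = L + M * Q" using P1[OF Q(1)] by (simp add: L_def left_diff_distrib)
      ultimately have "(P - T) * Q = (P - T) * (M * Q)" by (metis add_0 distrib_left)
      then have "?X * Q = (P - T) * (M * C * Q)" using C(3) by (metis mult.assoc)
      then have "norm (?X * Q) \<le> norm (M * C)"
        by (metis Tc proj_norm_le proj_norm_le_right[OF Q(2,3)] order_trans)
      then have "(norm (?X * Q))\<^sup>2 \<le> (norm (M * C))\<^sup>2" by (intro power_mono) auto
      then show ?thesis by (simp add: MC)
    qed
    also have "(norm (?X * (P - Q)))\<^sup>2 \<le> 4 * (N + 1) * P1s"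
    proof -
      have "C * (P - Q) = (P - Q) * C" using C P1[OF C(1)] by (simp add: left_diff_distrib right_diff_distrib)
      then have "?X * (P - Q) = (P - T) * ((P - Q) * C)" by (simp add: mult.assoc)
      then have "norm (?X * (P - Q)) \<le> norm ((P - Q) * C)" using proj_norm_le[OF Tc] by simp
      then have "(norm (?X * (P - Q)))\<^sup>2 \<le> (norm ((P - Q) * C))\<^sup>2" by (intro power_mono) auto
      also have "\<dots> \<le> P1s / \<epsilon>" using Q2[of C] e0 by (simp add: HC field_simps)
      finally show ?thesis by (simp add: \<epsilon>_def mult.commute)
    qed
    finally show ?thesis by (simp add: algebra_simps)
  qed
  have "errf m (C * C) (B * B) T \<le> (4 * (N + 1) + 1) * P1s + 4 * P2s"
    using I II by (simp add: errf_def P_def)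
  also have "\<dots> \<le> 5 * (N + 1) * P1s + 5 * (N + 1) * P2s"
    using p0 N0 by (intro add_mono mult_right_mono) auto
  also have "\<dots> = 5 * (card \<Lambda> + 1) * clerr \<Lambda> E (\<lambda>a. a) J F u"
    unfolding cl N_def by (simp add: algebra_simps)
  finally show ?thesis using that[OF T(1,2,3)] unfolding CC BB by blast
qed

section \<open>Dominating a test by an invariant operator\<close>

lemma orthonormal_independent:
  fixes h :: "'a::real_vector \<Rightarrow> 'a \<Rightarrow> real"
  assumes lin: "\<And>b. linear (h b)" and fin: "finite B"
    and on: "\<And>b c. b \<in> B \<Longrightarrow> c \<in> B \<Longrightarrow> h b c = (if b = c then 1 else 0)"
  shows "independent B"
proof (subst independent_explicit_finite_subsets, intro allI impI ballI)
  fix A and f :: "'a \<Rightarrow> real" and b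
  assume A: "A \<subseteq> B" "finite A" "(\<Sum>v\<in>A. f v *\<^sub>R v) = 0" "b \<in> A"
  have "0 = h b (\<Sum>v\<in>A. f v *\<^sub>R v)" using A(3) lin by (simp add: linear_0)
  also have "\<dots> = (\<Sum>v\<in>A. f v * h b v)" using lin by (simp add: linear_sum linear_scale)
  also have "\<dots> = (\<Sum>v\<in>A. if v = b then f v else 0)" using A by (intro sum.cong) (auto simp: on subset_iff)
  also have "\<dots> = f b" using A by simp
  finally show "f b = 0" by simp
qed

text \<open>A largest orthonormal set replaces Gram-Schmidt: independence bounds its size by
  \<open>card T\<close>, and a nonzero residual of an expansion could be normalised and added. It
  serves both \<open>inner\<close> and the regular trace form below.\<close>

lemma orthonormal_basis_exists:
  fixes h :: "'a::real_vector \<Rightarrow> 'a \<Rightarrow> real"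
  assumes lin: "\<And>b. linear (h b)" and sym: "\<And>x y. h x y = h y x"
    and W: "subspace W" "W \<subseteq> span T" "finite T"
    and pos: "\<And>x. x \<in> W \<Longrightarrow> x \<noteq> 0 \<Longrightarrow> 0 < h x x"
  obtains B where "finite B" "B \<subseteq> W" "card B \<le> card T"
    "\<And>b c. b \<in> B \<Longrightarrow> c \<in> B \<Longrightarrow> h b c = (if b = c then 1 else 0)"
    "\<And>x. x \<in> W \<Longrightarrow> x = (\<Sum>b\<in>B. h b x *\<^sub>R b)"
proof -
  define ok where "ok B \<longleftrightarrow> finite B \<and> B \<subseteq> W \<and> (\<forall>b\<in>B. \<forall>c\<in>B. h b c = (if b = c then 1 else 0))" for B
  have bound: "card B \<le> card T" if "ok B" for B
  proof -
    have "independent B" using that lin by (intro orthonormal_independent[of h]) (auto simp: ok_def)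
    then show ?thesis using that W independent_span_bound[of T B] by (auto simp: ok_def)
  qed
  have "ok {}" by (simp add: ok_def)
  then obtain B where B: "ok B" and mx: "\<And>C. ok C \<Longrightarrow> card C \<le> card B"
    using ex_has_greatest_nat[of ok "{}" card "Suc (card T)"] bound by (auto simp: less_Suc_eq_le)
  have "x = (\<Sum>b\<in>B. h b x *\<^sub>R b)" if x: "x \<in> W" for x
  proof (rule ccontr)
    define y where "y = x - (\<Sum>b\<in>B. h b x *\<^sub>R b)"
    assume "x \<noteq> (\<Sum>b\<in>B. h b x *\<^sub>R b)"
    then have y0: "y \<noteq> 0" by (simp add: y_def)
    have yW: "y \<in> W" unfolding y_def using B x W(1)
      by (intro subspace_diff subspace_sum subspace_scale) (auto simp: ok_def)
    have orth: "h b y = 0" if b: "b \<in> B" for b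
    proof -
      have "h b (\<Sum>c\<in>B. h c x *\<^sub>R c) = (\<Sum>c\<in>B. h c x * h b c)"
        using lin by (simp add: linear_sum linear_scale)
      also have "\<dots> = (\<Sum>c\<in>B. if c = b then h c x else 0)"
        using B b by (intro sum.cong) (auto simp: ok_def)
      also have "\<dots> = h b x" using B b by (simp add: ok_def)
      finally show ?thesis using lin by (simp add: y_def linear_diff)
    qed
    define z where "z = (1 / sqrt (h y y)) *\<^sub>R y"
    have p: "h y y > 0" using pos yW y0 by blast
    have hz: "h b z = h b y / sqrt (h y y)" for b
      using lin by (simp add: z_def linear_scale)
    have "h z z = 1" using p by (simp add: hz sym[of z y] hz)
    moreover have "h b z = 0" "h z b = 0" if "b \<in> B" for b using orth[OF that] by (simp_all add: hz sym[of z b])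
    moreover have "z \<in> W" unfolding z_def using yW W(1) by (rule subspace_scale[rotated])
    moreover have "z \<notin> B" using \<open>h z z = 1\<close> calculation(2) by force
    ultimately have "ok (insert z B)" using B by (auto simp: ok_def)
    from mx[OF this] show False using B \<open>z \<notin> B\<close> by (simp add: ok_def)
  qed
  then show ?thesis using that[of B] B bound[OF B] by (auto simp: ok_def)
qed

text \<open>Cauchy-Schwarz for the form of \<open>T\<close>: the positivity of the form at
  \<open>\<beta> c *\<^sub>R V b - \<beta> b *\<^sub>R V c\<close> is summed over all pairs
  \<open>b\<close>, \<open>c\<close>.\<close>

lemma psd_form_sum_le:
  fixes V :: "'b \<Rightarrow> fmat"
  assumes T: "adjf T = T" "\<And>X. 0 \<le> inner X (T * X)" and fin: "finite B"
  shows "inner (\<Sum>b\<in>B. \<beta> b *\<^sub>R V b) (T * (\<Sum>b\<in>B. \<beta> b *\<^sub>R V b))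
    \<le> (\<Sum>b\<in>B. (\<beta> b)\<^sup>2) * (\<Sum>b\<in>B. inner (V b) (T * V b))"
proof -
  let ?t = "\<lambda>b c. inner (V b) (T * V c)"
  have sym: "?t c b = ?t b c" for b c by (metis T(1) inner_commute inner_mult_left)
  have two: "2 * (\<beta> b * \<beta> c * ?t b c) \<le> (\<beta> c)\<^sup>2 * ?t b b + (\<beta> b)\<^sup>2 * ?t c c" for b c
  proof -
    have "0 \<le> inner (\<beta> c *\<^sub>R V b - \<beta> b *\<^sub>R V c) (T * (\<beta> c *\<^sub>R V b - \<beta> b *\<^sub>R V c))" by (rule T(2))
    also have "\<dots> = (\<beta> c)\<^sup>2 * ?t b b + (\<beta> b)\<^sup>2 * ?t c c - 2 * (\<beta> b * \<beta> c * ?t b c)"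
      by (simp add: right_diff_distrib inner_diff_left inner_diff_right sym[of c b] power2_eq_square algebra_simps)
    finally show ?thesis by simp
  qed
  have "inner (\<Sum>b\<in>B. \<beta> b *\<^sub>R V b) (T * (\<Sum>b\<in>B. \<beta> b *\<^sub>R V b)) = (\<Sum>b\<in>B. \<Sum>c\<in>B. \<beta> b * \<beta> c * ?t b c)"
    by (simp add: sum_distrib_left inner_sum_left inner_sum_right mult.assoc sym)
  then have "2 * inner (\<Sum>b\<in>B. \<beta> b *\<^sub>R V b) (T * (\<Sum>b\<in>B. \<beta> b *\<^sub>R V b))
      = (\<Sum>b\<in>B. \<Sum>c\<in>B. 2 * (\<beta> b * \<beta> c * ?t b c))" by (simp only: sum_distrib_left)
  also have "\<dots> \<le> (\<Sum>b\<in>B. \<Sum>c\<in>B. (\<beta> c)\<^sup>2 * ?t b b + (\<beta> b)\<^sup>2 * ?t c c)"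
    by (intro sum_mono two)
  also have "\<dots> = (\<Sum>b\<in>B. \<Sum>c\<in>B. (\<beta> c)\<^sup>2 * ?t b b) + (\<Sum>b\<in>B. \<Sum>c\<in>B. (\<beta> b)\<^sup>2 * ?t c c)"
    by (simp add: sum.distrib)
  also have "(\<Sum>b\<in>B. \<Sum>c\<in>B. (\<beta> c)\<^sup>2 * ?t b b) = (\<Sum>b\<in>B. (\<beta> b)\<^sup>2) * (\<Sum>b\<in>B. ?t b b)"
    by (subst sum.swap) (simp add: sum_product)
  also have "(\<Sum>b\<in>B. \<Sum>c\<in>B. (\<beta> b)\<^sup>2 * ?t c c) = (\<Sum>b\<in>B. (\<beta> b)\<^sup>2) * (\<Sum>b\<in>B. ?t b b)"
    by (simp add: sum_product)
  finally show ?thesis by simp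
qed

text \<open>The operator \<open>M\<close> replaces the Haar average of \<open>T\<close>: for a basis \<open>B\<close> of the group algebra
  that is orthonormal for the regular trace, \<open>\<Sum>b\<in>B. b T b\<^sup>*\<close> is invariant and
  \<open>\<Sum>b\<in>B. b\<^sup>* b\<close> is the identity.\<close>

theorem invariant_dominating:
  assumes U: "idn m \<in> U" "\<And>a. a \<in> U \<Longrightarrow> fits m a" "\<And>a b. a \<in> U \<Longrightarrow> b \<in> U \<Longrightarrow> a * b \<in> U"
      "\<And>a. a \<in> U \<Longrightarrow> adjf a \<in> U" "\<And>a. a \<in> U \<Longrightarrow> adjf a * a = idn m"
    and S: "U \<subseteq> span S" "finite S"
    and sig: "fits m \<sigma>" "\<And>a. a \<in> U \<Longrightarrow> \<sigma> * a = a * \<sigma>"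
    and T: "fits m T" "adjf T = T" "\<And>X. 0 \<le> inner X (T * X)"
  obtains M D where "fits m M" "adjf M = M" "\<And>a. a \<in> U \<Longrightarrow> a * M = M * a"
    "\<And>X. inner X (T * X) \<le> inner X (M * X)" "inner \<sigma> M = real D * inner \<sigma> T" "D \<le> card S"
proof -
  define W where "W = span U"
  have W: "subspace W" "W \<subseteq> span S" unfolding W_def using S by (auto simp: span_minimal)
  have WU: "U \<subseteq> W" unfolding W_def by (rule span_superset)
  have Wfit: "fits m x" if "x \<in> W" for x
    using that unfolding W_def
    by (induction rule: span_induct_alt) (simp_all add: fits_add fits_scaleR U(2))
  have Wsig: "\<sigma> * x = x * \<sigma>" if "x \<in> W" for x
    using that unfolding W_def
    by (induction rule: span_induct_alt) (auto simp: sig(2) distrib_left distrib_right)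
  have Wadj: "adjf x \<in> W" if "x \<in> W" for x
    using that unfolding W_def
    by (induction rule: span_induct_alt)
      (simp_all add: adjf_add adjf_scaleR span_add span_scale span_zero span_base U(4))
  have Wmult1: "a * x \<in> W" if "a \<in> U" "x \<in> W" for a x
    using that(2) unfolding W_def
    by (induction rule: span_induct_alt)
      (simp_all add: distrib_left span_add span_scale span_zero span_base U(3) that(1))
  have Wmult: "y * x \<in> W" if "y \<in> W" "x \<in> W" for y x
    using that(1) unfolding W_def
    by (induction rule: span_induct_alt)
      (simp_all add: distrib_right span_zero span_add span_scale Wmult1[unfolded W_def] that(2)[unfolded W_def])
  have linI: "linear (inner (b::fmat))" for b
    by (simp add: linear_iff inner_add_right)
  obtain C where C: "finite C" "C \<subseteq> W" "card C \<le> card S"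
    "\<And>b c. b \<in> C \<Longrightarrow> c \<in> C \<Longrightarrow> inner b c = (if b = c then 1 else 0)"
    "\<And>x. x \<in> W \<Longrightarrow> x = (\<Sum>b\<in>C. inner b x *\<^sub>R b)"
    by (rule orthonormal_basis_exists[OF linI inner_commute W(1,2) S(2)]) (simp, rule that)
  \<comment> \<open>\<open>inner Z a\<close> is the trace of right multiplication by
    \<open>a\<close> on \<open>W\<close>, computed in the basis \<open>C\<close>. Hence
    \<open>h x y\<close> below is the trace of right multiplication by
    \<open>adjf x * y\<close>.\<close>
  define Z where "Z = (\<Sum>c\<in>C. adjf c * c)"
  have Zadj: "adjf Z = Z" by (simp add: Z_def adjf_sum adjf_mult)
  define h where "h x y = inner x (y * Z)" for x y
  have hlin: "linear (h b)" for b
    by (simp add: h_def linear_iff inner_add_right distrib_right)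
  have hsym: "h x y = h y x" for x y
    unfolding h_def by (metis Zadj inner_commute inner_mult_right)
  have hadj: "h x (a * y) = h (adjf a * x) y" for x y a
    by (simp add: h_def inner_mult_left mult.assoc)
  \<comment> \<open>\<open>idn m\<close> lies in \<open>W\<close> and is thus a combination of the
    elements of \<open>C\<close>; an \<open>x\<close> with all \<open>x * adjf c = 0\<close> must
    vanish.\<close>
  have hpos: "0 < h x x" if x: "x \<in> W" "x \<noteq> 0" for x
  proof -
    have e: "h x x = (\<Sum>c\<in>C. (norm (x * adjf c))\<^sup>2)"
      by (simp add: h_def Z_def sum_distrib_left inner_sum_right norm2_eq_inner inner_mult_right mult.assoc)
    have "h x x \<noteq> 0"
    proof
      assume "h x x = 0"
      then have z: "\<And>c. c \<in> C \<Longrightarrow> x * adjf c = 0"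
        using C(1) by (auto simp: e sum_nonneg_eq_0_iff)
      have "idn m = (\<Sum>c\<in>C. inner c (idn m) *\<^sub>R c)" using C(5) WU U(1) by blast
      then have "adjf (idn m) = adjf (\<Sum>c\<in>C. inner c (idn m) *\<^sub>R c)" by (rule arg_cong)
      then have "idn m = (\<Sum>c\<in>C. inner c (idn m) *\<^sub>R adjf c)" by (simp add: adjf_sum adjf_scaleR)
      then have "x * idn m = x * (\<Sum>c\<in>C. inner c (idn m) *\<^sub>R adjf c)" by (rule arg_cong)
      also have "\<dots> = 0" by (simp add: sum_distrib_left z)
      finally show False using x Wfit by (simp add: mult_idn)
    qed
    moreover have "h x x \<ge> 0" unfolding e by (simp add: sum_nonneg)
    ultimately show ?thesis by simp
  qed
  obtain B where B: "finite B" "B \<subseteq> W"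
    "\<And>b c. b \<in> B \<Longrightarrow> c \<in> B \<Longrightarrow> h b c = (if b = c then 1 else 0)"
    "\<And>x. x \<in> W \<Longrightarrow> x = (\<Sum>b\<in>B. h b x *\<^sub>R b)"
    by (rule orthonormal_basis_exists[OF hlin hsym W(1,2) S(2) hpos]) (assumption, assumption, rule that)
  have parseval: "(\<Sum>b\<in>B. h x b * h y b) = h x y" if "y \<in> W" for x y
  proof -
    have "h x y = h x (\<Sum>b\<in>B. h b y *\<^sub>R b)" using B(4)[OF that] by simp
    also have "\<dots> = (\<Sum>b\<in>B. h x b * h y b)"
      using hlin by (simp add: linear_sum linear_scale hsym[of y] mult.commute)
    finally show ?thesis by simp
  qed
  \<comment> \<open>The trace of right multiplication by \<open>x\<close> on \<open>W\<close> is the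
    same in the bases \<open>B\<close> and \<open>C\<close>. For \<open>x = Y\<close> this gives
    \<open>h Y Y = 0\<close>.\<close>
  have full: "(\<Sum>b\<in>B. adjf b * b) = idn m"
  proof -
    define Y where "Y = idn m - (\<Sum>b\<in>B. adjf b * b)"
    have YW: "Y \<in> W" unfolding Y_def using B WU U(1) W(1) Wadj Wmult
      by (intro subspace_diff subspace_sum) auto
    have "(\<Sum>b\<in>B. h b (b * x)) = (\<Sum>c\<in>C. inner c (c * x))" if x: "x \<in> W" for x
    proof -
      have "h b (b * x) = (\<Sum>c\<in>C. inner c b * h b (c * x))" if b: "b \<in> B" for b
      proof -
        have "b = (\<Sum>c\<in>C. inner c b *\<^sub>R c)" using C(5) B(2) b by blast
        then have "h b (b * x) = h b ((\<Sum>c\<in>C. inner c b *\<^sub>R c) * x)" by simp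
        then show ?thesis using hlin by (simp add: sum_distrib_right linear_sum linear_scale)
      qed
      then have "(\<Sum>b\<in>B. h b (b * x)) = (\<Sum>b\<in>B. \<Sum>c\<in>C. inner c b * h b (c * x))" by simp
      also have "\<dots> = (\<Sum>c\<in>C. \<Sum>b\<in>B. inner c b * h b (c * x))" by (rule sum.swap)
      also have "\<dots> = (\<Sum>c\<in>C. inner c (c * x))"
      proof (rule sum.cong[OF refl])
        fix c assume c: "c \<in> C"
        have "c * x = (\<Sum>b\<in>B. h b (c * x) *\<^sub>R b)" using B(4) Wmult C(2) c x by blast
        then have "inner c (c * x) = inner c (\<Sum>b\<in>B. h b (c * x) *\<^sub>R b)" by simp
        then show "(\<Sum>b\<in>B. inner c b * h b (c * x)) = inner c (c * x)"
          by (simp add: inner_sum_right mult.commute)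
      qed
      finally show ?thesis .
    qed
    from this[OF YW] have "inner (\<Sum>b\<in>B. adjf b * b) (Y * Z) = inner Z Y"
      by (simp add: h_def Z_def inner_sum_left inner_mult_left mult.assoc)
    also have "inner Z Y = inner (idn m * Z) Y"
      using Wfit C by (subst idn_mult) (auto simp: Z_def intro!: fits_sum fits_mult simp: fits_adjf)
    also have "\<dots> = inner (idn m) (Y * Z)" by (simp add: inner_mult_right Zadj)
    finally have "h Y Y = 0" by (simp add: h_def Y_def inner_diff_left)
    then have "Y = 0" using hpos[OF YW] by force
    then show ?thesis by (simp add: Y_def)
  qed
  define R where "R = (\<Sum>b\<in>B. b * (T * adjf b))"
  have Bfit: "b \<in> B \<Longrightarrow> fits m b" for b using Wfit B(2) by blast
  have Rfit: "fits m R" unfolding R_def using Bfit T by (auto intro!: fits_sum fits_mult simp: fits_adjf)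
  have Radj: "adjf R = R" by (simp add: R_def adjf_sum adjf_mult T mult.assoc)
  \<comment> \<open>Left multiplication by \<open>a\<close> preserves \<open>h\<close>, so its
    matrix in the basis \<open>B\<close> is orthogonal and \<open>R\<close> does not change.\<close>
  have Rinv: "a * R * adjf a = R" if a: "a \<in> U" for a
  proof -
    have aa: "a * adjf a = idn m" using U(4,5) a by (metis adjf_adjf)
    have aW: "a \<in> W" using WU a by blast
    have ex: "a * b = (\<Sum>c\<in>B. h c (a * b) *\<^sub>R c)" if "b \<in> B" for b
      using B(2,4) Wmult aW that by blast
    have "a * R * adjf a = (\<Sum>b\<in>B. (a * b) * T * adjf (a * b))"
      by (simp add: R_def sum_distrib_left sum_distrib_right adjf_mult mult.assoc)
    also have "\<dots> = (\<Sum>b\<in>B. (\<Sum>c\<in>B. h c (a * b) *\<^sub>R c) * T * adjf (\<Sum>d\<in>B. h d (a * b) *\<^sub>R d))"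
      by (intro sum.cong refl) (simp flip: ex)
    also have "\<dots> = (\<Sum>b\<in>B. \<Sum>c\<in>B. \<Sum>d\<in>B. (h c (a * b) * h d (a * b)) *\<^sub>R (c * T * adjf d))"
      by (simp add: adjf_sum adjf_scaleR sum_distrib_right sum_distrib_left scaleR_right.sum,
          rule sum.cong[OF refl], rule trans[OF sum.swap]) (simp add: mult.commute)
    also have "\<dots> = (\<Sum>c\<in>B. \<Sum>d\<in>B. \<Sum>b\<in>B. (h c (a * b) * h d (a * b)) *\<^sub>R (c * T * adjf d))"
      by (subst sum.swap, subst (2) sum.swap) simp
    also have "\<dots> = (\<Sum>c\<in>B. \<Sum>d\<in>B. (\<Sum>b\<in>B. h c (a * b) * h d (a * b)) *\<^sub>R (c * T * adjf d))"
      by (simp add: scaleR_left.sum)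
    also have "\<dots> = (\<Sum>c\<in>B. \<Sum>d\<in>B. if d = c then c * T * adjf c else 0)"
    proof (intro sum.cong refl)
      fix c d assume cd: "c \<in> B" "d \<in> B"
      have "(\<Sum>b\<in>B. h c (a * b) * h d (a * b)) = (\<Sum>b\<in>B. h (adjf a * c) b * h (adjf a * d) b)"
        by (simp add: hadj)
      also have "\<dots> = h (adjf a * c) (adjf a * d)"
        using Wmult Wadj aW B(2) cd by (intro parseval) auto
      also have "\<dots> = h c (a * adjf a * d)" by (simp add: hadj mult.assoc)
      also have "\<dots> = (if d = c then 1 else 0)"
        unfolding aa using Bfit cd by (simp add: idn_mult B(3))
      finally show "(\<Sum>b\<in>B. h c (a * b) * h d (a * b)) *\<^sub>R (c * T * adjf d) = (if d = c then c * T * adjf c else 0)"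
        by simp
    qed
    also have "\<dots> = R" using B(1) by (simp add: R_def mult.assoc)
    finally show ?thesis .
  qed
  define D where "D = card C"
  \<comment> \<open>The trace of the identity map on \<open>W\<close>, that is, its real
    dimension.\<close>
  have hid: "h (idn m) (idn m) = real D"
  proof -
    have "idn m * Z = Z" using Wfit C by (intro idn_mult) (auto simp: Z_def intro!: fits_sum fits_mult simp: fits_adjf)
    then have "h (idn m) (idn m) = (\<Sum>c\<in>C. inner (idn m) (adjf c * c))"
      by (simp add: h_def) (simp add: Z_def inner_sum_right)
    also have "\<dots> = (\<Sum>c\<in>C. inner c c)"
    proof (rule sum.cong[OF refl])
      fix c assume "c \<in> C"
      then have "c * idn m = c" using Wfit C(2) by (intro mult_idn) auto
      then show "inner (idn m) (adjf c * c) = inner c c" by (metis inner_mult_left adjf_adjf inner_commute)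
    qed
    also have "\<dots> = real D" using C(4) by (simp add: D_def)
    finally show ?thesis .
  qed
  show ?thesis
  proof (rule that[of "real D *\<^sub>R R" D])
    show "fits m (real D *\<^sub>R R)" "adjf (real D *\<^sub>R R) = real D *\<^sub>R R"
      using Rfit Radj by (auto simp: fits_scaleR adjf_scaleR)
    show "D \<le> card S" using C(3) by (simp add: D_def)
    show "a * real D *\<^sub>R R = real D *\<^sub>R R * a" if a: "a \<in> U" for a
    proof -
      have "R * a = a * R * (adjf a * a)" by (subst Rinv[OF a, symmetric]) (simp add: mult.assoc)
      then show ?thesis using U(5)[OF a] Rfit by (simp add: mult.assoc mult_idn)
    qed
    \<comment> \<open>As \<open>\<sigma>\<close> commutes with each \<open>b\<close>, the factors
      gather to \<open>adjf b * b\<close>, whose sum is the unit; averaging does not change the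
      value at \<open>\<sigma>\<close>.\<close>
    have "inner \<sigma> R = (\<Sum>b\<in>B. inner (adjf b * b * \<sigma>) T)"
    proof -
      have "inner \<sigma> (b * (T * adjf b)) = inner (adjf b * b * \<sigma>) T" if "b \<in> B" for b
      proof -
        have "inner \<sigma> (b * (T * adjf b)) = inner (adjf b * \<sigma>) (T * adjf b)" by (simp add: inner_mult_left)
        also have "\<dots> = inner (adjf b * \<sigma> * b) T" by (simp only: inner_mult_right)
        also have "adjf b * \<sigma> * b = adjf b * b * \<sigma>" using Wsig B(2) that by (auto simp: mult.assoc)
        finally show ?thesis .
      qed
      then show ?thesis by (simp add: R_def inner_sum_right)
    qed
    also have "\<dots> = inner \<sigma> T" using sig by (simp add: full idn_mult flip: inner_sum_left sum_distrib_right)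
    finally show "inner \<sigma> (real D *\<^sub>R R) = real D * inner \<sigma> T" by simp
    fix X
    \<comment> \<open>Coordinates of the unit. Writing both units around \<open>T\<close> as
      combinations of the \<open>adjf b\<close> gives \<open>T \<le> D * R\<close>, since the
      squares of the coordinates sum to \<open>h (idn m) (idn m) = D\<close>.\<close>
    define \<beta> where "\<beta> b = h b (idn m)" for b
    have "adjf (idn m) = adjf (\<Sum>b\<in>B. \<beta> b *\<^sub>R b)" using B(4)[of "idn m"] WU U(1) by (auto simp: \<beta>_def)
    then have id: "idn m = (\<Sum>b\<in>B. \<beta> b *\<^sub>R adjf b)" by (simp add: adjf_sum adjf_scaleR)
    have "idn m * X = (\<Sum>b\<in>B. \<beta> b *\<^sub>R (adjf b * X))" by (subst id) (simp add: sum_distrib_right)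
    moreover have "T = idn m * (T * idn m)" using T(1) by (simp add: idn_mult mult_idn)
    then have "inner X (T * X) = inner X (idn m * (T * (idn m * X)))" by (metis mult.assoc)
    then have "inner X (T * X) = inner (idn m * X) (T * (idn m * X))" by (simp add: inner_mult_left)
    ultimately have "inner X (T * X) \<le> (\<Sum>b\<in>B. (\<beta> b)\<^sup>2) * (\<Sum>b\<in>B. inner (adjf b * X) (T * (adjf b * X)))"
      using psd_form_sum_le[OF T(2,3) B(1), of \<beta> "\<lambda>b. adjf b * X"] by simp
    also have "(\<Sum>b\<in>B. (\<beta> b)\<^sup>2) = (\<Sum>b\<in>B. h (idn m) b * h (idn m) b)"
      unfolding \<beta>_def power2_eq_square using hsym by (intro sum.cong) metis+
    also have "\<dots> = real D"
      unfolding hid[symmetric] using WU U(1) by (intro parseval) auto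
    also have "(\<Sum>b\<in>B. inner (adjf b * X) (T * (adjf b * X))) = inner X (R * X)"
      by (simp add: R_def sum_distrib_right inner_sum_right inner_mult_left mult.assoc)
    finally show "inner X (T * X) \<le> inner X (real D *\<^sub>R R * X)" by simp
  qed
qed

text \<open>Thresholding turns the dominating \<open>M\<close>, which need not be bounded by 1, into
  a projection. A projection is a test, and a spectral one inherits the commutation with
  \<open>U\<close>.\<close>

theorem invariant_test:
  assumes U: "idn m \<in> U" "\<And>a. a \<in> U \<Longrightarrow> fits m a" "\<And>a b. a \<in> U \<Longrightarrow> b \<in> U \<Longrightarrow> a * b \<in> U"
      "\<And>a. a \<in> U \<Longrightarrow> adjf a \<in> U" "\<And>a. a \<in> U \<Longrightarrow> adjf a * a = idn m"
    and S: "U \<subseteq> span S" "finite S"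
    and \<sigma>: "\<sigma> = B * adjf B" "fits m B" "\<And>a. a \<in> U \<Longrightarrow> \<sigma> * a = a * \<sigma>"
    and \<rho>: "\<rho> = C * adjf C" "fits m C" "inner \<rho> (idn m) = 1"
    and T: "testf m T" and e: "errf m \<rho> \<sigma> T \<le> e" "0 < e" "e \<le> 4"
  obtains T' where "fits m T'" "adjf T' = T'" "T' * T' = T'" "\<And>a. a \<in> U \<Longrightarrow> T' * a = a * T'"
    "errf m \<rho> \<sigma> T' \<le> (card S + 6) * sqrt e"
proof -
  have T1: "fits m T" "adjf T = T" "\<And>X. 0 \<le> inner X (T * X)" using T by (auto simp: testf_def)
  have sf: "fits m \<sigma>" using \<sigma> by (auto intro!: fits_mult simp: fits_adjf)
  obtain M D where M: "fits m M" "adjf M = M" "\<And>a. a \<in> U \<Longrightarrow> a * M = M * a"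
    "\<And>X. inner X (T * X) \<le> inner X (M * X)" "inner \<sigma> M = real D * inner \<sigma> T" "D \<le> card S"
    using invariant_dominating[OF U S sf \<sigma>(3) T1] by metis
  have Mpos: "0 \<le> inner X (M * X)" for X using M(4)[of X] T1(3)[of X] by linarith
  \<comment> \<open>The choice that balances \<open>card S * e / \<delta>\<close> for
    \<open>\<sigma>\<close> against the order \<open>\<delta> + e\<close> for
    \<open>\<rho>\<close>.\<close>
  define \<delta> where "\<delta> = sqrt e"
  have d0: "\<delta> > 0" using e by (simp add: \<delta>_def)
  obtain Q where Q: "fits m Q" "adjf Q = Q" "Q * Q = Q"
    and Q1: "\<And>X. inner (Q * X) (M * (Q * X)) \<le> \<delta> * (norm (Q * X))\<^sup>2"
    and Q2: "\<And>X. \<delta> * (norm ((idn m - Q) * X))\<^sup>2 \<le> inner X (M * X)"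
    and Q3: "\<And>X. fits m X \<Longrightarrow> X * M = M * X \<Longrightarrow> X * Q = Q * X"
    using resol_threshold[OF M(1,2) Mpos d0] by metis
  define T' where "T' = idn m - Q"
  have T': "adjf T' = T'" "T' * T' = T'" using proj_compl[OF Q] by (auto simp: T'_def)
  have e1: "0 \<le> inner \<rho> (idn m - T)" "0 \<le> inner \<sigma> T"
    using T by (simp_all add: \<rho> \<sigma> inner_mult_right testf_def)
  have "inner \<sigma> T' = (norm (T' * B))\<^sup>2"
    using proj_inner[OF T', of B] by (simp add: \<sigma> inner_mult_right)
  also have "\<dots> \<le> inner B (M * B) / \<delta>" using Q2[of B] d0 by (simp add: T'_def field_simps)
  also have "inner B (M * B) = real D * inner \<sigma> T" using M(5) by (simp add: \<sigma> inner_mult_right)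
  also have "real D * inner \<sigma> T \<le> real (card S) * e"
    using M(6) e e1 by (intro mult_mono) (auto simp: errf_def)
  finally have II: "inner \<sigma> T' \<le> card S * \<delta>"
    using d0 e by (simp add: divide_right_mono \<delta>_def real_div_sqrt flip: times_divide_eq_right)
  have "inner \<rho> Q \<le> 2 * \<delta> + 2 * e"
  proof -
    let ?S = "idn m - T"
    \<comment> \<open>On \<open>Q\<close> one has \<open>T \<le> M \<le> \<delta>\<close>, and the
      square of \<open>T\<close> is at most \<open>T\<close>.\<close>
    have "norm (T * (Q * C)) \<le> sqrt \<delta> * norm (Q * C)"
    proof (rule power2_le_imp_le)
      have "(norm (T * (Q * C)))\<^sup>2 \<le> inner (Q * C) (T * (Q * C))" by (rule testf_norm_le[OF T])
      also have "\<dots> \<le> \<delta> * (norm (Q * C))\<^sup>2" using M(4)[of "Q * C"] Q1[of C] by linarith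
      finally show "(norm (T * (Q * C)))\<^sup>2 \<le> (sqrt \<delta> * norm (Q * C))\<^sup>2"
        using d0 by (simp add: power_mult_distrib)
    qed (use d0 in auto)
    \<comment> \<open>In the first part \<open>T\<close> moves over to \<open>Q * C\<close>, where
      it is small; the second part is bounded by the error of \<open>T\<close> at
      \<open>\<rho>\<close>.\<close>
    have "C = T * C + ?S * C" using \<rho>(2) by (simp add: left_diff_distrib idn_mult)
    then have "inner (Q * C) C = inner (Q * C) (T * C) + inner (Q * C) (?S * C)"
      by (metis inner_add_right)
    moreover have "inner (Q * C) C = (norm (Q * C))\<^sup>2" using proj_inner[OF Q(2,3), of C] by (simp add: inner_commute)
    moreover have "inner (Q * C) (T * C) = inner (T * (Q * C)) C" using T1(2) by (simp add: inner_mult_left)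
    moreover have "inner (T * (Q * C)) C \<le> norm (T * (Q * C)) * norm C" by (rule norm_cauchy_schwarz)
    moreover have "\<dots> \<le> sqrt \<delta> * norm (Q * C) * norm C"
      using \<open>norm (T * (Q * C)) \<le> sqrt \<delta> * norm (Q * C)\<close> by (rule mult_right_mono) simp
    moreover have "inner (Q * C) (?S * C) \<le> norm (Q * C) * norm (?S * C)" by (rule norm_cauchy_schwarz)
    ultimately have "norm (Q * C) * norm (Q * C) \<le> norm (Q * C) * (sqrt \<delta> * norm C + norm (?S * C))"
      by (simp add: power2_eq_square algebra_simps)
    then have "norm (Q * C) \<le> sqrt \<delta> * norm C + norm (?S * C)"
      using d0 by (cases "norm (Q * C) = 0") auto
    then have "(norm (Q * C))\<^sup>2 \<le> (sqrt \<delta> * norm C + norm (?S * C))\<^sup>2" by (rule power_mono) simp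
    also have "\<dots> \<le> 2 * (sqrt \<delta> * norm C)\<^sup>2 + 2 * (norm (?S * C))\<^sup>2"
      using sum_squares_bound[of "sqrt \<delta> * norm C" "norm (?S * C)"] by (simp add: power2_sum)
    also have "(sqrt \<delta> * norm C)\<^sup>2 = \<delta>"
    proof -
      have "(norm C)\<^sup>2 = inner \<rho> (idn m)" using \<rho>(2) by (simp add: \<rho>(1) inner_mult_right idn_mult norm2_eq_inner)
      then show ?thesis using d0 \<rho>(3) by (simp add: power_mult_distrib)
    qed
    also have "(norm (?S * C))\<^sup>2 \<le> inner \<rho> ?S"
      using testf_norm_le[OF testf_compl[OF T], of C] by (simp add: \<rho>(1) inner_mult_right)
    also have "inner \<rho> ?S \<le> e" using e e1 by (simp add: errf_def)
    finally show ?thesis using proj_inner[OF Q(2,3), of C] by (simp add: \<rho>(1) inner_mult_right)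
  qed
  \<comment> \<open>The assumption \<open>e \<le> 4\<close> enters here: it gives
    \<open>\<delta> \<le> 2\<close>, hence \<open>e \<le> 2 * \<delta>\<close>.\<close>
  also have "2 * e \<le> 4 * \<delta>"
  proof -
    have "e = \<delta> * \<delta>" using e by (simp add: \<delta>_def)
    moreover have "\<delta> \<le> 2" unfolding \<delta>_def using e by (intro real_le_lsqrt) auto
    ultimately show ?thesis using d0 by simp
  qed
  finally have I: "inner \<rho> (idn m - T') \<le> 6 * \<delta>" by (simp add: T'_def)
  show ?thesis
  proof (rule that[OF _ T'])
    show "fits m T'" using Q by (simp add: T'_def fits_diff)
    show "T' * a = a * T'" if a: "a \<in> U" for a
      using Q3[OF U(2)[OF a] M(3)[OF a]] U(2)[OF a]
      by (simp add: T'_def left_diff_distrib right_diff_distrib idn_mult mult_idn)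
    show "errf m \<rho> \<sigma> T' \<le> (card S + 6) * sqrt e"
      using I II by (simp add: errf_def \<delta>_def distrib_right)
  qed
qed

section \<open>Tensor powers\<close>

lemma sum_div_mod:
  fixes f :: "nat \<Rightarrow> nat \<Rightarrow> 'a::comm_monoid_add"
  assumes d: "d > 0"
  shows "(\<Sum>k<m * d. f (k div d) (k mod d)) = (\<Sum>a<m. \<Sum>b<d. f a b)"
proof -
  have lt: "a * d + b < m * d" if "a < m" "b < d" for a b
  proof -
    have "a * d + b < Suc a * d" using that by simp
    also have "\<dots> \<le> m * d" using that by (intro mult_le_mono1) simp
    finally show ?thesis .
  qed
  have "(\<Sum>a<m. \<Sum>b<d. f a b) = (\<Sum>(a,b)\<in>{..<m} \<times> {..<d}. f a b)"
    by (simp add: sum.cartesian_product)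
  also have "\<dots> = (\<Sum>k<m * d. f (k div d) (k mod d))"
    by (rule sum.reindex_bij_witness[of _ "\<lambda>k. (k div d, k mod d)" "\<lambda>(a,b). a * d + b"])
      (use d lt in \<open>auto simp: less_mult_imp_div_less\<close>)
  finally show ?thesis by simp
qed

text \<open>The Kronecker product needs only the size \<open>d\<close> of its second factor; that of
  the first may be arbitrary.\<close>

definition krf :: "nat \<Rightarrow> fmat \<Rightarrow> fmat \<Rightarrow> fmat" where
  "krf d A B = mk_fmat (\<lambda>i j. ent A (i div d) (j div d) * ent B (i mod d) (j mod d))"

fun tpf :: "nat \<Rightarrow> fmat \<Rightarrow> nat \<Rightarrow> fmat" where
  "tpf d A 0 = idn 1"
| "tpf d A (Suc n) = krf d (tpf d A n) A"

text \<open>The head of the word is the last tensor factor, matching the recursion of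
  \<open>tpf\<close>.\<close>

fun listproj :: "nat \<Rightarrow> ('i \<Rightarrow> fmat) \<Rightarrow> 'i list \<Rightarrow> fmat" where
  "listproj d E [] = idn 1"
| "listproj d E (x # xs) = krf d (listproj d E xs) (E x)"

definition words :: "'i set \<Rightarrow> nat \<Rightarrow> 'i list set" where
  "words L n = {xs. set xs \<subseteq> L \<and> length xs = n}"

lemma words_0: "words L 0 = {[]}"
  by (auto simp: words_def)

lemma words_Suc: "words L (Suc n) = (\<lambda>(x, xs). x # xs) ` (L \<times> words L n)"
  by (auto simp: words_def length_Suc_conv image_def)

lemma finite_words: "finite L \<Longrightarrow> finite (words L n)"
  by (simp add: words_def finite_lists_length_eq)

lemma sum_words_Suc: "(\<Sum>xs\<in>words L (Suc n). f xs) = (\<Sum>x\<in>L. \<Sum>xs\<in>words L n. f (x # xs))"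
proof -
  have "inj_on (\<lambda>(x, xs). x # xs) (L \<times> words L n)" by (auto simp: inj_on_def)
  then show ?thesis by (simp add: words_Suc sum.reindex sum.cartesian_product case_prod_unfold)
qed

text \<open>The classical error of product distributions, with the eigenvalue products read so far
  kept in \<open>s\<close> and \<open>t\<close>. The accumulators make the estimates for growing
  \<open>n\<close> plain inductions.\<close>

fun clsum :: "('i \<Rightarrow> 'j \<Rightarrow> real) \<Rightarrow> ('i \<Rightarrow> real) \<Rightarrow> 'i set \<Rightarrow> ('j \<Rightarrow> real) \<Rightarrow> 'j set \<Rightarrow> nat \<Rightarrow> real \<Rightarrow> real \<Rightarrow> real" where
  "clsum w a I b J 0 s t = min s t"
| "clsum w a I b J (Suc n) s t = (\<Sum>i\<in>I. \<Sum>j\<in>J. w i j * clsum w a I b J n (s * a i) (t * b j))"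

lemma norm_fits: "fits m X \<Longrightarrow> (norm X)\<^sup>2 = (\<Sum>i<m. \<Sum>j<m. (cmod (ent X i j))\<^sup>2)"
  by (simp add: norm2_eq_inner inner_fmat cmod_power2 flip: power2_eq_square)

context
  fixes d :: nat assumes d: "d > 0"
begin

lemma ent_krf: "ent (krf d A B) i j = ent A (i div d) (j div d) * ent B (i mod d) (j mod d)"
proof -
  obtain m where m: "fits m A" using fits_ex by blast
  show ?thesis unfolding krf_def
  proof (subst ent_mk[of _ "m * d"])
    fix i j assume "ent A (i div d) (j div d) * ent B (i mod d) (j mod d) \<noteq> 0"
    then have "i div d < m" "j div d < m" using m by (auto simp: fits_def)
    then show "i < m * d \<and> j < m * d" using d by (simp add: div_less_iff_less_mult)
  qed simp
qed

lemma fits_krf: "fits m A \<Longrightarrow> fits (m * d) (krf d A B)"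
  unfolding fits_def ent_krf using d by (metis div_less_iff_less_mult mult_eq_0_iff)

lemma krf_mult:
  assumes B: "fits d B" shows "krf d A B * krf d A' B' = krf d (A * A') (B * B')"
proof (rule fmat_eqI)
  fix i j
  obtain m where m: "fits m A" using fits_ex by blast
  have "ent (krf d A B * krf d A' B') i j = (\<Sum>k<m * d.
      (ent A (i div d) (k div d) * ent A' (k div d) (j div d)) * (ent B (i mod d) (k mod d) * ent B' (k mod d) (j mod d)))"
    by (subst ent_mult_left[OF fits_krf[OF m]]) (simp add: ent_krf algebra_simps)
  also have "\<dots> = (\<Sum>a<m. \<Sum>b<d. (ent A (i div d) a * ent A' a (j div d)) * (ent B (i mod d) b * ent B' b (j mod d)))"
    by (rule sum_div_mod[OF d])
  also have "\<dots> = ent (krf d (A * A') (B * B')) i j"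
    by (simp add: ent_krf ent_mult_left[OF m] ent_mult_left[OF B] sum_product)
  finally show "ent (krf d A B * krf d A' B') i j = ent (krf d (A * A') (B * B')) i j" .
qed

lemma adjf_krf: "adjf (krf d A B) = krf d (adjf A) (adjf B)"
  by (rule fmat_eqI) (simp add: ent_krf ent_adjf)

lemma krf_scaleR: "krf d (a *\<^sub>R A) (b *\<^sub>R B) = (a * b) *\<^sub>R krf d A B"
  by (rule fmat_eqI) (simp add: ent_krf ent_scaleR)

lemma krf_zero: "krf d 0 B = 0" "krf d A 0 = 0"
  by (auto intro!: fmat_eqI simp: ent_krf ent_zero)

lemma krf_sum: "krf d (\<Sum>i\<in>I. f i) (\<Sum>j\<in>J. g j) = (\<Sum>j\<in>J. \<Sum>i\<in>I. krf d (f i) (g j))"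
  by (rule fmat_eqI) (simp add: ent_krf ent_sum sum_product sum.swap[of _ I J])

lemma krf_idn: "krf d (idn m) (idn d) = idn (m * d)"
proof (rule fmat_eqI)
  fix i j
  have "i = j \<longleftrightarrow> i div d = j div d \<and> i mod d = j mod d" by (metis div_mult_mod_eq)
  then show "ent (krf d (idn m) (idn d)) i j = ent (idn (m * d)) i j"
    using d by (auto simp: ent_krf ent_idn div_less_iff_less_mult)
qed

lemma norm_krf:
  assumes B: "fits d B" shows "norm (krf d A B) = norm A * norm B"
proof -
  obtain m where m: "fits m A" using fits_ex by blast
  have "(norm (krf d A B))\<^sup>2 = (\<Sum>i<m * d. \<Sum>j<m * d.
      (cmod (ent A (i div d) (j div d)))\<^sup>2 * (cmod (ent B (i mod d) (j mod d)))\<^sup>2)"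
    by (simp add: norm_fits[OF fits_krf[OF m]] ent_krf norm_mult power_mult_distrib)
  also have "\<dots> = (\<Sum>i<m * d. \<Sum>a<m. \<Sum>b<d. (cmod (ent A (i div d) a))\<^sup>2 * (cmod (ent B (i mod d) b))\<^sup>2)"
    by (intro sum.cong refl sum_div_mod[OF d])
  also have "\<dots> = (\<Sum>k<m. \<Sum>l<d. \<Sum>a<m. \<Sum>b<d. (cmod (ent A k a))\<^sup>2 * (cmod (ent B l b))\<^sup>2)"
    by (rule sum_div_mod[OF d])
  also have "\<dots> = (norm A)\<^sup>2 * (norm B)\<^sup>2"
    by (simp add: norm_fits[OF m] norm_fits[OF B] sum_product)
  also have "\<dots> = (norm A * norm B)\<^sup>2" by (simp add: power_mult_distrib)
  finally show ?thesis by (simp add: power2_eq_iff_nonneg)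
qed

lemma fits_tpf: "fits (d ^ n) (tpf d A n)"
  by (induction n) (auto dest: fits_krf simp: mult.commute)

lemma tpf_mult: "fits d A \<Longrightarrow> tpf d (A * B) n = tpf d A n * tpf d B n"
  by (induction n) (auto simp: krf_mult)

lemma adjf_tpf: "adjf (tpf d A n) = tpf d (adjf A) n"
  by (induction n) (auto simp: adjf_krf)

lemma tpf_idn: "tpf d (idn d) n = idn (d ^ n)"
  by (induction n) (auto simp: krf_idn mult.commute)

lemma resol_listproj:
  assumes r: "resol d L E" shows "resol (d ^ n) (words L n) (listproj d E)"
proof (induction n)
  case 0
  then show ?case by (auto simp: resol_def words_0)
next
  case (Suc n)
  note f = resolD[OF r] and IH = resolD[OF Suc]
  show ?case unfolding resol_def
  proof (intro conjI ballI)
    show "finite (words L (Suc n))" using f(1) by (rule finite_words)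
    show "adjf (listproj d E xs) = listproj d E xs" if "xs \<in> words L (Suc n)" for xs
      using that f(2) IH(2) by (auto simp: words_Suc adjf_krf)
    show "listproj d E xs * listproj d E ys = (if xs = ys then listproj d E xs else 0)"
      if "xs \<in> words L (Suc n)" "ys \<in> words L (Suc n)" for xs ys
    proof -
      obtain x xs' y ys' where e: "xs = x # xs'" "ys = y # ys'" "x \<in> L" "y \<in> L" "xs' \<in> words L n" "ys' \<in> words L n"
        using \<open>xs \<in> _\<close> \<open>ys \<in> _\<close> by (auto simp: words_Suc)
      have "listproj d E xs * listproj d E ys = krf d (listproj d E xs' * listproj d E ys') (E x * E y)"
        using resol_fits[OF r] e by (simp add: krf_mult)
      then show ?thesis using e f(3,4) IH(3,4) by (cases "x = y"; cases "xs' = ys'") (auto simp: krf_zero)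
    qed
    have "(\<Sum>xs\<in>words L (Suc n). listproj d E xs) = krf d (\<Sum>xs\<in>words L n. listproj d E xs) (\<Sum>x\<in>L. E x)"
      by (simp add: sum_words_Suc krf_sum)
    then show "(\<Sum>xs\<in>words L (Suc n). listproj d E xs) = idn (d ^ Suc n)"
      by (simp add: f(5) IH(5) krf_idn mult.commute)
  qed
qed

lemma tpf_listproj:
  "tpf d (\<Sum>x\<in>L. c x *\<^sub>R E x) n = (\<Sum>xs\<in>words L n. (\<Prod>x\<leftarrow>xs. c x) *\<^sub>R listproj d E xs)"
  by (induction n) (simp_all add: words_0 sum_words_Suc krf_sum krf_scaleR mult.commute)

lemma clerr_listproj:
  fixes a b E F
  defines "w \<equiv> \<lambda>i j. (norm (F j * E i))\<^sup>2"
  assumes E: "resol d I E" and F: "resol d J F"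
  shows "clerr (words I n) (listproj d E) (\<lambda>xs. \<Prod>x\<leftarrow>xs. a x) (words J n) (listproj d F) (\<lambda>xs. \<Prod>x\<leftarrow>xs. b x)
    = clsum w a I b J n 1 1"
proof -
  \<comment> \<open>Arbitrary prefactors \<open>s\<close>, \<open>t\<close> are required because
    peeling off a letter multiplies them by its eigenvalues.\<close>
  have "(\<Sum>xs\<in>words I n. \<Sum>ys\<in>words J n. min (s * (\<Prod>x\<leftarrow>xs. a x)) (t * (\<Prod>x\<leftarrow>ys. b x)) *
      (norm (listproj d F ys * listproj d E xs))\<^sup>2) = clsum w a I b J n s t" for s t
  proof (induction n arbitrary: s t)
    case 0
    have "(norm (idn 1))\<^sup>2 = 1\<^sup>2" by (simp add: norm_fits[of 1] ent_idn)
    then have "norm (idn 1) = 1" by (subst (asm) power2_eq_iff_nonneg) auto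
    then show ?case by (simp add: words_0)
  next
    case (Suc n)
    have "(\<Sum>xs\<in>words I (Suc n). \<Sum>ys\<in>words J (Suc n). min (s * (\<Prod>x\<leftarrow>xs. a x)) (t * (\<Prod>x\<leftarrow>ys. b x)) *
        (norm (listproj d F ys * listproj d E xs))\<^sup>2)
      = (\<Sum>i\<in>I. \<Sum>xs\<in>words I n. \<Sum>j\<in>J. \<Sum>ys\<in>words J n. w i j *
         (min (s * a i * (\<Prod>x\<leftarrow>xs. a x)) (t * b j * (\<Prod>x\<leftarrow>ys. b x)) *
        (norm (listproj d F ys * listproj d E xs))\<^sup>2))"
      unfolding sum_words_Suc
    proof (intro sum.cong refl)
      fix i xs j ys assume ij: "i \<in> I" "j \<in> J"
      then have "norm (listproj d F (j # ys) * listproj d E (i # xs)) = norm (listproj d F ys * listproj d E xs) * norm (F j * E i)"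
        using resol_fits[OF E] resol_fits[OF F] by (simp add: krf_mult norm_krf fits_mult)
      then show "min (s * (\<Prod>x\<leftarrow>i # xs. a x)) (t * (\<Prod>x\<leftarrow>j # ys. b x)) * (norm (listproj d F (j # ys) * listproj d E (i # xs)))\<^sup>2
        = w i j * (min (s * a i * (\<Prod>x\<leftarrow>xs. a x)) (t * b j * (\<Prod>x\<leftarrow>ys. b x)) * (norm (listproj d F ys * listproj d E xs))\<^sup>2)"
        by (simp add: w_def power_mult_distrib mult.assoc)
    qed
    also have "\<dots> = (\<Sum>i\<in>I. \<Sum>j\<in>J. w i j * (\<Sum>xs\<in>words I n. \<Sum>ys\<in>words J n.
         (min (s * a i * (\<Prod>x\<leftarrow>xs. a x)) (t * b j * (\<Prod>x\<leftarrow>ys. b x)) *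
        (norm (listproj d F ys * listproj d E xs))\<^sup>2)))"
      by (simp add: sum_distrib_left sum.swap[of _ "words I n" J])
    finally show ?case by (simp add: Suc)
  qed
  from this[of 1 1] show ?thesis by (simp add: clerr_def)
qed

end

text \<open>Merges the words with equal eigenvalue product. The upper bound pays for the number of
  projections, which drops from exponential to polynomial, while the classical error stays the same
  by Pythagoras.\<close>

lemma resol_regroup:
  assumes r: "resol m I E"
  shows "resol m (l ` I) (\<lambda>v. \<Sum>i\<in>{i\<in>I. l i = v}. E i)"
    "(\<Sum>v\<in>l ` I. v *\<^sub>R (\<Sum>i\<in>{i\<in>I. l i = v}. E i)) = (\<Sum>i\<in>I. l i *\<^sub>R E i)"
    "clerr (l ` I) (\<lambda>v. \<Sum>i\<in>{i\<in>I. l i = v}. E i) (\<lambda>v. v) J F u = clerr I E l J F u"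
proof -
  note f = resolD[OF r]
  let ?E = "\<lambda>v. \<Sum>i\<in>{i\<in>I. l i = v}. E i"
  have part: "adjf (?E v) = ?E v" "?E v * ?E v = ?E v" for v
    using resol_partial[OF r, of "{i\<in>I. l i = v}"] by auto
  have orth: "?E v * ?E w = 0" if "v \<noteq> w" for v w
    unfolding sum_distrib_right
    using resol_mult_partial[OF r, of "{i\<in>I. l i = w}"] that by (intro sum.neutral) auto
  show "resol m (l ` I) ?E" unfolding resol_def
    using part orth f(1) by (auto simp: f(5) sum.image_gen[of I E l, symmetric])
  have "(\<Sum>i\<in>I. l i *\<^sub>R E i) = (\<Sum>v\<in>l ` I. \<Sum>i\<in>{i\<in>I. l i = v}. l i *\<^sub>R E i)"
    by (rule sum.image_gen[OF f(1)])
  then show "(\<Sum>v\<in>l ` I. v *\<^sub>R ?E v) = (\<Sum>i\<in>I. l i *\<^sub>R E i)"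
    by (simp add: scaleR_right.sum)
  have n: "(norm (X * ?E v))\<^sup>2 = (\<Sum>i\<in>{i\<in>I. l i = v}. (norm (X * E i))\<^sup>2)" for v X
    using resol_norm_right[OF r, of "{i\<in>I. l i = v}" "\<lambda>_. 1" "\<lambda>_. X"] by (simp add: sum_distrib_left)
  have "clerr I E l J F u = (\<Sum>v\<in>l ` I. \<Sum>i\<in>{i\<in>I. l i = v}. \<Sum>j\<in>J. min (l i) (u j) * (norm (F j * E i))\<^sup>2)"
    unfolding clerr_def by (rule sum.image_gen[OF f(1)])
  also have "\<dots> = (\<Sum>v\<in>l ` I. \<Sum>i\<in>{i\<in>I. l i = v}. \<Sum>j\<in>J. min v (u j) * (norm (F j * E i))\<^sup>2)"
    by (intro sum.cong refl) auto
  also have "\<dots> = (\<Sum>v\<in>l ` I. \<Sum>j\<in>J. \<Sum>i\<in>{i\<in>I. l i = v}. min v (u j) * (norm (F j * E i))\<^sup>2)"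
    by (intro sum.cong refl sum.swap)
  also have "\<dots> = clerr (l ` I) ?E (\<lambda>v. v) J F u"
    by (simp add: clerr_def n flip: sum_distrib_left)
  finally show "clerr (l ` I) ?E (\<lambda>v. v) J F u = clerr I E l J F u" by simp
qed

text \<open>The method of types: a quantity determined by \<open>card K\<close> counters with values
  in \<open>{0..n}\<close> takes few values. It serves the eigenvalues of a tensor power and the
  classes of its entries.\<close>

lemma card_count_le:
  assumes "finite K" and "\<And>x k. x \<in> X \<Longrightarrow> k \<in> K \<Longrightarrow> f x k \<le> n"
    and "\<And>x y. x \<in> X \<Longrightarrow> y \<in> X \<Longrightarrow> (\<And>k. k \<in> K \<Longrightarrow> f x k = f y k) \<Longrightarrow> g x = g y"
  shows "card (g ` X) \<le> (n + 1 :: nat) ^ card K"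
proof -
  let ?r = "\<lambda>x. restrict (f x) K"
  have sub: "?r ` X \<subseteq> K \<rightarrow>\<^sub>E {..n}" using assms(2) by auto
  have fin: "finite (K \<rightarrow>\<^sub>E {..n})" using assms(1) by (intro finite_PiE) auto
  have "\<exists>h. \<forall>x\<in>X. g x = h (?r x)"
  proof (intro exI ballI)
    fix x assume x: "x \<in> X"
    let ?y = "inv_into X ?r (?r x)"
    have y: "?y \<in> X" "?r ?y = ?r x" using x by (auto intro: inv_into_into f_inv_into_f)
    then have "f ?y k = f x k" if "k \<in> K" for k using that by (metis restrict_apply')
    then show "g x = g (inv_into X ?r (?r x))" using assms(3) x y(1) by metis
  qed
  then obtain h where "\<And>x. x \<in> X \<Longrightarrow> g x = h (?r x)" by blast
  then have "g ` X = h ` ?r ` X" by force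
  then have "card (g ` X) \<le> card (?r ` X)"
    using card_image_le[OF finite_subset[OF sub fin], of h] by metis
  also have "\<dots> \<le> card (K \<rightarrow>\<^sub>E {..n})" using sub fin by (rule card_mono[rotated])
  also have "\<dots> = (n + 1) ^ card K" using assms(1) by (simp add: card_PiE)
  finally show ?thesis .
qed

lemma card_prod_words:
  fixes c :: "'i \<Rightarrow> 'a::comm_monoid_mult"
  assumes L: "finite L"
  shows "card ((\<lambda>xs. \<Prod>x\<leftarrow>xs. c x) ` words L n) \<le> (n + 1) ^ card L"
proof (rule card_count_le[of _ _ count_list])
  show "count_list xs k \<le> n" if "xs \<in> words L n" for xs k
    using that count_le_length[of xs k] by (auto simp: words_def)
  show "(\<Prod>x\<leftarrow>xs. c x) = (\<Prod>x\<leftarrow>ys. c x)"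
    if "xs \<in> words L n" "ys \<in> words L n" "\<And>k. k \<in> L \<Longrightarrow> count_list xs k = count_list ys k" for xs ys
  proof -
    have "(\<Prod>x\<leftarrow>zs. c x) = (\<Prod>k\<in>L. c k ^ count_list zs k)" if "set zs \<subseteq> L" for zs
      using that
    proof (induction zs)
      case (Cons z zs)
      have "(\<Prod>k\<in>L. c k ^ count_list (z # zs) k) = (\<Prod>k\<in>L. (if k = z then c k else 1) * c k ^ count_list zs k)"
        by (rule prod.cong) auto
      also have "\<dots> = c z * (\<Prod>k\<in>L. c k ^ count_list zs k)"
        using L Cons by (simp add: prod.distrib)
      finally show ?case using Cons by simp
    qed simp
    then show ?thesis using that by (auto simp: words_def intro!: prod.cong)
  qed
qed (fact L)

section \<open>Transfer from matrices\<close>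

definition fm :: "complex mat \<Rightarrow> fmat" where
  "fm A = mk_fmat (\<lambda>i j. if i < dim_row A \<and> j < dim_col A then A $$ (i, j) else 0)"

definition mf :: "nat \<Rightarrow> fmat \<Rightarrow> complex mat" where
  "mf m X = mat m m (\<lambda>(i, j). ent X i j)"

lemma ent_fm: "ent (fm A) i j = (if i < dim_row A \<and> j < dim_col A then A $$ (i, j) else 0)"
  unfolding fm_def by (subst ent_mk[of _ "max (dim_row A) (dim_col A)"]) (auto split: if_splits)

lemma fits_fm: "A \<in> carrier_mat m m \<Longrightarrow> fits m (fm A)"
  by (auto simp: fits_def ent_fm split: if_splits)

lemma mf_carrier [simp]: "mf m X \<in> carrier_mat m m"
  by (simp add: mf_def)

lemma fm_mf: "fits m X \<Longrightarrow> fm (mf m X) = X"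
  by (rule fmat_eqI) (auto simp: ent_fm mf_def fits_def)

lemma fm_inject:
  assumes "A \<in> carrier_mat m k" "B \<in> carrier_mat m k" "fm A = fm B" shows "A = B"
proof (rule eq_matI)
  fix i j assume "i < dim_row B" "j < dim_col B"
  moreover have "ent (fm A) i j = ent (fm B) i j" using assms by simp
  ultimately show "A $$ (i, j) = B $$ (i, j)" using assms(1,2) by (simp add: ent_fm)
qed (use assms in auto)

lemma fm_mult:
  assumes "A \<in> carrier_mat m m" "B \<in> carrier_mat m m" shows "fm (A * B) = fm A * fm B"
  by (rule fmat_eqI, subst ent_mult_left[OF fits_fm[OF assms(1)]])
    (use assms in \<open>auto simp: ent_fm scalar_prod_def atLeast0LessThan\<close>)

lemma fm_adj: "fm (adj A) = adjf (fm A)"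
  by (rule fmat_eqI) (auto simp: ent_fm ent_adjf adj_def)

lemma fm_one: "fm (1\<^sub>m m) = idn m"
  by (rule fmat_eqI) (auto simp: ent_fm ent_idn)

lemma fm_minus: "A \<in> carrier_mat m m \<Longrightarrow> B \<in> carrier_mat m m \<Longrightarrow> fm (A - B) = fm A - fm B"
  by (rule fmat_eqI) (auto simp: ent_fm ent_diff)

lemma fm_kron:
  assumes "d > 0" "A \<in> carrier_mat m m" "B \<in> carrier_mat d d" shows "fm (kron A B) = krf d (fm A) (fm B)"
  by (rule fmat_eqI) (use assms in \<open>auto simp: ent_fm ent_krf kron_def div_less_iff_less_mult\<close>)

lemma tpow_carrier: "A \<in> carrier_mat d d \<Longrightarrow> tpow A n \<in> carrier_mat (d ^ n) (d ^ n)"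
  by (induction n) (auto simp: kron_def mult.commute)

lemma fm_tpow: "d > 0 \<Longrightarrow> A \<in> carrier_mat d d \<Longrightarrow> fm (tpow A n) = tpf d (fm A) n"
  by (induction n) (auto simp: fm_one fm_kron[OF _ tpow_carrier])

text \<open>\<open>inner\<close> conjugates its first argument, hence the adjoint; it disappears for
  the Hermitian states.\<close>

lemma Re_mtrace_mult:
  assumes "A \<in> carrier_mat m m" "B \<in> carrier_mat m m"
  shows "Re (mtrace (A * B)) = inner (adjf (fm A)) (fm B)"
proof -
  have "Re (mtrace (A * B)) = (\<Sum>i<m. \<Sum>k<m. Re (A $$ (i, k) * B $$ (k, i)))"
    using assms by (simp add: mtrace_def scalar_prod_def atLeast0LessThan)
  also have "\<dots> = (\<Sum>k<m. \<Sum>i<m. Re (A $$ (i, k) * B $$ (k, i)))" by (rule sum.swap)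
  also have "\<dots> = inner (adjf (fm A)) (fm B)"
    using assms by (subst inner_fmat[of m]) (auto simp: fits_adjf fits_fm ent_adjf ent_fm intro!: sum.cong)
  finally show ?thesis .
qed

lemma Re_mtrace: "A \<in> carrier_mat m m \<Longrightarrow> Re (mtrace A) = inner (adjf (fm A)) (idn m)"
  using Re_mtrace_mult[of A m "1\<^sub>m m"] by (simp add: fm_one)

lemma quad_two:
  fixes a :: "nat \<Rightarrow> nat \<Rightarrow> complex"
  assumes "p < m" "q < m" "p \<noteq> q"
  shows "(\<Sum>i<m. \<Sum>j<m. cnj (if i = p then \<alpha> else if i = q then \<beta> else 0) * a i j * (if j = p then \<alpha> else if j = q then \<beta> else 0))
    = cnj \<alpha> * \<alpha> * a p p + cnj \<alpha> * \<beta> * a p q + cnj \<beta> * \<alpha> * a q p + cnj \<beta> * \<beta> * a q q"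
proof -
  let ?v = "\<lambda>i. if i = p then \<alpha> else if i = q then \<beta> else 0"
  have "(\<Sum>i<m. \<Sum>j<m. cnj (?v i) * a i j * ?v j) = (\<Sum>i\<in>{p,q}. \<Sum>j<m. cnj (?v i) * a i j * ?v j)"
    using assms by (intro sum.mono_neutral_right) auto
  also have "\<dots> = (\<Sum>i\<in>{p,q}. \<Sum>j\<in>{p,q}. cnj (?v i) * a i j * ?v j)"
    using assms by (intro sum.cong refl sum.mono_neutral_right) auto
  also have "\<dots> = cnj \<alpha> * \<alpha> * a p p + cnj \<alpha> * \<beta> * a p q + cnj \<beta> * \<alpha> * a q p + cnj \<beta> * \<beta> * a q q"
    using assms by (simp add: algebra_simps)
  finally show ?thesis .
qed

text \<open>\<open>psd\<close> asks only for a form with real nonnegative values. Over the complex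
  numbers real values alone force \<open>A\<close> to be Hermitian, by polarization.\<close>

lemma psd_hermitian:
  assumes A: "psd m A" shows "adjf (fm A) = fm A"
proof -
  have car: "A \<in> carrier_mat m m" using A by (simp add: psd_def)
  have form: "Im (\<Sum>i<m. \<Sum>j<m. cnj (v i) * A $$ (i,j) * v j) = 0" for v
  proof -
    have "vec m v \<in> carrier_vec m" by simp
    then have "Im (\<Sum>i<m. \<Sum>j<m. cnj (vec m v $ i) * A $$ (i,j) * vec m v $ j) = 0"
      using A unfolding psd_def Let_def by blast
    then show ?thesis by simp
  qed
  have two: "Im (cnj \<alpha> * \<alpha> * A $$ (p,p) + cnj \<alpha> * \<beta> * A $$ (p,q) + cnj \<beta> * \<alpha> * A $$ (q,p) + cnj \<beta> * \<beta> * A $$ (q,q)) = 0"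
    if "p < m" "q < m" "p \<noteq> q" for p q \<alpha> \<beta>
    using form[of "\<lambda>i. if i = p then \<alpha> else if i = q then \<beta> else 0"] quad_two[OF that, of \<alpha> \<beta> "\<lambda>i j. A $$ (i,j)"]
    by simp
  have diag: "Im (A $$ (p,p)) = 0" if "p < m" for p
  proof -
    have "(\<Sum>i<m. \<Sum>j<m. cnj (if i = p then 1 else 0) * A $$ (i,j) * (if j = p then 1 else 0))
      = (\<Sum>i<m. if i = p then (\<Sum>j<m. if j = p then A $$ (i,j) else 0) else 0)"
    proof (rule sum.cong[OF refl])
      fix i
      have "(\<Sum>j<m. A $$ (i,j) * (if j = p then 1 else 0)) = (\<Sum>j<m. if j = p then A $$ (i,j) else 0)"
        by (rule sum.cong) auto
      then show "(\<Sum>j<m. cnj (if i = p then 1 else 0) * A $$ (i,j) * (if j = p then 1 else 0))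
        = (if i = p then (\<Sum>j<m. if j = p then A $$ (i,j) else 0) else 0)" by (cases "i = p") simp_all
    qed
    also have "\<dots> = A $$ (p,p)" using that by simp
    finally show ?thesis using form[of "\<lambda>i. if i = p then 1 else 0"] by simp
  qed
  have "cnj (A $$ (q,p)) = A $$ (p,q)" if "p < m" "q < m" for p q
  proof (cases "p = q")
    case True
    then show ?thesis using diag that by (simp add: complex_eq_iff)
  next
    case False
    \<comment> \<open>The vectors \<open>(1, 1)\<close> and \<open>(1, \<i>)\<close> at the
      positions \<open>p\<close>, \<open>q\<close> fix the imaginary and the real part.\<close>
    show ?thesis using two[OF that False, of 1 1] two[OF that False, of 1 \<i>] diag that
      by (simp add: complex_eq_iff)
  qed
  then show ?thesis using car by (intro fmat_eqI) (auto simp: ent_adjf ent_fm)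
qed

lemma psd_inner:
  assumes A: "psd m A" shows "0 \<le> inner X (fm A * X)"
proof -
  have car: "A \<in> carrier_mat m m" using A by (simp add: psd_def)
  obtain n0 where n0: "fits n0 X" using fits_ex by blast
  define n where "n = max m n0"
  have n: "fits n X" "m \<le> n" using fits_mono[OF n0] by (auto simp: n_def)
  have "inner X (fm A * X) = (\<Sum>i<n. \<Sum>k<n. Re (cnj (ent X i k) * (\<Sum>j<m. ent (fm A) i j * ent X j k)))"
    by (simp add: inner_fmat[OF n(1)] ent_mult_left[OF fits_fm[OF car]])
  also have "\<dots> = (\<Sum>i<m. \<Sum>k<n. Re (cnj (ent X i k) * (\<Sum>j<m. ent (fm A) i j * ent X j k)))"
    using n car by (intro sum.mono_neutral_right) (auto simp: ent_fm)
  also have "\<dots> = (\<Sum>k<n. Re (\<Sum>i<m. \<Sum>j<m. cnj (ent X i k) * A $$ (i,j) * ent X j k))"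
    using car by (subst sum.swap) (simp add: ent_fm sum_distrib_left mult.assoc)
  also have "\<dots> \<ge> 0"
  proof (rule sum_nonneg)
    fix k
    have "vec m (\<lambda>i. ent X i k) \<in> carrier_vec m" by simp
    then have "0 \<le> Re (\<Sum>i<m. \<Sum>j<m. cnj (vec m (\<lambda>i. ent X i k) $ i) * A $$ (i,j) * vec m (\<lambda>i. ent X i k) $ j)"
      using A unfolding psd_def Let_def by blast
    then show "0 \<le> Re (\<Sum>i<m. \<Sum>j<m. cnj (ent X i k) * A $$ (i,j) * ent X j k)" by simp
  qed
  finally show ?thesis .
qed

lemma proj_psd:
  assumes T: "fits m T" "adjf T = T" "T * T = T" shows "psd m (mf m T)"
  unfolding psd_def Let_def
proof (intro conjI ballI)
  fix v :: "complex vec" assume v: "v \<in> carrier_vec m"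
  \<comment> \<open>This is \<open>T = adjf T * T\<close> entrywise; it turns the form into a sum of
    squared moduli.\<close>
  have e: "ent T i j = (\<Sum>k<m. cnj (ent T k i) * ent T k j)" for i j
    using ent_mult_left[OF T(1), of T i j] T(3) ent_adjf[of T i] by (simp add: T(2))
  have "(\<Sum>i<m. \<Sum>j<m. cnj (v $ i) * mf m T $$ (i, j) * v $ j)
    = (\<Sum>i<m. \<Sum>j<m. \<Sum>k<m. cnj (ent T k i * v $ i) * (ent T k j * v $ j))"
    by (intro sum.cong refl) (simp add: mf_def, subst e, simp add: sum_distrib_left sum_distrib_right mult_ac)
  also have "\<dots> = (\<Sum>i<m. \<Sum>k<m. \<Sum>j<m. cnj (ent T k i * v $ i) * (ent T k j * v $ j))"
    by (intro sum.cong refl sum.swap)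
  also have "\<dots> = (\<Sum>k<m. \<Sum>i<m. \<Sum>j<m. cnj (ent T k i * v $ i) * (ent T k j * v $ j))"
    by (rule sum.swap)
  also have "\<dots> = (\<Sum>k<m. cnj (\<Sum>i<m. ent T k i * v $ i) * (\<Sum>j<m. ent T k j * v $ j))"
    by (simp add: sum_product)
  also have "\<dots> = (\<Sum>k<m. of_real ((cmod (\<Sum>j<m. ent T k j * v $ j))\<^sup>2))"
    by (intro sum.cong refl) (metis complex_norm_square mult.commute)
  finally have z: "(\<Sum>i<m. \<Sum>j<m. cnj (v $ i) * mf m T $$ (i, j) * v $ j)
    = of_real (\<Sum>k<m. (cmod (\<Sum>j<m. ent T k j * v $ j))\<^sup>2)" by simp
  show "Im (\<Sum>i<m. \<Sum>j<m. cnj (v $ i) * mf m T $$ (i, j) * v $ j) = 0" unfolding z by simp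
  show "0 \<le> Re (\<Sum>i<m. \<Sum>j<m. cnj (v $ i) * mf m T $$ (i, j) * v $ j)" unfolding z by (simp add: sum_nonneg)
qed simp

lemma is_test_testf: "is_test d n T \<Longrightarrow> testf (d ^ n) (fm T)"
  using psd_inner[of "d ^ n" "1\<^sub>m (d ^ n) - T"]
  by (auto simp: is_test_def testf_def psd_hermitian psd_inner fits_fm psd_def[of _ T] fm_minus[of _ "d ^ n"] fm_one)

lemma proj_is_test:
  assumes T: "fits (d ^ n) T" "adjf T = T" "T * T = T" shows "is_test d n (mf (d ^ n) T)"
proof -
  let ?m = "d ^ n"
  have "1\<^sub>m ?m - mf ?m T = mf ?m (idn ?m - T)"
    by (rule fm_inject[of _ ?m ?m]) (auto simp: fm_minus[of _ ?m] fm_one fm_mf T fits_diff minus_carrier_mat)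
  moreover have "psd ?m (mf ?m (idn ?m - T))"
    using proj_compl[OF T] T by (intro proj_psd) (auto simp: fits_diff)
  ultimately show ?thesis using proj_psd[OF T] by (simp add: is_test_def)
qed

lemma err_errf:
  assumes d: "d > 0" and p: "psd d \<rho>0" "psd d \<rho>1" and T: "T \<in> carrier_mat (d ^ n) (d ^ n)"
  shows "err d \<rho>0 \<rho>1 n T = errf (d ^ n) (tpf d (fm \<rho>0) n) (tpf d (fm \<rho>1) n) (fm T)"
proof -
  have car: "\<rho>0 \<in> carrier_mat d d" "\<rho>1 \<in> carrier_mat d d" using p by (auto simp: psd_def)
  show ?thesis unfolding err_def errf_def plus_complex.sel
    using tpow_carrier[OF car(1), of n] tpow_carrier[OF car(2), of n] T p car d
    by (simp add: Re_mtrace_mult[of _ "d ^ n"] fm_tpow adjf_tpf psd_hermitian fm_minus[of _ "d ^ n"] fm_one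
        minus_carrier_mat)
qed

section \<open>Bounds on the error probabilities\<close>

text \<open>Counts the tensor positions at which the base-\<open>d\<close> digits of the row and
  column index form the pair \<open>p\<close>. An entry of a tensor power depends on the indices
  only through these counts.\<close>

fun cnt :: "nat \<Rightarrow> nat \<Rightarrow> nat \<Rightarrow> nat \<Rightarrow> nat \<times> nat \<Rightarrow> nat" where
  "cnt d 0 i j p = 0"
| "cnt d (Suc n) i j p = cnt d n (i div d) (j div d) p + (if p = (i mod d, j mod d) then 1 else 0)"

lemma cnt_le: "cnt d n i j p \<le> n"
  by (induction n arbitrary: i j) (auto simp: le_SucI)

lemma ent_tpf:
  assumes d: "d > 0" and "i < d ^ n" "j < d ^ n"
  shows "ent (tpf d A n) i j = (\<Prod>p\<in>{..<d} \<times> {..<d}. ent A (fst p) (snd p) ^ cnt d n i j p)"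
  using assms(2,3)
proof (induction n arbitrary: i j)
  case 0
  then show ?case by (simp add: ent_idn)
next
  case (Suc n)
  let ?K = "{..<d} \<times> {..<d}" and ?q = "(i mod d, j mod d)"
  have "i div d < d ^ n" "j div d < d ^ n" using Suc.prems d by (simp_all add: div_less_iff_less_mult mult.commute)
  note IH = Suc.IH[OF this]
  have "(\<Prod>p\<in>?K. ent A (fst p) (snd p) ^ cnt d (Suc n) i j p) =
    (\<Prod>p\<in>?K. ent A (fst p) (snd p) ^ cnt d n (i div d) (j div d) p * (if p = ?q then ent A (fst p) (snd p) else 1))"
    by (rule prod.cong) auto
  also have "\<dots> = ent (tpf d A n) (i div d) (j div d) * ent A (i mod d) (j mod d)"
    using d by (simp add: prod.distrib IH)
  also have "\<dots> = ent (tpf d A (Suc n)) i j" using d by (simp add: ent_krf)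
  finally show ?case by simp
qed

text \<open>The count vectors classify the index pairs independently of \<open>A\<close>, so one
  polynomially small generating set works for all \<open>n\<close>-th tensor powers; the 2 comes
  from real scalars.\<close>

lemma tpf_in_span_small:
  assumes d: "d > 0"
  obtains S where "finite S" "card S \<le> 2 * (n + 1) ^ (d * d)" "\<And>A. tpf d A n \<in> span S"
proof -
  let ?K = "{..<d} \<times> {..<d}"
  define key where "key i j = restrict (cnt d n i j) ?K" for i j
  have "card (case_prod key ` ({..<d ^ n} \<times> {..<d ^ n})) \<le> (n + 1) ^ card ?K"
  proof (rule card_count_le[of _ _ "\<lambda>x. cnt d n (fst x) (snd x)"])
    fix x y assume "\<And>k. k \<in> ?K \<Longrightarrow> cnt d n (fst x) (snd x) k = cnt d n (fst y) (snd y) k"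
    then show "case_prod key x = case_prod key y"
      by (auto simp: key_def case_prod_unfold intro!: restrict_ext)
  qed (auto simp: cnt_le)
  then have "card (inds (d ^ n) key) \<le> 2 * (n + 1) ^ (d * d)"
    using card_inds[of "d ^ n" key] by simp
  moreover have "tpf d A n \<in> span (inds (d ^ n) key)" for A
  proof (rule in_span_inds[OF fits_tpf[OF d]])
    fix i j i' j' assume b: "i < d ^ n" "j < d ^ n" "i' < d ^ n" "j' < d ^ n" and k: "key i j = key i' j'"
    have "cnt d n i j p = cnt d n i' j' p" if "p \<in> ?K" for p
      using k that unfolding key_def by (metis restrict_apply')
    then show "ent (tpf d A n) i j = ent (tpf d A n) i' j'"
      unfolding ent_tpf[OF d b(1,2)] ent_tpf[OF d b(3,4)] by (intro prod.cong) auto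
  qed
  ultimately show ?thesis using that by (metis finite_inds)
qed

lemma norm_tpf: "d > 0 \<Longrightarrow> fits d C \<Longrightarrow> norm (tpf d C n) = norm C ^ n"
proof (induction n)
  case 0
  have "(norm (idn 1))\<^sup>2 = 1\<^sup>2" by (simp add: norm_fits[of 1] ent_idn)
  then show ?case by (subst (asm) power2_eq_iff_nonneg) auto
qed (simp add: norm_krf)

section \<open>Error probabilities of a pair of densities\<close>

context
  fixes d :: nat and \<rho>0 \<rho>1 :: "complex mat"
  assumes dens0: "density d \<rho>0" and dens1: "density d \<rho>1"
begin

lemma dim_pos: "d > 0"
proof (rule ccontr)
  assume "\<not> 0 < d"
  then show False using dens0 by (auto simp: density_def psd_def mtrace_def)
qed

lemma psd01: "psd d \<rho>0" "psd d \<rho>1"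
  using dens0 dens1 by (auto simp: density_def)

lemma density_factor:
  assumes "density d \<rho>"
  obtains C where "fits d C" "fm \<rho> = C * adjf C" "norm C = 1"
proof -
  have p: "psd d \<rho>" using assms by (simp add: density_def)
  then have car: "\<rho> \<in> carrier_mat d d" by (simp add: psd_def)
  obtain C where C: "fits d C" "fm \<rho> = C * adjf C"
    using psd_factor[OF fits_fm[OF car] psd_hermitian[OF p] psd_inner[OF p]] by metis
  have "(norm C)\<^sup>2 = inner (fm \<rho>) (idn d)" using C by (simp add: inner_mult_right idn_mult norm2_eq_inner)
  also have "\<dots> = Re (mtrace \<rho>)" using Re_mtrace[OF car] psd_hermitian[OF p] by simp
  also have "\<dots> = 1\<^sup>2" using assms by (simp add: density_def)
  finally have "norm C = 1" by (subst (asm) power2_eq_iff_nonneg) auto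
  then show ?thesis using that C by blast
qed

lemma tpf_density_factor:
  assumes "density d \<rho>"
  obtains C where "fits (d ^ n) C" "tpf d (fm \<rho>) n = C * adjf C" "norm C = 1"
proof -
  obtain C where "fits d C" "fm \<rho> = C * adjf C" "norm C = 1" using density_factor[OF assms] by metis
  then show ?thesis using that[of "tpf d C n"] dim_pos
    by (simp add: fits_tpf tpf_mult adjf_tpf norm_tpf)
qed

lemma tpf_density_idn: "density d \<rho> \<Longrightarrow> inner (tpf d (fm \<rho>) n) (idn (d ^ n)) = 1"
  by (erule tpf_density_factor[of \<rho> n]) (simp add: inner_mult_right idn_mult flip: norm2_eq_inner)

abbreviation "Er n \<equiv> errf (d ^ n) (tpf d (fm \<rho>0) n) (tpf d (fm \<rho>1) n)"

lemma errf_nonneg: "testf (d ^ n) T \<Longrightarrow> 0 \<le> Er n T"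
  by (rule tpf_density_factor[OF dens0, of n], rule tpf_density_factor[OF dens1, of n])
    (simp add: errf_def testf_def inner_mult_right)

lemma err_Er: "is_test d n T \<Longrightarrow> err d \<rho>0 \<rho>1 n T = Er n (fm T)"
  using err_errf[OF dim_pos psd01] by (simp add: is_test_def psd_def)

lemma err_mf: "fits (d ^ n) T \<Longrightarrow> err d \<rho>0 \<rho>1 n (mf (d ^ n) T) = Er n T"
  using err_errf[OF dim_pos psd01, of "mf (d ^ n) T" n] by (simp add: fm_mf)

lemma err_nonneg: "is_test d n T \<Longrightarrow> 0 \<le> err d \<rho>0 \<rho>1 n T"
  using err_Er errf_nonneg is_test_testf by simp

lemma Er_zero: "Er n 0 = 1"
  using tpf_density_idn[OF dens0] by (simp add: errf_def)

text \<open>The zero test has error 1. It shows that the sets of errors are nonempty and bounds the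
  optimum.\<close>

lemma zero_test: "is_test d n (mf (d ^ n) 0)"
  by (rule proj_is_test) auto

lemma Pmin_full_le: "is_test d n T \<Longrightarrow> Pmin_full d \<rho>0 \<rho>1 n \<le> err d \<rho>0 \<rho>1 n T"
  unfolding Pmin_full_def using err_nonneg by (intro cInf_lower) (auto intro!: bdd_belowI[of _ 0])

lemma Pmin_full_greatest:
  assumes "\<And>T. is_test d n T \<Longrightarrow> c \<le> err d \<rho>0 \<rho>1 n T" shows "c \<le> Pmin_full d \<rho>0 \<rho>1 n"
  unfolding Pmin_full_def using assms zero_test by (intro cInf_greatest) auto

lemma Pmin_full_nonneg: "0 \<le> Pmin_full d \<rho>0 \<rho>1 n"
  using err_nonneg by (rule Pmin_full_greatest)

lemma Pmin_full_le_1: "Pmin_full d \<rho>0 \<rho>1 n \<le> 1"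
  using Pmin_full_le[OF zero_test] by (simp add: err_mf Er_zero)

lemma Pmin_full_approx:
  assumes "\<eta> > 0" obtains T where "is_test d n T" "err d \<rho>0 \<rho>1 n T < Pmin_full d \<rho>0 \<rho>1 n + \<eta>"
proof -
  have "\<exists>T. is_test d n T \<and> err d \<rho>0 \<rho>1 n T < Pmin_full d \<rho>0 \<rho>1 n + \<eta>"
  proof (rule ccontr)
    assume "\<not> ?thesis"
    then have "Pmin_full d \<rho>0 \<rho>1 n + \<eta> \<le> Pmin_full d \<rho>0 \<rho>1 n"
      by (intro Pmin_full_greatest) (auto simp: not_less)
    then show False using assms by simp
  qed
  then show ?thesis using that by blast
qed

lemma Pmin_inv_le:
  "is_test d n T \<Longrightarrow> (\<And>g. g \<in> Gs \<Longrightarrow> T * tpow (u g) n = tpow (u g) n * T) \<Longrightarrow>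
    Pmin_inv d u Gs \<rho>0 \<rho>1 n \<le> err d \<rho>0 \<rho>1 n T"
  unfolding Pmin_inv_def using err_nonneg by (intro cInf_lower) (auto intro!: bdd_belowI[of _ 0])

lemma Pmin_full_le_inv:
  assumes u: "\<And>g. g \<in> Gs \<Longrightarrow> u g \<in> carrier_mat d d"
  shows "Pmin_full d \<rho>0 \<rho>1 n \<le> Pmin_inv d u Gs \<rho>0 \<rho>1 n"
  unfolding Pmin_inv_def
proof (rule cInf_greatest)
  have "mf (d ^ n) 0 * tpow (u g) n = tpow (u g) n * mf (d ^ n) 0" if "g \<in> Gs" for g
  proof -
    have c: "tpow (u g) n \<in> carrier_mat (d ^ n) (d ^ n)" using u that tpow_carrier by blast
    show ?thesis
      by (rule fm_inject[of _ "d ^ n" "d ^ n"])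
        (auto intro!: mult_carrier_mat c simp: fm_mult[of _ "d ^ n"] c fm_mf)
  qed
  then show "{err d \<rho>0 \<rho>1 n T |T. is_test d n T \<and> (\<forall>g\<in>Gs. T * tpow (u g) n = tpow (u g) n * T)} \<noteq> {}"
    using zero_test by blast
qed (auto intro: Pmin_full_le)

text \<open>Sandwiches the quantum error by one classical sequence; all dependence on matrices is
  confined to the weights \<open>w\<close> and the eigenvalues.\<close>

lemma Pmin_full_clsum:
  obtains w and I J :: "real set" and k :: nat where
    "finite I" "finite J" "\<And>a. a \<in> I \<Longrightarrow> 0 \<le> a" "\<And>b. b \<in> J \<Longrightarrow> 0 \<le> b" "\<And>a b. 0 \<le> (w a b :: real)"
    "\<And>n. clsum w (\<lambda>a. a) I (\<lambda>b. b) J n 1 1 \<le> 2 * Pmin_full d \<rho>0 \<rho>1 n"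
    "\<And>n. Pmin_full d \<rho>0 \<rho>1 n \<le> 5 * ((real n + 1) ^ k + 1) * clsum w (\<lambda>a. a) I (\<lambda>b. b) J n 1 1"
proof -
  have car: "\<rho>0 \<in> carrier_mat d d" "\<rho>1 \<in> carrier_mat d d" using psd01 by (auto simp: psd_def)
  obtain I E where E: "resol d I E" and I: "\<And>a. a \<in> I \<Longrightarrow> 0 \<le> a" and r0: "fm \<rho>0 = (\<Sum>a\<in>I. a *\<^sub>R E a)"
    using spectral_resolution_psd[OF fits_fm[OF car(1)] psd_hermitian[OF psd01(1)] psd_inner[OF psd01(1)]] by metis
  obtain J F where F: "resol d J F" and J: "\<And>a. a \<in> J \<Longrightarrow> 0 \<le> a" and r1: "fm \<rho>1 = (\<Sum>a\<in>J. a *\<^sub>R F a)"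
    using spectral_resolution_psd[OF fits_fm[OF car(2)] psd_hermitian[OF psd01(2)] psd_inner[OF psd01(2)]] by metis
  define w where "w a b = (norm (F b * E a))\<^sup>2" for a b
  let ?c = "\<lambda>n. clsum w (\<lambda>a. a) I (\<lambda>b. b) J n 1 1"
  let ?l = "\<lambda>xs. \<Prod>x\<leftarrow>xs. x :: real"
  have l0: "0 \<le> ?l xs" if "xs \<in> words I n" for xs n
    using that I by (auto simp: words_def intro!: prod_list_nonneg)
  have u0: "0 \<le> ?l xs" if "xs \<in> words J n" for xs n
    using that J by (auto simp: words_def intro!: prod_list_nonneg)
  note d = dim_pos
  have t: "tpf d (fm \<rho>0) n = (\<Sum>xs\<in>words I n. ?l xs *\<^sub>R listproj d E xs)"
    "tpf d (fm \<rho>1) n = (\<Sum>xs\<in>words J n. ?l xs *\<^sub>R listproj d F xs)" for n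
    unfolding r0 r1 by (rule tpf_listproj[OF d])+
  note Er = resol_listproj[OF d E] and Fr = resol_listproj[OF d F]
  have cl: "clerr (words I n) (listproj d E) ?l (words J n) (listproj d F) ?l = ?c n" for n
    using clerr_listproj[OF d E F, of n "\<lambda>x. x" "\<lambda>x. x"] by (simp add: w_def[abs_def])
  have lower: "?c n \<le> 2 * Pmin_full d \<rho>0 \<rho>1 n" for n
  proof -
    have "?c n / 2 \<le> err d \<rho>0 \<rho>1 n T" if T: "is_test d n T" for T
    proof -
      have "?c n \<le> 2 * Er n (fm T)" unfolding t cl[symmetric]
        by (rule errf_ge_clerr[OF Er Fr is_test_testf[OF T]]) (erule l0 u0)+
      then show ?thesis by (simp add: err_Er[OF T])
    qed
    from Pmin_full_greatest[OF this] show ?thesis by simp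
  qed
  have upper: "Pmin_full d \<rho>0 \<rho>1 n \<le> 5 * ((real n + 1) ^ card I + 1) * ?c n" for n
  proof -
    note g = resol_regroup[OF Er[of n], of ?l]
    let ?E = "\<lambda>v. \<Sum>xs\<in>{xs \<in> words I n. ?l xs = v}. listproj d E xs"
    have l0': "0 \<le> a" if "a \<in> ?l ` words I n" for a using that l0 by blast
    obtain T where T: "fits (d ^ n) T" "adjf T = T" "T * T = T" and
      "errf (d ^ n) (\<Sum>a\<in>?l ` words I n. a *\<^sub>R ?E a) (\<Sum>xs\<in>words J n. ?l xs *\<^sub>R listproj d F xs) T
       \<le> 5 * (card (?l ` words I n) + 1) * clerr (?l ` words I n) ?E (\<lambda>a. a) (words J n) (listproj d F) ?l"
      by (rule errf_le_clerr[OF g(1) Fr l0' u0]) (assumption, assumption, rule that)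
    then have T4: "Er n T \<le> 5 * (card (?l ` words I n) + 1) * ?c n"
      unfolding g(2) g(3) cl t by blast
    have "?c n \<ge> 0" unfolding cl[symmetric] clerr_def using l0 u0 by (auto intro!: sum_nonneg)
    moreover have "card (?l ` words I n) \<le> (n + 1) ^ card I"
      by (rule card_prod_words) (rule resolD(1)[OF E])
    then have "real (card (?l ` words I n)) \<le> (real n + 1) ^ card I"
      by (metis of_nat_1 of_nat_add of_nat_le_iff of_nat_power)
    ultimately have "5 * (card (?l ` words I n) + 1) * ?c n \<le> 5 * ((real n + 1) ^ card I + 1) * ?c n"
      by (intro mult_right_mono) auto
    moreover have "Pmin_full d \<rho>0 \<rho>1 n \<le> Er n T"
      using Pmin_full_le[OF proj_is_test[OF T(1-3)]] by (simp add: err_mf[OF T(1)])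
    ultimately show ?thesis using T4 by linarith
  qed
  show ?thesis
    by (rule that[of I J w "card I"]) (use resolD(1)[OF E] resolD(1)[OF F] I J lower upper in \<open>auto simp: w_def\<close>)
qed

lemma Pmin_inv_le_sqrt:
  fixes G :: "('g, 'b) monoid_scheme" and u :: "'g \<Rightarrow> complex mat"
  assumes grp: "group G" and uni: "\<And>g. g \<in> carrier G \<Longrightarrow> unitary_mat d (u g)"
    and hom: "\<And>g h. g \<in> carrier G \<Longrightarrow> h \<in> carrier G \<Longrightarrow> u (g \<otimes>\<^bsub>G\<^esub> h) = u g * u h"
    and inv1: "\<And>g. g \<in> carrier G \<Longrightarrow> \<rho>1 * u g = u g * \<rho>1"
  shows "Pmin_inv d u (carrier G) \<rho>0 \<rho>1 n \<le> (2 * (real n + 1) ^ (d * d) + 6) * sqrt (Pmin_full d \<rho>0 \<rho>1 n)"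
proof -
  interpret group G by (rule grp)
  note d = dim_pos
  have car: "u g \<in> carrier_mat d d" if "g \<in> carrier G" for g using uni[OF that] by (simp add: unitary_mat_def)
  have rcar: "\<rho>1 \<in> carrier_mat d d" using psd01 by (auto simp: psd_def)
  define v where "v g = fm (u g)" for g
  have vfit: "fits d (v g)" if "g \<in> carrier G" for g unfolding v_def using car[OF that] by (rule fits_fm)
  have vv: "adjf (v g) * v g = idn d" "v g * adjf (v g) = idn d" if g: "g \<in> carrier G" for g
  proof -
    have a: "adj (u g) \<in> carrier_mat d d" using car[OF g] by (intro carrier_matI) (auto simp: adj_def)
    have "fm (adj (u g) * u g) = idn d" "fm (u g * adj (u g)) = idn d"
      using uni[OF g] by (simp_all add: unitary_mat_def fm_one)
    then show "adjf (v g) * v g = idn d" "v g * adjf (v g) = idn d"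
      using a car[OF g] by (simp_all add: fm_mult[of _ d] fm_adj v_def)
  qed
  have vhom: "v (g \<otimes>\<^bsub>G\<^esub> h) = v g * v h" if "g \<in> carrier G" "h \<in> carrier G" for g h
    using that car by (simp add: v_def hom fm_mult[of _ d])
  \<comment> \<open>\<open>v\<close> of the unit is idempotent, and an idempotent unitary is the
    identity.\<close>
  have v1: "v \<one>\<^bsub>G\<^esub> = idn d"
  proof -
    have "v \<one>\<^bsub>G\<^esub> * v \<one>\<^bsub>G\<^esub> = v \<one>\<^bsub>G\<^esub>" using vhom[of "\<one>\<^bsub>G\<^esub>" "\<one>\<^bsub>G\<^esub>"] by simp
    then show ?thesis using vv(1)[of "\<one>\<^bsub>G\<^esub>"] vfit[of "\<one>\<^bsub>G\<^esub>"] by (metis idn_mult mult.assoc one_closed)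
  qed
  have vinv: "adjf (v g) = v (inv\<^bsub>G\<^esub> g)" if g: "g \<in> carrier G" for g
  proof -
    have "v (inv\<^bsub>G\<^esub> g) * v g = idn d" using vhom[of "inv\<^bsub>G\<^esub> g" g] g v1 by simp
    then have "v (inv\<^bsub>G\<^esub> g) * (v g * adjf (v g)) = adjf (v g)"
      using vfit[OF g] by (metis idn_mult mult.assoc fits_adjf)
    then show ?thesis using vv(2)[OF g] vfit[of "inv\<^bsub>G\<^esub> g"] g by (simp add: mult_idn)
  qed
  have vcom: "fm \<rho>1 * v g = v g * fm \<rho>1" if "g \<in> carrier G" for g
    using inv1[OF that] car[OF that] rcar unfolding v_def by (metis fm_mult)
  define U where "U = (\<lambda>g. tpf d (v g) n) ` carrier G"
  have U: "idn (d ^ n) \<in> U" "\<And>a. a \<in> U \<Longrightarrow> fits (d ^ n) a" "\<And>a b. a \<in> U \<Longrightarrow> b \<in> U \<Longrightarrow> a * b \<in> U"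
      "\<And>a. a \<in> U \<Longrightarrow> adjf a \<in> U" "\<And>a. a \<in> U \<Longrightarrow> adjf a * a = idn (d ^ n)"
      "\<And>a. a \<in> U \<Longrightarrow> tpf d (fm \<rho>1) n * a = a * tpf d (fm \<rho>1) n"
  proof -
    show "idn (d ^ n) \<in> U" unfolding U_def using v1 tpf_idn[OF d] by (metis image_eqI one_closed)
    show "fits (d ^ n) a" if "a \<in> U" for a using that fits_tpf[OF d] by (auto simp: U_def)
    show "a * b \<in> U" if "a \<in> U" "b \<in> U" for a b
      using that by (auto simp: U_def vfit vhom[symmetric] tpf_mult[OF d, symmetric])
    show "adjf a \<in> U" if "a \<in> U" for a using that by (auto simp: U_def adjf_tpf[OF d] vinv)
    show "adjf a * a = idn (d ^ n)" if "a \<in> U" for a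
      using that by (auto simp: U_def adjf_tpf[OF d] tpf_mult[OF d, symmetric] fits_adjf vfit vv tpf_idn[OF d])
    show "tpf d (fm \<rho>1) n * a = a * tpf d (fm \<rho>1) n" if "a \<in> U" for a
      using that by (auto simp: U_def tpf_mult[OF d, symmetric] fits_fm[OF rcar] vfit vcom)
  qed
  obtain S where S: "finite S" "card S \<le> 2 * (n + 1) ^ (d * d)" "\<And>A. tpf d A n \<in> span S"
    using tpf_in_span_small[OF d] by metis
  have US: "U \<subseteq> span S" using S(3) by (auto simp: U_def)
  obtain B where B: "fits (d ^ n) B" "tpf d (fm \<rho>1) n = B * adjf B" using tpf_density_factor[OF dens1] by metis
  obtain C where C: "fits (d ^ n) C" "tpf d (fm \<rho>0) n = C * adjf C" using tpf_density_factor[OF dens0] by metis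
  define D where "D = 2 * (real n + 1) ^ (d * d) + 6"
  define P where "P = Pmin_full d \<rho>0 \<rho>1 n"
  have P: "0 \<le> P" "P \<le> 1" using Pmin_full_nonneg Pmin_full_le_1 by (auto simp: P_def)
  have D: "real (card S) + 6 \<le> D" "D \<ge> 0"
  proof -
    have "real (card S) \<le> real (2 * (n + 1) ^ (d * d))" using S(2) by (rule of_nat_mono)
    then show "real (card S) + 6 \<le> D" by (simp add: D_def add.commute)
    then show "D \<ge> 0" by linarith
  qed
  \<comment> \<open>Near-optimal tests suffice. The slack \<open>\<eta>\<close> makes
    \<open>P + \<eta>\<close> positive even for \<open>P = 0\<close>, and \<open>\<eta> < 1\<close>
    keeps it below 4, as \<open>invariant_test\<close> requires.\<close>
  have bound: "Pmin_inv d u (carrier G) \<rho>0 \<rho>1 n \<le> D * sqrt (P + \<eta>)" if eta: "0 < \<eta>" "\<eta> < 1" for \<eta>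
  proof -
    obtain T where T: "is_test d n T" "err d \<rho>0 \<rho>1 n T < P + \<eta>" using Pmin_full_approx[OF eta(1)] P_def by metis
    obtain T' where T': "fits (d ^ n) T'" "adjf T' = T'" "T' * T' = T'" "\<And>a. a \<in> U \<Longrightarrow> T' * a = a * T'"
      "Er n T' \<le> (card S + 6) * sqrt (P + \<eta>)"
      by (rule invariant_test[OF U(1-5) US S(1) B(2,1) U(6) C(2,1) tpf_density_idn[OF dens0] is_test_testf[OF T(1)], of "P + \<eta>"])
        (use T P eta err_Er[OF T(1)] that in auto)
    have "mf (d ^ n) T' * tpow (u g) n = tpow (u g) n * mf (d ^ n) T'" if g: "g \<in> carrier G" for g
    proof -
      have c: "tpow (u g) n \<in> carrier_mat (d ^ n) (d ^ n)" using car[OF g] by (rule tpow_carrier)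
      have "T' * fm (tpow (u g) n) = fm (tpow (u g) n) * T'"
        using T'(4) g unfolding fm_tpow[OF d car[OF g]] by (auto simp: U_def v_def)
      then show ?thesis
        by (intro fm_inject[of _ "d ^ n" "d ^ n"])
          (auto intro!: mult_carrier_mat c simp: fm_mult[of _ "d ^ n"] c fm_mf T')
    qed
    then have "Pmin_inv d u (carrier G) \<rho>0 \<rho>1 n \<le> Er n T'"
      using Pmin_inv_le[OF proj_is_test[OF T'(1-3)]] err_mf[OF T'(1)] by metis
    also have "\<dots> \<le> (card S + 6) * sqrt (P + \<eta>)" by (rule T')
    also have "\<dots> \<le> D * sqrt (P + \<eta>)" using D P eta by (intro mult_right_mono) auto
    finally show ?thesis .
  qed
  have "Pmin_inv d u (carrier G) \<rho>0 \<rho>1 n \<le> D * sqrt P"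
  proof (rule tendsto_lowerbound[of "\<lambda>\<eta>. D * sqrt (P + \<eta>)" _ "at_right 0"])
    have "((\<lambda>\<eta>. D * sqrt (P + \<eta>)) \<longlongrightarrow> D * sqrt (P + 0)) (at_right 0)"
      by (intro tendsto_intros)
    then show "((\<lambda>\<eta>. D * sqrt (P + \<eta>)) \<longlongrightarrow> D * sqrt P) (at_right 0)" by simp
    show "\<forall>\<^sub>F \<eta> in at_right 0. Pmin_inv d u (carrier G) \<rho>0 \<rho>1 n \<le> D * sqrt (P + \<eta>)"
      unfolding eventually_at_right_field using bound by (intro exI[of _ 1]) auto
  qed simp
  then show ?thesis by (simp add: D_def P_def)
qed

end

section \<open>Exponential rates\<close>

lemma clsum_nonneg:
  assumes "\<And>i. i \<in> I \<Longrightarrow> 0 \<le> a i" "\<And>j. j \<in> J \<Longrightarrow> 0 \<le> b j" "\<And>i j. 0 \<le> w i j" "0 \<le> s" "0 \<le> t"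
  shows "0 \<le> clsum w a I b J n s t"
  using assms by (induction n arbitrary: s t) (auto intro!: sum_nonneg mult_nonneg_nonneg)

lemma clsum_scale:
  assumes ab: "\<And>i. i \<in> I \<Longrightarrow> 0 \<le> a i" "\<And>j. j \<in> J \<Longrightarrow> 0 \<le> b j" "\<And>i j. 0 \<le> w i j"
    and st: "0 \<le> s" "0 \<le> t" "0 \<le> s'" "0 \<le> t'"
  shows "min s t * clsum w a I b J n s' t' \<le> clsum w a I b J n (s * s') (t * t')"
  using st
proof (induction n arbitrary: s' t')
  case 0
  then show ?case by (auto intro!: mult_mono)
next
  case (Suc n)
  have "min s t * clsum w a I b J (Suc n) s' t'
    = (\<Sum>i\<in>I. \<Sum>j\<in>J. w i j * (min s t * clsum w a I b J n (s' * a i) (t' * b j)))"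
    by (simp add: sum_distrib_left mult.left_commute)
  also have "\<dots> \<le> (\<Sum>i\<in>I. \<Sum>j\<in>J. w i j * clsum w a I b J n (s * (s' * a i)) (t * (t' * b j)))"
    using ab Suc by (intro sum_mono mult_left_mono Suc.IH) auto
  finally show ?case by (simp add: mult.assoc)
qed

text \<open>The first \<open>m\<close> letters are read into the accumulators; what is left is the
  estimate \<open>clsum_scale\<close> for those accumulators.\<close>

lemma clsum_super:
  assumes ab: "\<And>i. i \<in> I \<Longrightarrow> 0 \<le> a i" "\<And>j. j \<in> J \<Longrightarrow> 0 \<le> b j" "\<And>i j. 0 \<le> w i j"
    and st: "0 \<le> s" "0 \<le> t"
  shows "clsum w a I b J m s t * clsum w a I b J n 1 1 \<le> clsum w a I b J (m + n) s t"
  using st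
proof (induction m arbitrary: s t)
  case 0
  then show ?case using clsum_scale[of I a J b w s t 1 1 n] ab by simp
next
  case (Suc m)
  have "clsum w a I b J (Suc m) s t * clsum w a I b J n 1 1
    = (\<Sum>i\<in>I. \<Sum>j\<in>J. w i j * (clsum w a I b J m (s * a i) (t * b j) * clsum w a I b J n 1 1))"
    by (simp add: sum_distrib_right mult.assoc)
  also have "\<dots> \<le> (\<Sum>i\<in>I. \<Sum>j\<in>J. w i j * clsum w a I b J (m + n) (s * a i) (t * b j))"
    using ab Suc by (intro sum_mono mult_left_mono Suc.IH) auto
  finally show ?case by simp
qed

lemma clsum_zero:
  assumes ab: "\<And>i. i \<in> I \<Longrightarrow> 0 \<le> a i" "\<And>j. j \<in> J \<Longrightarrow> 0 \<le> b j" and st: "0 \<le> s" "0 \<le> t" "s = 0 \<or> t = 0"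
  shows "clsum w a I b J n s t = 0"
  using st
proof (induction n arbitrary: s t)
  case (Suc n)
  then have "clsum w a I b J n (s * a i) (t * b j) = 0" if "i \<in> I" "j \<in> J" for i j
    using ab that by (intro Suc.IH) auto
  then show ?case by simp
qed auto

text \<open>A vanishing one-letter error means that every pair of positive weight has a zero
  eigenvalue. Its first letter then puts a zero into an accumulator for good.\<close>

lemma clsum_eq_0:
  assumes fin: "finite I" "finite J"
    and ab: "\<And>i. i \<in> I \<Longrightarrow> 0 \<le> a i" "\<And>j. j \<in> J \<Longrightarrow> 0 \<le> b j" "\<And>i j. 0 \<le> w i j"
    and z: "clsum w a I b J 1 1 1 = 0"
  shows "clsum w a I b J (Suc n) 1 1 = 0"
proof -
  have "(\<Sum>i\<in>I. \<Sum>j\<in>J. w i j * min (a i) (b j)) = 0" using z by simp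
  then have *: "w i j * min (a i) (b j) = 0" if "i \<in> I" "j \<in> J" for i j
    using that ab fin by (simp add: sum_nonneg_eq_0_iff sum_nonneg)
  have "w i j * clsum w a I b J n (1 * a i) (1 * b j) = 0" if ij: "i \<in> I" "j \<in> J" for i j
  proof (cases "w i j = 0")
    case False
    then have "a i = 0 \<or> b j = 0" using *[OF ij] by (auto simp: min_def split: if_splits)
    then show ?thesis using clsum_zero[of I a J b "1 * a i" "1 * b j"] ab ij by auto
  qed simp
  then have "(\<Sum>i\<in>I. \<Sum>j\<in>J. w i j * clsum w a I b J n (1 * a i) (1 * b j)) = 0"
    by (intro sum.neutral ballI)
  then show ?thesis by simp
qed

text \<open>Fekete's lemma: the limit is the supremum of the quotients, which \<open>K\<close> keeps
  finite.\<close>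

lemma superadditive_limit:
  fixes f :: "nat \<Rightarrow> real"
  assumes super: "\<And>m n. f m + f n \<le> f (m + n)" and bd: "\<And>n. n > 0 \<Longrightarrow> f n \<le> real n * K"
  shows "\<exists>L. (\<lambda>n. f n / real n) \<longlonglongrightarrow> L"
proof -
  define L where "L = (SUP n\<in>{0<..}. f n / real n)"
  have bdd: "bdd_above ((\<lambda>n. f n / real n) ` {0<..})"
    using bd by (intro bdd_aboveI[of _ K]) (auto simp: field_simps)
  have ub: "f n / real n \<le> L" if "n > 0" for n
    unfolding L_def using that bdd by (intro cSUP_upper) auto
  have mult: "real q * f m \<le> f (q * m)" if "q > 0" for q m
    using that
  proof (induction q rule: nat_induct_non_zero)
    case (Suc q)
    then show ?case using super[of m "q * m"] by (simp add: distrib_right)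
  qed simp
  have "(\<lambda>n. f n / real n) \<longlonglongrightarrow> L"
  proof (rule LIMSEQ_I)
    fix e :: real assume e: "e > 0"
    have "\<exists>m\<in>{0<..}. L - e / 2 < f m / real m"
      using less_cSUP_iff[OF _ bdd, of "L - e / 2"] e by (auto simp: L_def)
    then obtain m where m: "m > 0" "L - e / 2 < f m / real m" by auto
    define R where "R = (\<Sum>r<m. \<bar>f r\<bar>)"
    have R: "- R \<le> f r" if "r < m" for r
    proof -
      have "\<bar>f r\<bar> \<le> R" unfolding R_def using that by (intro member_le_sum) auto
      then show ?thesis by linarith
    qed
    define C where "C = \<bar>f m\<bar> + R"
    \<comment> \<open>Write \<open>n\<close> as \<open>?q * m + ?r\<close>. The remainder and the
      rounding of \<open>n / m\<close> cost a constant independent of \<open>n\<close>.\<close>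
    have low: "real n * (f m / real m) - C \<le> f n" if n: "n \<ge> m" for n
    proof -
      let ?q = "n div m" and ?r = "n mod m"
      have "?q > 0" using n m by (simp add: div_greater_zero_iff)
      then have "real ?q * f m + f ?r \<le> f n"
        using super[of "?q * m" ?r] mult[of ?q m] by simp
      moreover have "real n * (f m / real m) \<le> real ?q * f m + \<bar>f m\<bar>"
      proof -
        have "real n = real ?q * real m + real ?r" by (metis div_mult_mod_eq of_nat_add of_nat_mult)
        then have "real n * (f m / real m) = real ?q * f m + (real ?r / real m) * f m"
          using m by (simp add: field_simps)
        also have "(real ?r / real m) * f m \<le> (real ?r / real m) * \<bar>f m\<bar>"
          by (intro mult_left_mono) auto
        also have "\<dots> \<le> 1 * \<bar>f m\<bar>"
          using m by (intro mult_right_mono) (auto intro: less_imp_le)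
        finally show ?thesis by simp
      qed
      moreover have "- R \<le> f ?r" using m by (intro R) simp
      ultimately show ?thesis by (simp add: C_def)
    qed
    have C0: "C \<ge> 0" by (simp add: C_def R_def sum_nonneg)
    obtain N where N: "real N > 2 * C / e" using reals_Archimedean2 by blast
    show "\<exists>no. \<forall>n\<ge>no. norm (f n / real n - L) < e"
    proof (intro exI allI impI)
      fix n assume n: "max m (Suc N) \<le> n"
      then have n0: "n > 0" "real n > 2 * C / e" using N by auto
      then have "C / real n < e / 2" using e by (simp add: field_simps)
      moreover have "f m / real m - C / real n \<le> f n / real n"
      proof -
        have "(real n * (f m / real m) - C) / real n \<le> f n / real n"
          using low[of n] n by (intro divide_right_mono) auto
        then show ?thesis using n0(1) by (simp add: diff_divide_distrib)
      qed
      ultimately have "L - e < f n / real n" using m by linarith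
      then show "norm (f n / real n - L) < e" using ub[OF n0(1)] e by simp
    qed
  qed
  then show ?thesis by blast
qed

lemma ln_poly_div_tendsto_0:
  assumes "c > 0" shows "(\<lambda>n. ln (c * (real n + 1) ^ k) / real n) \<longlonglongrightarrow> 0"
proof -
  have "(\<lambda>n. (ln c + real k * ln (real n + 1)) / real n) \<longlonglongrightarrow> 0" by real_asymp
  then show ?thesis using assms by (simp add: ln_mult ln_realpow)
qed

lemma lnE_mono: "0 \<le> x \<Longrightarrow> x \<le> y \<Longrightarrow> lnE x \<le> lnE y"
  by (auto simp: lnE_def)

text \<open>The one-letter classical error decides between the cases. The first excludes
  \<open>n = 0\<close>, where the error is at least \<open>1/2\<close>, as the classical error there
  is \<open>min 1 1\<close>.\<close>

theorem Pmin_full_limit: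
  assumes dens: "density d \<rho>0" "density d \<rho>1"
  shows "(\<forall>n>0. Pmin_full d \<rho>0 \<rho>1 n = 0) \<or>
    (\<forall>n. 0 < Pmin_full d \<rho>0 \<rho>1 n) \<and> (\<exists>L. (\<lambda>n. ln (Pmin_full d \<rho>0 \<rho>1 n) / real n) \<longlonglongrightarrow> L)"
proof -
  obtain w I J k where I: "finite I" "finite J" and ab: "\<And>a. a \<in> I \<Longrightarrow> 0 \<le> a" "\<And>b. b \<in> J \<Longrightarrow> 0 \<le> b"
    "\<And>a b. 0 \<le> (w a b :: real)"
    and lo': "\<And>n. clsum w (\<lambda>a. a) I (\<lambda>b. b) J n 1 1 \<le> 2 * Pmin_full d \<rho>0 \<rho>1 n"
    and up': "\<And>n. Pmin_full d \<rho>0 \<rho>1 n \<le> 5 * ((real n + 1) ^ k + 1) * clsum w (\<lambda>a. a) I (\<lambda>b. b) J n 1 1"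
    by (rule Pmin_full_clsum[OF dens]) (rule that)
  define P where "P n = Pmin_full d \<rho>0 \<rho>1 n" for n
  note lo = lo'[folded P_def] and up = up'[folded P_def]
  define c where "c n = clsum w (\<lambda>a. a) I (\<lambda>b. b) J n 1 1" for n
  have c0: "0 \<le> c n" for n unfolding c_def using ab by (intro clsum_nonneg) auto
  have sup: "c m * c n \<le> c (m + n)" for m n unfolding c_def using ab by (intro clsum_super) auto
  have P0: "0 \<le> P n" and P1: "P n \<le> 1" for n
    using Pmin_full_nonneg[OF dens] Pmin_full_le_1[OF dens] by (auto simp: P_def)
  show ?thesis
  proof (cases "c 1 = 0")
    case True
    have "P n = 0" if n: "n > 0" for n
    proof -
      have "c n = 0" using clsum_eq_0[OF I, of "\<lambda>a. a" "\<lambda>b. b" w "n - 1"] ab True n by (simp add: c_def)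
      then show ?thesis using up[of n] P0[of n] by (simp add: c_def)
    qed
    then show ?thesis by (simp add: P_def)
  next
    case False
    have cpos: "0 < c n" for n
    proof (induction n)
      case (Suc n)
      have "0 < c 1 * c n" using False c0[of 1] Suc by simp
      then show ?case using sup[of 1 n] by simp
    qed (simp add: c_def)
    have Ppos: "0 < P n" for n using lo[of n] cpos[of n] by (simp add: c_def)
    have "\<exists>L. (\<lambda>n. ln (c n) / real n) \<longlonglongrightarrow> L"
    \<comment> \<open>The bound \<open>ln 2\<close> comes from
      \<open>c n \<le> 2 * P n \<le> 2\<close>.\<close>
    proof (rule superadditive_limit[where K = "ln 2"])
      show "ln (c m) + ln (c n) \<le> ln (c (m + n))" for m n
      proof -
        have "ln (c m * c n) \<le> ln (c (m + n))" using sup[of m n] cpos[of m] cpos[of n] cpos[of "m + n"] by simp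
        then show ?thesis using ln_mult_pos[OF cpos cpos] by simp
      qed
      show "ln (c n) \<le> real n * ln 2" if "n > 0" for n
      proof -
        have "c n \<le> 2" using lo[of n] P1[of n] by (simp add: c_def)
        then have "ln (c n) \<le> 1 * ln 2" using cpos[of n] by simp
        also have "\<dots> \<le> real n * ln 2" using that by (intro mult_right_mono) auto
        finally show ?thesis .
      qed
    qed
    then obtain L where L: "(\<lambda>n. ln (c n) / real n) \<longlonglongrightarrow> L" by blast
    have "(\<lambda>n. ln (P n) / real n) \<longlonglongrightarrow> L"
    proof (rule tendsto_sandwich)
      have "(\<lambda>n. ln (c n) / real n - ln 2 / real n) \<longlonglongrightarrow> L - 0"
        by (intro tendsto_diff L) real_asymp
      then show "(\<lambda>n. ln (c n) / real n - ln 2 / real n) \<longlonglongrightarrow> L" by simp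
      have "(\<lambda>n. ln (c n) / real n + ln (10 * (real n + 1) ^ k) / real n) \<longlonglongrightarrow> L + 0"
        by (intro tendsto_add L ln_poly_div_tendsto_0) simp
      then show "(\<lambda>n. ln (c n) / real n + ln (10 * (real n + 1) ^ k) / real n) \<longlonglongrightarrow> L" by simp
      have "ln (c n) - ln 2 \<le> ln (P n)" for n
      proof -
        have "ln (c n / 2) \<le> ln (P n)" using lo[of n] cpos[of n] Ppos[of n] by (subst ln_le_cancel_iff) (auto simp: c_def)
        then show ?thesis using cpos[of n] by (simp add: ln_div)
      qed
      then show "\<forall>\<^sub>F n in sequentially. ln (c n) / real n - ln 2 / real n \<le> ln (P n) / real n"
        by (auto simp: divide_right_mono simp flip: diff_divide_distrib)
      have "ln (P n) \<le> ln (c n) + ln (10 * (real n + 1) ^ k)" for n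
      proof -
        have "(1::real) \<le> (real n + 1) ^ k" by (intro one_le_power) simp
        then have "5 * ((real n + 1) ^ k + 1) * c n \<le> 10 * (real n + 1) ^ k * c n"
          using c0 by (intro mult_right_mono) auto
        then have "P n \<le> c n * (10 * (real n + 1) ^ k)" using up[of n] by (simp add: c_def mult.commute)
        then have "ln (P n) \<le> ln (c n * (10 * (real n + 1) ^ k))" using Ppos[of n] by simp
        also have "\<dots> = ln (c n) + ln (10 * (real n + 1) ^ k)"
          using cpos[of n] by (intro ln_mult_pos) auto
        finally show ?thesis .
      qed
      then show "\<forall>\<^sub>F n in sequentially. ln (P n) / real n \<le> ln (c n) / real n + ln (10 * (real n + 1) ^ k) / real n"
        by (auto simp: divide_right_mono simp flip: add_divide_distrib)
    qed
    then show ?thesis using Ppos by (auto simp: P_def)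
  qed
qed

theorem theorem5p5:
  fixes G :: "('g, 'b) monoid_scheme" and TG :: "'g topology"
    and u :: "'g \<Rightarrow> complex mat" and d :: nat and \<rho>0 \<rho>1 :: "complex mat"
  assumes grp: "group G"
    and top: "topspace TG = carrier G" "compact_space TG" "Hausdorff_space TG"
    and mult_cont: "continuous_map (prod_topology TG TG) TG (\<lambda>(x, y). x \<otimes>\<^bsub>G\<^esub> y)"
    and inv_cont: "continuous_map TG TG (\<lambda>x. inv\<^bsub>G\<^esub> x)"
    and u_unitary: "\<And>g. g \<in> carrier G \<Longrightarrow> unitary_mat d (u g)"
    and u_hom: "\<And>g h. g \<in> carrier G \<Longrightarrow> h \<in> carrier G \<Longrightarrow> u (g \<otimes>\<^bsub>G\<^esub> h) = u g * u h"
    and u_cont: "\<And>i j. i < d \<Longrightarrow> j < d \<Longrightarrow> continuous_map TG euclidean (\<lambda>g. u g $$ (i, j))"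
    and dens0: "density d \<rho>0" and dens1: "density d \<rho>1"
    and inv1: "\<And>g. g \<in> carrier G \<Longrightarrow> \<rho>1 * u g = u g * \<rho>1"
  shows "lim (\<lambda>n. lnE (Pmin_full d \<rho>0 \<rho>1 n) / ereal (real n))
           \<le> liminf (\<lambda>n. lnE (Pmin_inv d u (carrier G) \<rho>0 \<rho>1 n) / ereal (real n))
       \<and> liminf (\<lambda>n. lnE (Pmin_inv d u (carrier G) \<rho>0 \<rho>1 n) / ereal (real n))
           \<le> limsup (\<lambda>n. lnE (Pmin_inv d u (carrier G) \<rho>0 \<rho>1 n) / ereal (real n))
       \<and> limsup (\<lambda>n. lnE (Pmin_inv d u (carrier G) \<rho>0 \<rho>1 n) / ereal (real n))
           \<le> ereal (1/2) * lim (\<lambda>n. lnE (Pmin_full d \<rho>0 \<rho>1 n) / ereal (real n))"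
proof -
  define P where "P n = Pmin_full d \<rho>0 \<rho>1 n" for n
  define R where "R n = Pmin_inv d u (carrier G) \<rho>0 \<rho>1 n" for n
  define f where "f n = lnE (P n) / ereal (real n)" for n
  define g where "g n = lnE (R n) / ereal (real n)" for n
  have PR: "P n \<le> R n" for n
    unfolding P_def R_def using u_unitary by (intro Pmin_full_le_inv[OF dens0 dens1]) (auto simp: unitary_mat_def)
  have P0: "0 \<le> P n" for n unfolding P_def by (rule Pmin_full_nonneg[OF dens0 dens1])
  have RP: "R n \<le> (2 * (real n + 1) ^ (d * d) + 6) * sqrt (P n)" for n
    unfolding P_def R_def by (rule Pmin_inv_le_sqrt[OF dens0 dens1 grp u_unitary u_hom inv1])
  have fg: "f n \<le> g n" for n
  proof (cases "n = 0")
    case False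
    then show ?thesis unfolding f_def g_def using lnE_mono[OF P0 PR, of n] by (intro ereal_divide_right_mono) auto
  next
    \<comment> \<open>At \<open>n = 0\<close> the quotient is a product with
      \<open>inverse 0 = \<infinity>\<close>, so the comparison is made by cases.\<close>
    case True
    then show ?thesis unfolding f_def g_def using lnE_mono[OF P0 PR, of n]
      by (cases "lnE (P n)"; cases "lnE (R n)") (auto simp: divide_ereal_def)
  qed
  have main: "lim f \<le> liminf g \<and> limsup g \<le> ereal (1/2) * lim f"
    using Pmin_full_limit[OF dens0 dens1]
  proof
    assume z: "\<forall>n>0. Pmin_full d \<rho>0 \<rho>1 n = 0"
    have ev: "\<forall>\<^sub>F n in sequentially. f n = - \<infinity> \<and> g n = - \<infinity>"
    proof (rule eventually_sequentiallyI[of 1])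
      fix n :: nat assume "1 \<le> n"
      then have n: "n > 0" by simp
      then have "P n = 0" using z by (simp add: P_def)
      \<comment> \<open>The square-root bound forces the invariant error to vanish along with the
        full one.\<close>
      moreover from this have "R n = 0" using RP[of n] PR[of n] by simp
      ultimately show "f n = - \<infinity> \<and> g n = - \<infinity>" using n by (simp add: f_def g_def lnE_def divide_ereal_def)
    qed
    then have "f \<longlonglongrightarrow> - \<infinity>" by (intro tendsto_eventually) (auto elim: eventually_mono)
    moreover have "g \<longlonglongrightarrow> - \<infinity>" using ev by (intro tendsto_eventually) (auto elim: eventually_mono)
    ultimately have "lim f = - \<infinity>" "limsup g = - \<infinity>" by (simp_all add: limI lim_imp_Limsup)
    then show ?thesis by simp
  next
    assume "(\<forall>n. 0 < Pmin_full d \<rho>0 \<rho>1 n) \<and> (\<exists>L. (\<lambda>n. ln (Pmin_full d \<rho>0 \<rho>1 n) / real n) \<longlonglongrightarrow> L)"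
    then obtain L where Pp: "\<And>n. 0 < P n" and L: "(\<lambda>n. ln (P n) / real n) \<longlonglongrightarrow> L" by (auto simp: P_def)
    have Rp: "0 < R n" for n using Pp[of n] PR[of n] by linarith
    have "(\<lambda>n. ereal (ln (P n) / real n)) \<longlonglongrightarrow> ereal L" using L by (rule tendsto_ereal)
    moreover have "\<forall>\<^sub>F n in sequentially. ereal (ln (P n) / real n) = f n"
      by (rule eventually_sequentiallyI[of 1]) (use Pp in \<open>auto simp: f_def lnE_def less_imp_neq[symmetric]\<close>)
    ultimately have fl: "f \<longlonglongrightarrow> ereal L" by (rule Lim_transform_eventually)
    then have lf: "lim f = ereal L" by (rule limI)
    have "ereal L = liminf f" using fl by (simp add: lim_imp_Liminf)
    also have "\<dots> \<le> liminf g" using fg by (intro Liminf_mono) auto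
    finally have 1: "ereal L \<le> liminf g" .
    \<comment> \<open>The logarithm of the square-root bound divided by \<open>n\<close>; the factor
      \<open>1/2\<close> is that of \<open>ln (sqrt (P n))\<close>, and \<open>8\<close> absorbs
      \<open>2 * x + 6\<close> for \<open>x \<ge> 1\<close>.\<close>
    define h where "h n = ln (8 * (real n + 1) ^ (d * d)) / real n + (1/2) * (ln (P n) / real n)" for n
    have "h \<longlonglongrightarrow> 0 + (1/2) * L" unfolding h_def by (intro tendsto_intros L ln_poly_div_tendsto_0) simp
    then have hl: "(\<lambda>n. ereal (h n)) \<longlonglongrightarrow> ereal ((1/2) * L)" by (intro tendsto_ereal) simp
    have "\<forall>\<^sub>F n in sequentially. g n \<le> ereal (h n)"
    proof (rule eventually_sequentiallyI[of 1])
      fix n :: nat assume n: "1 \<le> n"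
      have "(1::real) \<le> (real n + 1) ^ (d * d)" by (intro one_le_power) simp
      then have "(2 * (real n + 1) ^ (d * d) + 6) * sqrt (P n) \<le> (8 * (real n + 1) ^ (d * d)) * sqrt (P n)"
        using P0[of n] by (intro mult_right_mono) auto
      then have "R n \<le> (8 * (real n + 1) ^ (d * d)) * sqrt (P n)" using RP[of n] by linarith
      then have "ln (R n) \<le> ln ((8 * (real n + 1) ^ (d * d)) * sqrt (P n))" using Rp[of n] Pp[of n] by simp
      also have "\<dots> = ln (8 * (real n + 1) ^ (d * d)) + ln (sqrt (P n))"
        by (rule ln_mult_pos) (use Pp[of n] in auto)
      also have "ln (sqrt (P n)) = ln (P n) / 2" using Pp[of n] by (simp add: ln_sqrt)
      finally have "ln (R n) / real n \<le> (ln (8 * (real n + 1) ^ (d * d)) + ln (P n) / 2) / real n"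
        by (rule divide_right_mono) simp
      then have "ln (R n) / real n \<le> h n" by (simp add: h_def add_divide_distrib)
      then show "g n \<le> ereal (h n)" using n Rp[of n] by (simp add: g_def lnE_def)
    qed
    then have "limsup g \<le> limsup (\<lambda>n. ereal (h n))" by (rule Limsup_mono)
    also have "\<dots> = ereal ((1/2) * L)" using hl by (simp add: lim_imp_Limsup)
    finally show ?thesis using 1 by (simp add: lf)
  qed
  moreover have "liminf g \<le> limsup g" by (rule Liminf_le_Limsup) simp
  ultimately show ?thesis unfolding f_def g_def P_def R_def by blast
qed

end
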